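(* Let $\mathbf u_1\ne\mathbf u_2$ be two quasi-static elastic deformations satisfying $$\nabla(\lambda\nabla\cdot\mathbf u_k)+2\nabla\cdot(\mu\,\varepsilon(\mathbf u_k))=\mathbf F_k\ \text{ in }\Omega,\qquad \mathbf u_k|_{\partial\Omega}=0,\qquad k=1,2,$$ with different force terms $\mathbf F_1,\mathbf F_2$. Suppose that for all $\mathbf x\in\Omega$ one has $\det(\varepsilon(\mathbf u_k(\mathbf x)))\neq0$ for at least one $k\in\{1,2\}$. Let $\mathcal A_\mu^{(2)}(\delta\mu,\delta\mathbf u_1,\delta\mathbf u_2)$ be the corresponding linearized operator for two measurements. Then $$\ker(\mathcal A_\mu^{(2)})=\{(0,0,0)\}.$$
   Context: Setting. $l>0$ is an integer with $2l>n$, where $n=3$; $\Omega\subset\mathbb R^3$ is a bounded connected domain with $C^{l+2}$ boundary; $H^s=W^s_2$. $\varepsilon(\mathbf u)=\frac12(\nabla\mathbf u+\nabla\mathbf u^\top)$; the divergence of a matrix field is taken column-wise. $\lambda,\mu$ are the Lamé parameter and shear modulus of the reference state (the same for both experiments), with $\mu\in H^{l+1}(\Omega)$, and $\mathbf u_1,\mathbf u_2\in H^{l+2}(\Omega)^3$. Quasi-static means no time dependence, so all time derivatives and initial conditions are absent. Operator. For $\delta\mu\in H^{l+1}(\Omega)$ and $\delta\mathbf u_1,\delta\mathbf u_2\in H^{l+2}(\Omega)^3$, $$\mathcal A_\mu^{(2)}(\delta\mu,\delta\mathbf u_1,\delta\mathbf u_2)=\begin{pmatrix}2\nabla\cdot(\delta\mu\,\varepsilon(\mathbf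 u_1))+2\nabla\cdot(\mu\,\varepsilon(\delta\mathbf u_1))\\ \delta\mathbf u_1\\ \delta\mathbf u_1|_{\partial\Omega}\\ 2\nabla\cdot(\delta\mu\,\varepsilon(\mathbf u_2))+2\nabla\cdot(\mu\,\varepsilon(\delta\mathbf u_2))\\ \delta\mathbf u_2\\ \delta\mathbf u_2|_{\partial\Omega}\end{pmatrix}.$$ *)

theory Defs
  imports "HOL-Analysis.Analysis"
begin

text \<open>
  Elements of function spaces on \<open>\<Omega>\<close> are represented by functions on the whole space; only
  their values on \<open>\<Omega>\<close>, up to Lebesgue null sets, matter.
\<close>

definition ae_eq :: "(real^'n) set \<Rightarrow> (real^'n \<Rightarrow> 'b) \<Rightarrow> (real^'n \<Rightarrow> 'b) \<Rightarrow> bool" where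
  "ae_eq \<Omega> f g \<longleftrightarrow> (AE x in lebesgue_on \<Omega>. f x = g x)"

definition partial_deriv :: "'n \<Rightarrow> (real^'n \<Rightarrow> real) \<Rightarrow> real^'n \<Rightarrow> real" where
  "partial_deriv i f x = frechet_derivative f (at x) (axis i 1)"

primrec partial_derivs :: "'n list \<Rightarrow> (real^'n \<Rightarrow> real) \<Rightarrow> real^'n \<Rightarrow> real" where
  "partial_derivs [] f = f"
| "partial_derivs (i # is) f = partial_deriv i (partial_derivs is f)"

text \<open>Meant for open \<open>U\<close>.\<close>

primrec Ck_on :: "nat \<Rightarrow> (real^'n) set \<Rightarrow> (real^'n \<Rightarrow> real) \<Rightarrow> bool" where
  "Ck_on 0 U f \<longleftrightarrow> continuous_on U f"
| "Ck_on (Suc k) U f \<longleftrightarrow>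
     (\<forall>x\<in>U. f differentiable (at x)) \<and> (\<forall>i. Ck_on k U (partial_deriv i f))"

definition Ck_map_on :: "nat \<Rightarrow> (real^'n) set \<Rightarrow> (real^'n \<Rightarrow> real^'m) \<Rightarrow> bool" where
  "Ck_map_on k U f \<longleftrightarrow> (\<forall>i. Ck_on k U (\<lambda>x. f x $ i))"

text \<open>
  The boundary is of class \<open>C\<^sup>k\<close> if near each of its points a \<open>C\<^sup>k\<close> diffeomorphism maps the
  domain to a half space and the boundary to the bounding hyperplane.
\<close>

definition Ck_boundary :: "nat \<Rightarrow> (real^'n) set \<Rightarrow> bool" where
  "Ck_boundary k \<Omega> \<longleftrightarrow>
     (\<forall>p\<in>frontier \<Omega>. \<exists>U V (\<psi> :: real^'n \<Rightarrow> real^'n) \<psi>' j. open U \<and> p \<in> U \<and> open V \<and>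
        homeomorphism U V \<psi> \<psi>' \<and> Ck_map_on k U \<psi> \<and> Ck_map_on k V \<psi>' \<and>
        \<psi> ` (U \<inter> \<Omega>) = {y \<in> V. y $ j > 0} \<and>
        \<psi> ` (U \<inter> frontier \<Omega>) = {y \<in> V. y $ j = 0})"

definition bounded_Ck_domain :: "nat \<Rightarrow> (real^'n) set \<Rightarrow> bool" where
  "bounded_Ck_domain k \<Omega> \<longleftrightarrow>
     open \<Omega> \<and> connected \<Omega> \<and> \<Omega> \<noteq> {} \<and> bounded \<Omega> \<and> Ck_boundary k \<Omega>"

definition test_functions :: "(real^'n) set \<Rightarrow> (real^'n \<Rightarrow> real) set" where
  "test_functions \<Omega> =
     {\<phi>. (\<forall>k. Ck_on k UNIV \<phi>) \<and> (\<exists>K. compact K \<and> K \<subseteq> \<Omega> \<and> (\<forall>x. x \<notin> K \<longrightarrow> \<phi> x = 0))}"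

definition L1_loc :: "(real^'n) set \<Rightarrow> (real^'n \<Rightarrow> real) set" where
  "L1_loc \<Omega> = {f. \<forall>K. compact K \<and> K \<subseteq> \<Omega> \<longrightarrow> integrable (lebesgue_on K) f}"

definition L2 :: "(real^'n) set \<Rightarrow> (real^'n \<Rightarrow> real) set" where
  "L2 \<Omega> = {f. f \<in> borel_measurable (lebesgue_on \<Omega>) \<and>
              integrable (lebesgue_on \<Omega>) (\<lambda>x. (f x)\<^sup>2)}"

text \<open>
  Multi-indices are represented by lists of coordinate directions; since partial derivatives
  of test functions commute, the order of the list is irrelevant.
\<close>

definition has_weak_deriv ::
  "(real^'n) set \<Rightarrow> 'n list \<Rightarrow> (real^'n \<Rightarrow> real) \<Rightarrow> (real^'n \<Rightarrow> real) \<Rightarrow> bool" where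
  "has_weak_deriv \<Omega> is f g \<longleftrightarrow> f \<in> L1_loc \<Omega> \<and> g \<in> L1_loc \<Omega> \<and>
     (\<forall>\<phi>\<in>test_functions \<Omega>.
        (LINT x|lebesgue_on \<Omega>. f x * partial_derivs is \<phi> x)
          = (-1) ^ length is * (LINT x|lebesgue_on \<Omega>. g x * \<phi> x))"

definition sobolev :: "nat \<Rightarrow> (real^'n) set \<Rightarrow> (real^'n \<Rightarrow> real) set" where
  "sobolev k \<Omega> = {f \<in> L2 \<Omega>. \<forall>is. length is \<le> k \<longrightarrow> (\<exists>g\<in>L2 \<Omega>. has_weak_deriv \<Omega> is f g)}"

definition sobolev_vec :: "nat \<Rightarrow> (real^'n) set \<Rightarrow> (real^'n \<Rightarrow> real^'m) set" where
  "sobolev_vec k \<Omega> = {u. \<forall>i. (\<lambda>x. u x $ i) \<in> sobolev k \<Omega>}"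

text \<open>Weak derivatives are determined only up to null sets.\<close>

definition weak_partial :: "(real^'n) set \<Rightarrow> 'n \<Rightarrow> (real^'n \<Rightarrow> real) \<Rightarrow> real^'n \<Rightarrow> real" where
  "weak_partial \<Omega> i f = (SOME g. has_weak_deriv \<Omega> [i] f g)"

definition weak_grad :: "(real^'n) set \<Rightarrow> (real^'n \<Rightarrow> real) \<Rightarrow> real^'n \<Rightarrow> real^'n" where
  "weak_grad \<Omega> f x = (\<chi> i. weak_partial \<Omega> i f x)"

definition weak_div :: "(real^'n) set \<Rightarrow> (real^'n \<Rightarrow> real^'n) \<Rightarrow> real^'n \<Rightarrow> real" where
  "weak_div \<Omega> u x = (\<Sum>i\<in>UNIV. weak_partial \<Omega> i (\<lambda>y. u y $ i) x)"

text \<open>Column-wise divergence of a matrix field; \<open>M y $ i $ j\<close> is the entry in row \<open>i\<close>, column \<open>j\<close>.\<close>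

definition weak_div_mat :: "(real^'n) set \<Rightarrow> (real^'n \<Rightarrow> real^'n^'n) \<Rightarrow> real^'n \<Rightarrow> real^'n" where
  "weak_div_mat \<Omega> M x = (\<chi> j. \<Sum>i\<in>UNIV. weak_partial \<Omega> i (\<lambda>y. M y $ i $ j) x)"

definition strain :: "(real^'n) set \<Rightarrow> (real^'n \<Rightarrow> real^'n) \<Rightarrow> real^'n \<Rightarrow> real^'n^'n" where
  "strain \<Omega> u x = (\<chi> i j.
     (weak_partial \<Omega> i (\<lambda>y. u y $ j) x + weak_partial \<Omega> j (\<lambda>y. u y $ i) x) / 2)"

text \<open>
  Pointwise values of Sobolev functions are those of the continuous representative. It is
  unique on open \<open>\<Omega>\<close>, and for the Sobolev orders used here it exists and extends continuously
  to the closure by the Sobolev embedding theorem.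
\<close>

definition cont_rep :: "(real^'n) set \<Rightarrow> (real^'n \<Rightarrow> 'b::topological_space) \<Rightarrow> real^'n \<Rightarrow> 'b" where
  "cont_rep \<Omega> f = (SOME g. continuous_on \<Omega> g \<and> ae_eq \<Omega> g f)"

definition has_boundary_trace ::
  "(real^'n) set \<Rightarrow> (real^'n \<Rightarrow> real^'m) \<Rightarrow> (real^'n \<Rightarrow> real^'m) \<Rightarrow> bool" where
  "has_boundary_trace \<Omega> u g \<longleftrightarrow>
     (\<forall>p\<in>frontier \<Omega>. (cont_rep \<Omega> u \<longlongrightarrow> g p) (at p within \<Omega>))"

definition boundary_trace ::
  "(real^'n) set \<Rightarrow> (real^'n \<Rightarrow> real^'m) \<Rightarrow> real^'n \<Rightarrow> real^'m" where
  "boundary_trace \<Omega> u p = Lim (at p within \<Omega>) (cont_rep \<Omega> u)"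

text \<open>
  No regularity of \<open>\<lambda>\<close> is prescribed beyond what gives \<open>\<nabla>(\<lambda> \<nabla>\<cdot>u)\<close> a meaning; for
  \<open>\<mu> \<in> H\<^sup>1\<close> and \<open>u \<in> H\<^sup>2\<close> the term \<open>\<nabla>\<cdot>(\<mu> \<epsilon>(u))\<close> always exists, by the product rule.
\<close>

definition quasi_static_deformation ::
  "(real^'n) set \<Rightarrow> (real^'n \<Rightarrow> real) \<Rightarrow> (real^'n \<Rightarrow> real) \<Rightarrow> (real^'n \<Rightarrow> real^'n)
     \<Rightarrow> (real^'n \<Rightarrow> real^'n) \<Rightarrow> bool" where
  "quasi_static_deformation \<Omega> lam \<mu> F u \<longleftrightarrow>
     (\<forall>i. \<exists>g. has_weak_deriv \<Omega> [i] (\<lambda>x. lam x * weak_div \<Omega> u x) g) \<and>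
     ae_eq \<Omega> (\<lambda>x. weak_grad \<Omega> (\<lambda>y. lam y * weak_div \<Omega> u y) x
                + 2 *\<^sub>R weak_div_mat \<Omega> (\<lambda>y. \<mu> y *\<^sub>R strain \<Omega> u y) x) F \<and>
     has_boundary_trace \<Omega> u (\<lambda>_. 0)"

definition linearized_op ::
  "(real^'n) set \<Rightarrow> (real^'n \<Rightarrow> real) \<Rightarrow> (real^'n \<Rightarrow> real^'n) \<Rightarrow> (real^'n \<Rightarrow> real^'n)
     \<Rightarrow> (real^'n \<Rightarrow> real) \<times> (real^'n \<Rightarrow> real^'n) \<times> (real^'n \<Rightarrow> real^'n)
     \<Rightarrow> (real^'n \<Rightarrow> real^'n) \<times> (real^'n \<Rightarrow> real^'n) \<times> (real^'n \<Rightarrow> real^'n)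
       \<times> (real^'n \<Rightarrow> real^'n) \<times> (real^'n \<Rightarrow> real^'n) \<times> (real^'n \<Rightarrow> real^'n)" where
  "linearized_op \<Omega> \<mu> u\<^sub>1 u\<^sub>2 = (\<lambda>(m, v\<^sub>1, v\<^sub>2).
     (\<lambda>x. 2 *\<^sub>R weak_div_mat \<Omega> (\<lambda>y. m y *\<^sub>R strain \<Omega> u\<^sub>1 y) x
          + 2 *\<^sub>R weak_div_mat \<Omega> (\<lambda>y. \<mu> y *\<^sub>R strain \<Omega> v\<^sub>1 y) x,
      v\<^sub>1,
      boundary_trace \<Omega> v\<^sub>1,
      \<lambda>x. 2 *\<^sub>R weak_div_mat \<Omega> (\<lambda>y. m y *\<^sub>R strain \<Omega> u\<^sub>2 y) x
          + 2 *\<^sub>R weak_div_mat \<Omega> (\<lambda>y. \<mu> y *\<^sub>R strain \<Omega> v\<^sub>2 y) x,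
      v\<^sub>2,
      boundary_trace \<Omega> v\<^sub>2))"

definition linearized_dom ::
  "nat \<Rightarrow> (real^'n) set
     \<Rightarrow> ((real^'n \<Rightarrow> real) \<times> (real^'n \<Rightarrow> real^'n) \<times> (real^'n \<Rightarrow> real^'n)) set" where
  "linearized_dom l \<Omega> = sobolev (l+1) \<Omega> \<times> sobolev_vec (l+2) \<Omega> \<times> sobolev_vec (l+2) \<Omega>"

text \<open>Fields on \<open>\<Omega>\<close> vanish almost everywhere, the continuous traces everywhere on the boundary.\<close>

definition linearized_ker ::
  "nat \<Rightarrow> (real^'n) set \<Rightarrow> (real^'n \<Rightarrow> real) \<Rightarrow> (real^'n \<Rightarrow> real^'n) \<Rightarrow> (real^'n \<Rightarrow> real^'n)
     \<Rightarrow> ((real^'n \<Rightarrow> real) \<times> (real^'n \<Rightarrow> real^'n) \<times> (real^'n \<Rightarrow> real^'n)) set" where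
  "linearized_ker l \<Omega> \<mu> u\<^sub>1 u\<^sub>2 =
     {w \<in> linearized_dom l \<Omega>.
        (case linearized_op \<Omega> \<mu> u\<^sub>1 u\<^sub>2 w of (f\<^sub>1, w\<^sub>1, b\<^sub>1, f\<^sub>2, w\<^sub>2, b\<^sub>2) \<Rightarrow>
           ae_eq \<Omega> f\<^sub>1 (\<lambda>_. 0) \<and> ae_eq \<Omega> w\<^sub>1 (\<lambda>_. 0) \<and> (\<forall>p\<in>frontier \<Omega>. b\<^sub>1 p = 0) \<and>
           ae_eq \<Omega> f\<^sub>2 (\<lambda>_. 0) \<and> ae_eq \<Omega> w\<^sub>2 (\<lambda>_. 0) \<and> (\<forall>p\<in>frontier \<Omega>. b\<^sub>2 p = 0))}"

text \<open>All representatives of the zero element \<open>(0, 0, 0)\<close>.\<close>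

definition zero_triple ::
  "nat \<Rightarrow> (real^'n) set
     \<Rightarrow> ((real^'n \<Rightarrow> real) \<times> (real^'n \<Rightarrow> real^'n) \<times> (real^'n \<Rightarrow> real^'n)) set" where
  "zero_triple l \<Omega> =
     {(m, v\<^sub>1, v\<^sub>2) \<in> linearized_dom l \<Omega>.
        ae_eq \<Omega> m (\<lambda>_. 0) \<and> ae_eq \<Omega> v\<^sub>1 (\<lambda>_. 0) \<and> ae_eq \<Omega> v\<^sub>2 (\<lambda>_. 0)}"

end

theory Submission
  imports Defs
begin

text \<open>
  An element \<open>(m, v\<^sub>1, v\<^sub>2)\<close> of the kernel has \<open>v\<^sub>1 = v\<^sub>2 = 0\<close>, and then the remaining equations say
  that the fields \<open>m \<epsilon>(u\<^sub>k)\<close> are divergence free. So the point is that \<open>m\<close> vanishes. Formally, with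
  \<open>u\<close> one of the two deformations and \<open>\<epsilon>\<close> its strain, the equation \<open>\<nabla>\<cdot>(m \<epsilon>) = 0\<close> is multiplied by
  \<open>sgn(m) u\<close> and integrated by parts. There is no boundary term since \<open>u = 0\<close> on the boundary, the
  derivative of \<open>sgn(m)\<close> does not contribute since it carries the factor \<open>m\<close>, and the symmetry of
  \<open>\<epsilon>\<close> leaves \<open>\<integral> \<bar>m\<bar> \<bar>\<epsilon>\<bar>\<^sup>2 = 0\<close>. Hence \<open>m \<epsilon>(u\<^sub>k) = 0\<close> in \<open>\<Omega>\<close> for both \<open>k\<close>, and since at every point
  one of the two strains has a nonzero determinant, \<open>m = 0\<close>.

  To make this rigorous, \<open>u\<close> is multiplied by a cutoff of \<open>\<bar>u\<bar>\<^sup>2\<close>, which gives it compact support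
  because \<open>u\<close> tends to zero at the boundary, and the sign is replaced by a smooth function \<open>\<theta>\<close>. The
  equation gives \<open>\<epsilon> \<nabla>m = - m \<nabla>\<cdot>\<epsilon>\<close>, so that the derivative of \<open>\<theta>(m)\<close> contributes
  \<open>m\<^sup>2 \<theta>'(m) u \<cdot> (\<nabla>\<cdot>\<epsilon>)\<close>, which is small without any bound on \<open>\<nabla>m\<close> (\<open>energy_identity\<close>,
  \<open>sgn_approx_bounds\<close>). The cutoff is removed first and the smoothing of the sign second
  (\<open>limit_identity\<close>, \<open>weighted_strain_eq_0\<close>).

  All of this is classical calculus, because in dimension three functions in \<open>H\<^sup>2\<close> are locally
  continuous (\<open>ex_mollify_limit\<close>), so that \<open>m \<in> H\<^sup>3\<close> and \<open>\<epsilon> \<in> H\<^sup>3\<close> are continuously differentiable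
  (\<open>mollify_limit_C1_along\<close>). The embedding rests on a kernel whose rescalings are generated by the
  Laplacian: the mollifications of \<open>f\<close> at the scales \<open>4 ^ - k\<close> and \<open>4 ^ - (k + 1)\<close> differ by an
  integral of the second derivatives of \<open>f\<close> against a kernel with an \<open>L\<^sup>2\<close> norm of order \<open>2 ^ - k\<close>
  (\<open>mollify_dyadic_bound\<close>). The passage between weak and classical derivatives is
  \<open>weak_deriv_unique\<close> and \<open>C1_along_imp_has_weak_deriv\<close>.
\<close>

section \<open>Explicit test functions\<close>

text \<open>The exponent \<open>n\<close> makes the family closed under differentiation, so that smoothness needs only
  first derivatives.\<close>

definition hump :: "nat \<Rightarrow> real \<Rightarrow> real" where
  "hump n t = (if t \<le> 0 then 0 else exp (- (1 / t)) / t ^ n)"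

lemma hump_nonneg: "0 \<le> hump n t"
  by (auto simp: hump_def)

lemma hump_le_fact: "hump n t \<le> fact n"
proof (cases "t \<le> 0")
  case False
  then have t: "t > 0" by simp
  have "(\<Sum>k\<le>n. (1/t) ^ k / fact k) \<le> exp (1/t)"
    unfolding exp_def using t summable_exp_generic[of "1/t"]
    by (intro order.trans[OF sum_le_suminf]) (auto simp: divide_inverse mult.commute scaleR_conv_of_real)
  moreover have "(1/t) ^ n / fact n \<le> (\<Sum>k\<le>n. (1/t) ^ k / fact k)"
    using t by (intro member_le_sum) auto
  ultimately have "(1/t) ^ n / fact n \<le> exp (1/t)" by linarith
  then have "(1/t) ^ n \<le> fact n * exp (1/t)"
    by (subst (asm) pos_divide_le_eq) (auto simp: mult.commute)
  then show ?thesis using t by (simp add: hump_def exp_minus field_simps power_one_over)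
qed (simp add: hump_def)

lemma has_real_derivative_hump:
  "(hump n has_real_derivative hump (n + 2) t - real n * hump (n + 1) t) (at t)"
proof (cases t "0::real" rule: linorder_cases)
  case less
  have "((\<lambda>_. 0::real) has_real_derivative 0) (at t)" by simp
  then show ?thesis using less
    by (subst has_field_derivative_cong_eventually[where g = "\<lambda>_. 0"])
      (auto simp: hump_def eventually_at_topological intro!: exI[of _ "{..<0}"])
next
  case equal
  have "((\<lambda>h. hump n h / h) \<longlongrightarrow> 0) (at 0)"
  proof (rule Lim_null_comparison)
    show "\<forall>\<^sub>F h in at 0. norm (hump n h / h) \<le> fact (n + 2) * \<bar>h\<bar>"
    proof (rule always_eventually, rule allI)
      fix h :: real
      show "norm (hump n h / h) \<le> fact (n + 2) * \<bar>h\<bar>"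
      proof (cases "h \<le> 0")
        case False
        then have "hump n h / h = hump (n + 2) h * h"
          by (simp add: hump_def field_simps power2_eq_square)
        also have "\<dots> \<le> fact (n + 2) * h"
          using False hump_le_fact[of "n+2" h] by (intro mult_right_mono) auto
        finally show ?thesis using False hump_nonneg[of n h] by simp
      next
        case True
        then have "norm (hump n h / h) = 0" by (simp add: hump_def)
        moreover have "0 \<le> fact (n + 2) * \<bar>h\<bar>" by (intro mult_nonneg_nonneg) auto
        ultimately show ?thesis by linarith
      qed
    qed
    show "((\<lambda>h. fact (n + 2) * \<bar>h\<bar>) \<longlongrightarrow> 0) (at (0::real))"
      by (auto intro!: tendsto_eq_intros)
  qed
  then show ?thesis using equal by (simp add: DERIV_def hump_def)
next
  case greater
  have "((\<lambda>t. exp (- (1 / t)) / t ^ n) has_real_derivative hump (n + 2) t - real n * hump (n + 1) t) (at t)"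
    using greater
    by (auto intro!: derivative_eq_intros simp: hump_def)
       (cases n; cases "n - 1"; simp add: divide_simps power2_eq_square algebra_simps)
  moreover have "\<forall>\<^sub>F x in nhds t. hump n x = exp (- (1 / x)) / x ^ n"
    using greater by (auto simp: hump_def eventually_nhds intro!: exI[of _ "{0<..}"])
  ultimately show ?thesis
    by (subst has_field_derivative_cong_ev[OF refl, where g = "\<lambda>t. exp (- (1 / t)) / t ^ n"]) auto
qed

lemma continuous_on_hump [continuous_intros]:
  "continuous_on S f \<Longrightarrow> continuous_on S (\<lambda>x. hump n (f x))"
proof -
  have "continuous_on UNIV (hump n)"
    by (meson DERIV_isCont continuous_at_imp_continuous_on has_real_derivative_hump)
  then show "continuous_on S f \<Longrightarrow> continuous_on S (\<lambda>x. hump n (f x))"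
    by (rule continuous_on_compose2) auto
qed

lemma partial_deriv_has_derivative:
  "(f has_derivative f') (at x) \<Longrightarrow> partial_deriv i f x = f' (axis i 1)"
  by (simp add: partial_deriv_def frechet_derivative_at[symmetric])

lemma Ck_on_Suc_imp: "Ck_on (Suc k) U f \<Longrightarrow> Ck_on k U f"
proof (induction k arbitrary: f)
  case 0
  then show ?case
    by (simp add: continuous_at_imp_continuous_on differentiable_imp_continuous_within)
next
  case (Suc k)
  have "Ck_on k U (partial_deriv i f)" for i
    using Suc.prems by (intro Suc.IH) simp
  then show ?case using Suc.prems by (simp only: Ck_on.simps) blast
qed

lemma Ck_on_const: "Ck_on k UNIV (\<lambda>x. c)"
proof (induction k arbitrary: c)
  case (Suc k)
  have "partial_deriv i (\<lambda>x. c) = (\<lambda>x. 0)" for i :: 'a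
    by (rule ext, subst partial_deriv_has_derivative[OF has_derivative_const]) simp
  then show ?case using Suc by simp
qed simp

lemma Ck_on_nth: "Ck_on k UNIV (\<lambda>x. x $ i)"
proof (cases k)
  case (Suc k')
  have "partial_deriv j (\<lambda>x. x $ i) = (\<lambda>x. axis j 1 $ i)" for j :: 'a
    by (rule ext, subst partial_deriv_has_derivative[where f' = "\<lambda>h. h $ i"])
      (auto intro!: bounded_linear_imp_has_derivative)
  then show ?thesis
    by (auto simp: Suc Ck_on_const intro!: bounded_linear_imp_differentiable)
qed (auto intro!: continuous_intros)

lemma Ck_on_add:
  assumes "Ck_on k UNIV f" "Ck_on k UNIV g"
  shows "Ck_on k UNIV (\<lambda>x. f x + g x)"
  using assms
proof (induction k arbitrary: f g)
  case (Suc k)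
  have "partial_deriv i (\<lambda>x. f x + g x) = (\<lambda>x. partial_deriv i f x + partial_deriv i g x)" for i
    using Suc.prems
    by (intro ext, subst partial_deriv_has_derivative[OF has_derivative_add])
      (auto simp: partial_deriv_def frechet_derivative_works[symmetric])
  then show ?case using Suc by (auto intro!: differentiable_add)
qed (auto intro!: continuous_intros)

lemma Ck_on_mult:
  assumes "Ck_on k UNIV f" "Ck_on k UNIV g"
  shows "Ck_on k UNIV (\<lambda>x. f x * g x)"
  using assms
proof (induction k arbitrary: f g)
  case (Suc k)
  have "partial_deriv i (\<lambda>x. f x * g x) = (\<lambda>x. f x * partial_deriv i g x + partial_deriv i f x * g x)" for i
    using Suc.prems
    by (intro ext, subst partial_deriv_has_derivative[OF has_derivative_mult])
      (auto simp: partial_deriv_def frechet_derivative_works[symmetric])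
  moreover have "Ck_on k UNIV f" "Ck_on k UNIV g"
    using Suc.prems Ck_on_Suc_imp by blast+
  ultimately show ?case using Suc by (auto intro!: differentiable_mult Ck_on_add)
qed (auto intro!: continuous_intros)

definition bump :: "nat \<Rightarrow> real \<Rightarrow> real^'n \<Rightarrow> real^'n \<Rightarrow> real" where
  "bump n s x y = hump n (1 - (norm (y - x))\<^sup>2 / s\<^sup>2)"

lemma bump_nonneg: "0 \<le> bump n s x y"
  by (simp add: bump_def hump_nonneg)

lemma bump_le: "bump n s x y \<le> fact n"
  by (simp add: bump_def hump_le_fact)

lemma continuous_on_bump [continuous_intros]:
  "continuous_on S f \<Longrightarrow> continuous_on S g \<Longrightarrow> continuous_on S (\<lambda>p. bump n s (f p) (g p))"
  unfolding bump_def divide_inverse by (intro continuous_intros)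

lemma bump_measurable [measurable]: "bump n s x \<in> borel_measurable borel"
  by (intro borel_measurable_continuous_onI continuous_intros)

lemma bump_commute: "bump n s x y = bump n s y x"
  by (simp add: bump_def norm_minus_commute)

lemma has_derivative_bump:
  "(bump n s x has_derivative (\<lambda>h. (bump (n + 2) s x y - real n * bump (n + 1) s x y) * (- 2 / s\<^sup>2 * ((y - x) \<bullet> h)))) (at y)"
proof -
  have "((\<lambda>y. 1 - ((y - x) \<bullet> (y - x)) / s\<^sup>2) has_derivative (\<lambda>h. - 2 / s\<^sup>2 * ((y - x) \<bullet> h))) (at y)"
    by (auto intro!: derivative_eq_intros simp: inner_commute fun_eq_iff divide_inverse algebra_simps)
  then have "((\<lambda>y. hump n (1 - ((y - x) \<bullet> (y - x)) / s\<^sup>2)) has_derivative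
      (\<lambda>h. (- 2 / s\<^sup>2 * ((y - x) \<bullet> h)) * (bump (n + 2) s x y - real n * bump (n + 1) s x y))) (at y)"
    unfolding bump_def power2_norm_eq_inner
    by (rule DERIV_compose_FDERIV[OF has_real_derivative_hump])
  then show ?thesis by (simp add: bump_def[abs_def] power2_norm_eq_inner mult.commute)
qed

lemma partial_deriv_bump:
  "partial_deriv i (bump n s x) = (\<lambda>y. (bump (n + 2) s x y - real n * bump (n + 1) s x y) * (- 2 / s\<^sup>2 * (y $ i - x $ i)))"
  by (rule ext, subst partial_deriv_has_derivative[OF has_derivative_bump]) (simp add: inner_axis)

text \<open>A partial derivative of a bump is a combination of bumps times an affine function; induction
  on the order of differentiability therefore has to range over all \<open>n\<close>.\<close>

lemma Ck_on_bump: "Ck_on k UNIV (bump n s x)"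
proof (induction k arbitrary: n)
  case 0
  then show ?case by (auto simp: bump_def[abs_def] divide_inverse intro!: continuous_intros)
next
  case (Suc k)
  have "Ck_on k UNIV (\<lambda>y. (bump (n + 2) s x y + (- real n) * bump (n + 1) s x y) * (- 2 / s\<^sup>2 * (y $ i + (- x $ i))))" for i
    by (intro Ck_on_mult Ck_on_add Ck_on_const Ck_on_nth Suc)
  then show ?case using has_derivative_bump[of n s x]
    by (simp add: partial_deriv_bump) (meson differentiable_def)
qed

lemma bump_eq_0: "s > 0 \<Longrightarrow> y \<notin> cball x s \<Longrightarrow> bump n s x y = 0"
proof -
  assume "s > 0" "y \<notin> cball x s"
  then have "s\<^sup>2 \<le> (norm (y - x))\<^sup>2"
    by (intro power_mono) (auto simp: dist_norm norm_minus_commute)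
  then show ?thesis using \<open>s > 0\<close> by (simp add: bump_def hump_def field_simps)
qed

lemma bump_test: "s > 0 \<Longrightarrow> cball x s \<subseteq> \<Omega> \<Longrightarrow> bump n s x \<in> test_functions \<Omega>"
  unfolding test_functions_def using bump_eq_0[of s _ x n] Ck_on_bump[of _ n s x]
  by (intro CollectI conjI allI exI[of _ "cball x s"] impI) auto

lemma test_Ck: "\<phi> \<in> test_functions \<Omega> \<Longrightarrow> Ck_on k UNIV \<phi>"
  by (simp add: test_functions_def)

lemma test_differentiable: "\<phi> \<in> test_functions \<Omega> \<Longrightarrow> \<phi> differentiable (at x)"
  using test_Ck[of \<phi> \<Omega> "Suc 0"] by simp

lemma test_continuous: "\<phi> \<in> test_functions \<Omega> \<Longrightarrow> continuous_on UNIV \<phi>"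
  using test_Ck[of \<phi> \<Omega> 0] by simp

lemma partial_deriv_test:
  assumes "\<phi> \<in> test_functions \<Omega>"
  shows "partial_deriv i \<phi> \<in> test_functions \<Omega>"
proof -
  obtain K where K: "compact K" "K \<subseteq> \<Omega>" "\<And>x. x \<notin> K \<Longrightarrow> \<phi> x = 0"
    using assms by (auto simp: test_functions_def)
  have "partial_deriv i \<phi> x = 0" if "x \<notin> K" for x
  proof -
    have "(\<phi> has_derivative (\<lambda>_. 0)) (at x)"
      using that K by (intro has_derivative_transform_within_open[OF has_derivative_const, where s = "- K"])
        (auto intro!: open_Compl compact_imp_closed)
    then show ?thesis by (simp add: partial_deriv_has_derivative)
  qed
  moreover have "Ck_on k UNIV (partial_deriv i \<phi>)" for k
    using test_Ck[OF assms, of "Suc k"] by simp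
  ultimately show ?thesis using K by (auto simp: test_functions_def)
qed

lemma partial_derivs_test: "\<phi> \<in> test_functions \<Omega> \<Longrightarrow> partial_derivs is \<phi> \<in> test_functions \<Omega>"
  by (induction "is") (auto intro: partial_deriv_test)

lemma partial_derivs_append: "partial_derivs (is @ js) f = partial_derivs is (partial_derivs js f)"
  by (induction "is") auto

text \<open>Testing against \<open>partial_derivs js \<phi>\<close> peels off the outer derivatives in order, so no
  commutation of partial derivatives is involved.\<close>

lemma has_weak_deriv_append:
  assumes "has_weak_deriv \<Omega> is f g" "has_weak_deriv \<Omega> (is @ js) f h"
  shows "has_weak_deriv \<Omega> js g h"
  unfolding has_weak_deriv_def
proof (intro conjI ballI)
  fix \<phi> assume "\<phi> \<in> test_functions \<Omega>"
  then have "(LINT x|lebesgue_on \<Omega>. f x * partial_derivs is (partial_derivs js \<phi>) x)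
      = (-1) ^ length is * (LINT x|lebesgue_on \<Omega>. g x * partial_derivs js \<phi> x)"
    "(LINT x|lebesgue_on \<Omega>. f x * partial_derivs is (partial_derivs js \<phi>) x)
      = (-1) ^ length (is @ js) * (LINT x|lebesgue_on \<Omega>. h x * \<phi> x)"
    using assms partial_derivs_test[of \<phi> \<Omega> js] by (auto simp: has_weak_deriv_def partial_derivs_append)
  then have "(-1) ^ length is * ((-1) ^ length is * (LINT x|lebesgue_on \<Omega>. g x * partial_derivs js \<phi> x))
     = (-1) ^ length is * ((-1) ^ length is * ((-1) ^ length js * (LINT x|lebesgue_on \<Omega>. h x * \<phi> x)))"
    by (simp add: power_add)
  then show "(LINT x|lebesgue_on \<Omega>. g x * partial_derivs js \<phi> x)
      = (-1) ^ length js * (LINT x|lebesgue_on \<Omega>. h x * \<phi> x)"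
    by (simp flip: mult.assoc power_mult_distrib)
qed (use assms in \<open>auto simp: has_weak_deriv_def\<close>)

lemma sobolev_weak_deriv:
  assumes "f \<in> sobolev k \<Omega>" "length is \<le> k" "has_weak_deriv \<Omega> is f g" "g \<in> L2 \<Omega>"
  shows "g \<in> sobolev (k - length is) \<Omega>"
  unfolding sobolev_def
proof safe
  fix js :: "'a list" assume "length js \<le> k - length is"
  then have "length (is @ js) \<le> k" using assms by simp
  then obtain h where "h \<in> L2 \<Omega>" "has_weak_deriv \<Omega> (is @ js) f h"
    using assms(1) unfolding sobolev_def by blast
  then show "\<exists>h\<in>L2 \<Omega>. has_weak_deriv \<Omega> js g h"
    using has_weak_deriv_append assms by blast
qed (use assms in auto)

section \<open>Integration by parts for functions differentiable along an axis\<close>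

lemma AE_lebesgue_on_iff_negligible:
  assumes "S \<in> sets lebesgue"
  shows "(AE x in lebesgue_on S. P x) \<longleftrightarrow> negligible {x \<in> S. \<not> P x}"
proof -
  have "(AE x in lebesgue_on S. P x) \<longleftrightarrow> (AE x in lebesgue. x \<in> S \<longrightarrow> P x)"
    using assms by (intro AE_restrict_space_iff) auto
  also have "\<dots> \<longleftrightarrow> {x \<in> S. \<not> P x} \<in> null_sets lebesgue"
    by (subst completion.AE_iff_null_sets) simp
  finally show ?thesis by (simp add: negligible_iff_null_sets)
qed

lemma ae_eq_iff_negligible:
  "open \<Omega> \<Longrightarrow> ae_eq \<Omega> f g \<longleftrightarrow> negligible {x \<in> \<Omega>. f x \<noteq> g x}"
  unfolding ae_eq_def by (intro AE_lebesgue_on_iff_negligible) auto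

text \<open>Completeness of Lebesgue measure.\<close>

lemma measurable_lebesgue_on_AE:
  fixes f g :: "'a::euclidean_space \<Rightarrow> real"
  assumes "g \<in> borel_measurable (lebesgue_on S)" "AE x in lebesgue_on S. f x = g x" "S \<in> sets lebesgue"
  shows "f \<in> borel_measurable (lebesgue_on S)"
proof -
  let ?f = "\<lambda>x. if x \<in> S then f x else 0" and ?g = "\<lambda>x. if x \<in> S then g x else 0"
  have *: "?g \<in> borel_measurable lebesgue"
    using assms by (intro borel_measurable_if_I)
  have "AE x in lebesgue. ?g x = ?f x"
    using assms by (auto simp: AE_restrict_space_iff elim: eventually_mono)
  then have "?f \<in> borel_measurable lebesgue"
    by (intro measurableI completion.in_sets_AE[OF _ measurable_sets[OF *]]) (auto elim: eventually_mono)
  then show ?thesis using borel_measurable_if_D by blast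
qed

lemma integrable_lebesgue_on_supported:
  fixes g :: "'a::euclidean_space \<Rightarrow> real"
  assumes "K \<in> sets lebesgue" "S \<in> sets lebesgue" "K \<subseteq> S" "\<And>x. x \<in> S - K \<Longrightarrow> g x = 0"
  shows "integrable (lebesgue_on S) g \<longleftrightarrow> integrable (lebesgue_on K) g"
    and "integral\<^sup>L (lebesgue_on S) g = integral\<^sup>L (lebesgue_on K) g"
proof -
  have "(\<lambda>x. if x \<in> S then g x else 0) = (\<lambda>x. if x \<in> K then g x else 0)"
    using assms(3,4) by (auto simp: fun_eq_iff)
  then show "integrable (lebesgue_on S) g \<longleftrightarrow> integrable (lebesgue_on K) g"
    "integral\<^sup>L (lebesgue_on S) g = integral\<^sup>L (lebesgue_on K) g"
    using Lebesgue_Measure.integrable_restrict_UNIV[of S g] Lebesgue_Measure.integrable_restrict_UNIV[of K g]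
      Lebesgue_Measure.integral_restrict_UNIV[of S g] Lebesgue_Measure.integral_restrict_UNIV[of K g] assms(1,2)
    by simp_all
qed

text \<open>The mean value theorem turns the bound on \<open>K'\<close> into a bound on the difference quotients, and
  dominated convergence applies.\<close>

lemma has_real_derivative_integral:
  fixes K :: "real \<Rightarrow> 'a \<Rightarrow> real"
  assumes f: "integrable M f" and d: "d > 0"
    and der: "\<And>t y. \<bar>t - t0\<bar> < d \<Longrightarrow> y \<in> space M \<Longrightarrow> ((\<lambda>t. K t y) has_real_derivative K' t y) (at t)"
    and meas: "\<And>t. \<bar>t - t0\<bar> < d \<Longrightarrow> K t \<in> borel_measurable M"
    and int: "\<And>t. \<bar>t - t0\<bar> < d \<Longrightarrow> integrable M (\<lambda>y. f y * K t y)"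
    and bd: "\<And>t y. \<bar>t - t0\<bar> < d \<Longrightarrow> y \<in> space M \<Longrightarrow> \<bar>K' t y\<bar> \<le> B"
  shows "((\<lambda>t. \<integral>y. f y * K t y \<partial>M) has_real_derivative (\<integral>y. f y * K' t0 y \<partial>M)) (at t0)"
  unfolding DERIV_def tendsto_at_iff_sequentially
proof safe
  fix X :: "nat \<Rightarrow> real"
  assume X0: "\<forall>i. X i \<in> UNIV - {0}" and X: "X \<longlonglongrightarrow> 0"
  let ?Q = "\<lambda>i y. if \<bar>X i\<bar> < d then f y * ((K (t0 + X i) y - K t0 y) / X i) else 0"
  have ev: "\<forall>\<^sub>F i in sequentially. \<bar>X i\<bar> < d"
    using order_tendstoD(2)[OF tendsto_rabs_zero[OF X] d] .
  have lip: "\<bar>K (t0 + h) y - K t0 y\<bar> \<le> B * \<bar>h\<bar>" if "\<bar>h\<bar> < d" "y \<in> space M" for h y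
  proof -
    have "norm (K (t0 + h) y - K t0 y) \<le> B * norm ((t0 + h) - t0)"
    proof (rule field_differentiable_bound[where S = "{t. \<bar>t - t0\<bar> < d}"])
      have "{t. \<bar>t - t0\<bar> < d} = ball t0 d" by (auto simp: dist_real_def)
      then show "convex {t. \<bar>t - t0\<bar> < d}" by simp
    qed (use that d der bd in \<open>auto intro: has_field_derivative_at_within\<close>)
    then show ?thesis by simp
  qed
  have meas': "?Q i \<in> borel_measurable M" for i
  proof (cases "\<bar>X i\<bar> < d")
    case True
    have [measurable]: "f \<in> borel_measurable M" "K (t0 + X i) \<in> borel_measurable M" "K t0 \<in> borel_measurable M"
      using meas[of "t0 + X i"] meas[of t0] d f True by auto
    show ?thesis using True by simp
  qed simp
  have lim: "(\<lambda>i. ?Q i y) \<longlonglongrightarrow> f y * K' t0 y" if "y \<in> space M" for y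
  proof -
    have "(\<lambda>i. (K (t0 + X i) y - K t0 y) / X i) \<longlonglongrightarrow> K' t0 y"
      using der[of t0 y] that d X0 X
      unfolding DERIV_def tendsto_at_iff_sequentially by (auto simp: o_def)
    then have "(\<lambda>i. f y * ((K (t0 + X i) y - K t0 y) / X i)) \<longlonglongrightarrow> f y * K' t0 y"
      by (intro tendsto_intros)
    moreover have "\<forall>\<^sub>F i in sequentially. f y * ((K (t0 + X i) y - K t0 y) / X i) = ?Q i y"
      using ev by eventually_elim simp
    ultimately show ?thesis by (rule Lim_transform_eventually)
  qed
  have "(\<lambda>i. \<integral>y. ?Q i y \<partial>M) \<longlonglongrightarrow> (\<integral>y. f y * K' t0 y \<partial>M)"
  proof (rule integral_dominated_convergence[where w = "\<lambda>y. B * \<bar>f y\<bar>"])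
    show "(\<lambda>y. f y * K' t0 y) \<in> borel_measurable M"
      by (rule borel_measurable_LIMSEQ_real[OF lim meas'])
    show "integrable M (\<lambda>y. B * \<bar>f y\<bar>)" using f by simp
    show "AE y in M. norm (?Q i y) \<le> B * \<bar>f y\<bar>" for i
    proof (rule AE_I2)
      fix y assume y: "y \<in> space M"
      have B: "B \<ge> 0" using bd[of t0 y] y d by (auto intro: order_trans[OF abs_ge_zero])
      show "norm (?Q i y) \<le> B * \<bar>f y\<bar>"
      proof (cases "\<bar>X i\<bar> < d")
        case True
        have "\<bar>(K (t0 + X i) y - K t0 y) / X i\<bar> \<le> B"
          using lip[OF True y] X0 by (simp add: abs_divide pos_divide_le_eq)
        then have "\<bar>f y\<bar> * \<bar>(K (t0 + X i) y - K t0 y) / X i\<bar> \<le> \<bar>f y\<bar> * B"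
          by (intro mult_left_mono) auto
        then show ?thesis using True by (simp add: abs_mult mult.commute[of B])
      qed (use B in auto)
    qed
  qed (use meas' lim in auto)
  moreover have "\<forall>\<^sub>F i in sequentially. (\<integral>y. ?Q i y \<partial>M) =
      ((\<integral>y. f y * K (t0 + X i) y \<partial>M) - (\<integral>y. f y * K t0 y \<partial>M)) / X i"
    using ev
  proof eventually_elim
    case (elim i)
    then have "(\<integral>y. ?Q i y \<partial>M) = (\<integral>y. (f y * K (t0 + X i) y - f y * K t0 y) / X i \<partial>M)"
      by (intro Bochner_Integration.integral_cong) (auto simp: right_diff_distrib diff_divide_distrib)
    also have "\<dots> = ((\<integral>y. f y * K (t0 + X i) y \<partial>M) - (\<integral>y. f y * K t0 y \<partial>M)) / X i"
      using int[of "t0 + X i"] int[of t0] elim d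
      by (simp add: Bochner_Integration.integral_diff)
    finally show ?case .
  qed
  ultimately show "((\<lambda>h. ((\<integral>y. f y * K (t0 + h) y \<partial>M) - (\<integral>y. f y * K t0 y \<partial>M)) / h) \<circ> X)
      \<longlonglongrightarrow> (\<integral>y. f y * K' t0 y \<partial>M)"
    by (auto simp: o_def intro: Lim_transform_eventually)
qed

text \<open>Differentiability along a single axis is all that integration by parts needs, and it reduces the product and chain rules to functions of one real variable.\<close>

definition C1_along :: "'n \<Rightarrow> (real^'n) set \<Rightarrow> (real^'n \<Rightarrow> real) \<Rightarrow> (real^'n \<Rightarrow> real) \<Rightarrow> bool" where
  "C1_along i \<Omega> F G \<longleftrightarrow> continuous_on \<Omega> F \<and> continuous_on \<Omega> G \<and>
     (\<forall>x\<in>\<Omega>. ((\<lambda>t. F (x + t *\<^sub>R axis i 1)) has_real_derivative G x) (at 0))"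

lemma C1_along_continuous: "C1_along i \<Omega> F G \<Longrightarrow> continuous_on \<Omega> F"
  by (simp add: C1_along_def)

lemma C1_along_shift:
  assumes "C1_along i \<Omega> F G" "x + t *\<^sub>R axis i 1 \<in> \<Omega>"
  shows "((\<lambda>t. F (x + t *\<^sub>R axis i 1)) has_real_derivative G (x + t *\<^sub>R axis i 1)) (at t)"
proof -
  have "((\<lambda>s. F (x + (s + t) *\<^sub>R axis i 1)) has_real_derivative G (x + t *\<^sub>R axis i 1)) (at 0)"
    using bspec[OF assms(1)[unfolded C1_along_def, THEN conjunct2, THEN conjunct2] assms(2)]
    by (simp add: algebra_simps)
  then show ?thesis
    using DERIV_shift[of "\<lambda>t. F (x + t *\<^sub>R axis i 1)" "G (x + t *\<^sub>R axis i 1)" 0 t] by simp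
qed

text \<open>By translation invariance, the integral of the zero extension of \<open>F\<close> shifted by \<open>t\<close> along the
  axis does not depend on \<open>t\<close>, while its derivative at \<open>t = 0\<close> is the integral of \<open>G\<close>.\<close>

lemma integral_C1_along_compact_support:
  fixes F G :: "real^'n \<Rightarrow> real"
  assumes "open \<Omega>" "C1_along i \<Omega> F G" "compact K" "K \<subseteq> \<Omega>" "\<And>x. x \<in> \<Omega> - K \<Longrightarrow> F x = 0"
  shows "integrable (lebesgue_on \<Omega>) G" "(LINT x|lebesgue_on \<Omega>. G x) = 0"
proof -
  define F0 where "F0 = (\<lambda>x. if x \<in> K then F x else 0)"
  define G0 where "G0 = (\<lambda>x. if x \<in> K then G x else 0)"
  let ?e = "axis i 1 :: real^'n"
  have zero_der: "((\<lambda>t. F0 (x + t *\<^sub>R ?e)) has_real_derivative 0) (at 0)" if "x \<notin> K" for x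
  proof -
    have "open ((\<lambda>t. x + t *\<^sub>R ?e) -` (- K))"
      using assms(3) by (intro open_vimage continuous_intros open_Compl compact_imp_closed)
    then show ?thesis using that
      by (intro has_field_derivative_transform_within_open[OF DERIV_const]) (auto simp: F0_def)
  qed
  have F0_\<Omega>: "F0 x = F x" if "x \<in> \<Omega>" for x using assms(5) that by (auto simp: F0_def)
  have der_in: "((\<lambda>t. F0 (x + t *\<^sub>R ?e)) has_real_derivative G x) (at 0)" if "x \<in> \<Omega>" for x
  proof -
    have o: "open ((\<lambda>t. x + t *\<^sub>R ?e) -` \<Omega>)"
      using assms(1) by (intro open_vimage continuous_intros)
    have "((\<lambda>t. F (x + t *\<^sub>R ?e)) has_real_derivative G x) (at 0)"
      using assms(2) that by (simp add: C1_along_def)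
    then show ?thesis
      by (rule has_field_derivative_transform_within_open[where S = "(\<lambda>t. x + t *\<^sub>R ?e) -` \<Omega>"])
         (use that F0_\<Omega> o in simp_all)
  qed
  have G_out: "G x = 0" if "x \<in> \<Omega> - K" for x
    using DERIV_unique[OF der_in zero_der] that by blast
  have G0_\<Omega>: "G0 x = G x" if "x \<in> \<Omega>" for x using G_out that by (auto simp: G0_def)
  have der: "((\<lambda>t. F0 (x + t *\<^sub>R ?e)) has_real_derivative G0 x) (at 0)" for x
    using der_in[of x] zero_der[of x] G0_\<Omega>[of x] assms(4) by (cases "x \<in> K") (auto simp: G0_def)
  have cont: "continuous_on UNIV F0" "continuous_on UNIV G0"
  proof -
    have U: "UNIV = \<Omega> \<union> - K" using assms(4) by auto
    have 1: "open (- K)" using assms(3) by (intro open_Compl compact_imp_closed)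
    have "continuous_on \<Omega> F0" "continuous_on \<Omega> G0"
      using assms(2) F0_\<Omega> G0_\<Omega> unfolding C1_along_def by (auto cong: continuous_on_cong)
    moreover have "continuous_on (- K) F0" "continuous_on (- K) G0"
      by (rule continuous_on_eq[OF continuous_on_const[of _ 0]], simp add: F0_def G0_def)+
    ultimately show "continuous_on UNIV F0" "continuous_on UNIV G0"
      unfolding U using assms(1) 1 by (auto intro: continuous_on_open_Un)
  qed
  have [measurable]: "F0 \<in> borel_measurable borel" "G0 \<in> borel_measurable borel"
    using cont by (auto intro: borel_measurable_continuous_onI)
  obtain r where r: "r > 0" "K \<subseteq> ball 0 r"
    using bounded_subset_ballD[OF compact_imp_bounded[OF assms(3)], of 0] by auto
  define C where "C = cball (0::real^'n) (r + 1)"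
  have "K \<subseteq> C" using r by (auto simp: C_def)
  obtain B where B: "\<And>x. \<bar>G0 x\<bar> \<le> B"
  proof -
    have "bounded (G0 ` K)"
      using cont assms(3) by (intro compact_imp_bounded compact_continuous_image) (auto intro: continuous_on_subset)
    then obtain B where "\<And>x. x \<in> K \<Longrightarrow> \<bar>G0 x\<bar> \<le> B"
      unfolding bounded_iff by auto
    then have "\<bar>G0 x\<bar> \<le> max B 0" for x
      by (cases "x \<in> K") (auto simp: G0_def intro: max.coboundedI1)
    then show ?thesis using that by blast
  qed
  have int_cont: "integrable lborel (\<lambda>x. indicator C x * H x)" if "continuous_on UNIV H" for H :: "real^'n \<Rightarrow> real"
    using borel_integrable_compact[of C H] that by (auto simp: C_def intro: continuous_on_subset)
  have C_int: "integrable lborel (indicator C :: _ \<Rightarrow> real)" using int_cont[of "\<lambda>_. 1"] by simp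
  have "((\<lambda>t. \<integral>x. indicator C x * F0 (x + t *\<^sub>R ?e) \<partial>lborel) has_real_derivative
      (\<integral>x. indicator C x * G0 (x + 0 *\<^sub>R ?e) \<partial>lborel)) (at 0)"
  proof (rule has_real_derivative_integral[where d = 1 and B = B and K' = "\<lambda>t x. G0 (x + t *\<^sub>R ?e)"])
    show "((\<lambda>t. F0 (y + t *\<^sub>R ?e)) has_real_derivative G0 (y + t *\<^sub>R ?e)) (at t)" for y t
      using der cont by (intro C1_along_shift[of i UNIV]) (auto simp: C1_along_def)
    show "integrable lborel (\<lambda>y. indicat_real C y * F0 (y + t *\<^sub>R ?e))" for t
      using cont by (intro int_cont continuous_on_compose2[OF cont(1)] continuous_intros) auto
  qed (use C_int B in auto)
  moreover have "(\<integral>x. indicator C x * F0 (x + t *\<^sub>R ?e) \<partial>lborel) = (\<integral>x. F0 x \<partial>lborel)" if "\<bar>t\<bar> < 1" for t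
  proof -
    have "indicator C x * F0 (x + t *\<^sub>R ?e) = F0 (x + t *\<^sub>R ?e)" for x
    proof (cases "x + t *\<^sub>R ?e \<in> K")
      case True
      have "norm x \<le> norm (x + t *\<^sub>R ?e) + norm (t *\<^sub>R ?e)"
        using norm_triangle_ineq4[of "x + t *\<^sub>R ?e" "t *\<^sub>R ?e"] by simp
      then have "x \<in> C" using True r that by (force simp: C_def)
      then show ?thesis by simp
    qed (simp add: F0_def)
    then have "(\<integral>x. indicator C x * F0 (x + t *\<^sub>R ?e) \<partial>lborel) = (\<integral>x. F0 (t *\<^sub>R ?e + x) \<partial>lborel)"
      by (simp only: add.commute)
    also have "\<dots> = (\<integral>x. F0 x \<partial>distr lborel borel ((+) (t *\<^sub>R ?e)))"
      by (subst integral_distr) auto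
    finally show ?thesis by (simp add: lborel_distr_plus)
  qed
  then have "((\<lambda>t. \<integral>x. indicator C x * F0 (x + t *\<^sub>R ?e) \<partial>lborel) has_real_derivative 0) (at 0)"
    by (intro has_field_derivative_transform_within_open[OF DERIV_const, of "ball 0 1"]) (auto simp: dist_real_def)
  ultimately have "(\<integral>x. indicator C x * G0 (x + 0 *\<^sub>R ?e) \<partial>lborel) = 0"
    by (rule DERIV_unique)
  moreover have "(\<lambda>x. indicator C x * G0 x) = G0" using \<open>K \<subseteq> C\<close> by (auto simp: G0_def indicator_def fun_eq_iff)
  ultimately have int0: "(\<integral>x. G0 x \<partial>lborel) = 0" and intg: "integrable lborel G0"
    using int_cont[OF cont(2)] by auto
  have eq: "(\<lambda>x. if x \<in> \<Omega> then G x else 0) = G0"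
    using G_out assms(4) by (auto simp: G0_def fun_eq_iff)
  have \<Omega>: "\<Omega> \<in> sets lebesgue" using assms(1) by auto
  show "integrable (lebesgue_on \<Omega>) G"
    using Lebesgue_Measure.integrable_restrict_UNIV[OF \<Omega>, of G] intg by (simp add: eq integrable_completion)
  show "(LINT x|lebesgue_on \<Omega>. G x) = 0"
    using Lebesgue_Measure.integral_restrict_UNIV[OF \<Omega>, of G] int0 by (simp add: eq integral_completion)
qed

lemma continuous_L1_loc: "open \<Omega> \<Longrightarrow> continuous_on \<Omega> f \<Longrightarrow> f \<in> L1_loc \<Omega>"
  unfolding L1_loc_def
proof safe
  fix K :: "(real^'a) set" assume *: "continuous_on \<Omega> f" "compact K" "K \<subseteq> \<Omega>"
  have "integrable lborel (\<lambda>x. indicator K x *\<^sub>R f x)"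
    using * by (intro borel_integrable_compact) (auto intro: continuous_on_subset)
  then have "integrable lebesgue (\<lambda>x. indicator K x *\<^sub>R f x)"
    by (subst integrable_completion) auto
  then show "integrable (lebesgue_on K) f"
    using * by (subst integrable_restrict_space) (auto dest: lmeasurable_compact)
qed

lemma L1_loc_mult_integrable:
  assumes "open \<Omega>" "f \<in> L1_loc \<Omega>" "continuous_on UNIV \<psi>" "compact L" "L \<subseteq> \<Omega>" "\<And>x. x \<notin> L \<Longrightarrow> \<psi> x = 0"
  shows "integrable (lebesgue_on \<Omega>) (\<lambda>x. f x * \<psi> x)"
proof -
  have L: "L \<in> sets lebesgue" "\<Omega> \<in> sets lebesgue"
    using assms(1,4) by (auto dest: lmeasurable_compact)
  have f: "integrable (lebesgue_on L) f" using assms by (simp add: L1_loc_def)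
  have "bounded (\<psi> ` L)"
    using assms by (intro compact_imp_bounded compact_continuous_image) (auto intro: continuous_on_subset)
  then obtain B where B: "\<And>x. x \<in> L \<Longrightarrow> \<bar>\<psi> x\<bar> \<le> B" unfolding bounded_iff by auto
  have \<psi>: "\<psi> \<in> borel_measurable (lebesgue_on L)"
    using assms(3) L by (intro continuous_imp_measurable_on_sets_lebesgue) (auto intro: continuous_on_subset)
  have "integrable (lebesgue_on L) (\<lambda>x. f x * \<psi> x)"
  proof (rule Bochner_Integration.integrable_bound[where f = "\<lambda>x. B * f x"])
    show "AE x in lebesgue_on L. norm (f x * \<psi> x) \<le> norm (B * f x)"
    proof (rule AE_I2)
      fix x assume "x \<in> space (lebesgue_on L)"
      then have "\<bar>\<psi> x\<bar> \<le> \<bar>B\<bar>" using B by fastforce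
      then show "norm (f x * \<psi> x) \<le> norm (B * f x)"
        by (simp add: abs_mult mult.commute[of "\<bar>B\<bar>"] mult_left_mono)
    qed
    show "(\<lambda>x. f x * \<psi> x) \<in> borel_measurable (lebesgue_on L)"
      using f \<psi> by (intro borel_measurable_times) auto
  qed (use f in simp)
  then show ?thesis
    using integrable_lebesgue_on_supported(1)[OF L assms(5), of "\<lambda>x. f x * \<psi> x"] assms(6) by simp
qed

lemma C1_along_mult:
  "C1_along i \<Omega> F G \<Longrightarrow> C1_along i \<Omega> F' G' \<Longrightarrow> C1_along i \<Omega> (\<lambda>x. F x * F' x) (\<lambda>x. F x * G' x + G x * F' x)"
  unfolding C1_along_def
  by (auto intro!: continuous_intros derivative_eq_intros)

lemma C1_along_chain:
  assumes "C1_along i \<Omega> F G" "\<And>t. (f has_real_derivative f' t) (at t)" "continuous_on UNIV f'"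
  shows "C1_along i \<Omega> (\<lambda>x. f (F x)) (\<lambda>x. f' (F x) * G x)"
proof -
  have f: "continuous_on UNIV f"
    using assms(2) by (meson DERIV_isCont continuous_at_imp_continuous_on)
  have "((\<lambda>t. f (F (x + t *\<^sub>R axis i 1))) has_real_derivative f' (F x) * G x) (at 0)" if "x \<in> \<Omega>" for x
    using DERIV_chain2[OF assms(2), of "\<lambda>t. F (x + t *\<^sub>R axis i 1)" "G x" 0] assms(1) that
    by (simp add: C1_along_def)
  then show ?thesis using assms(1,3) f unfolding C1_along_def
    by (auto intro!: continuous_on_mult intro: continuous_on_compose2)
qed

lemma C1_along_sum:
  "(\<And>k. k \<in> I \<Longrightarrow> C1_along i \<Omega> (F k) (G k)) \<Longrightarrow> C1_along i \<Omega> (\<lambda>x. \<Sum>k\<in>I. F k x) (\<lambda>x. \<Sum>k\<in>I. G k x)"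
  unfolding C1_along_def by (auto intro!: continuous_intros DERIV_sum)

lemma has_directional_derivative:
  assumes "(f has_derivative f') (at (x + t *\<^sub>R v))"
  shows "((\<lambda>t. f (x + t *\<^sub>R v)) has_real_derivative f' v) (at t)"
proof -
  have "((\<lambda>t. f (x + t *\<^sub>R v)) has_derivative (\<lambda>h. f' (h *\<^sub>R v))) (at t)"
    using assms by (auto intro!: derivative_eq_intros has_derivative_compose[where g = f])
  moreover have "f' (h *\<^sub>R v) = f' v * h" for h
    using has_derivative_linear[OF assms] by (simp add: linear_scale mult.commute)
  ultimately show ?thesis by (simp add: has_field_derivative_def)
qed

lemma C1_along_test: "\<phi> \<in> test_functions \<Omega> \<Longrightarrow> C1_along i U \<phi> (partial_deriv i \<phi>)"
  unfolding C1_along_def partial_deriv_def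
proof (intro conjI ballI)
  assume \<phi>: "\<phi> \<in> test_functions \<Omega>"
  show "continuous_on U \<phi>" "continuous_on U (\<lambda>x. frechet_derivative \<phi> (at x) (axis i 1))"
    using test_continuous[OF \<phi>] test_continuous[OF partial_deriv_test[OF \<phi>, of i]]
    by (auto simp: partial_deriv_def[abs_def] intro: continuous_on_subset)
  show "((\<lambda>t. \<phi> (x + t *\<^sub>R axis i 1)) has_real_derivative frechet_derivative \<phi> (at x) (axis i 1)) (at 0)" for x
    using test_differentiable[OF \<phi>, of x] has_directional_derivative[of \<phi> "frechet_derivative \<phi> (at x)" x 0 "axis i 1"]
    by (simp add: frechet_derivative_works)
qed

lemma C1_along_imp_has_weak_deriv:
  assumes "open \<Omega>" "C1_along i \<Omega> F G"
  shows "has_weak_deriv \<Omega> [i] F G"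
  unfolding has_weak_deriv_def
proof (intro conjI ballI)
  show "F \<in> L1_loc \<Omega>" "G \<in> L1_loc \<Omega>"
    using assms by (auto simp: C1_along_def intro: continuous_L1_loc)
  fix \<phi> assume \<phi>: "\<phi> \<in> test_functions \<Omega>"
  then obtain K where K: "compact K" "K \<subseteq> \<Omega>" "\<And>x. x \<notin> K \<Longrightarrow> \<phi> x = 0"
    by (auto simp: test_functions_def)
  obtain K' where K': "compact K'" "K' \<subseteq> \<Omega>" "\<And>x. x \<notin> K' \<Longrightarrow> partial_deriv i \<phi> x = 0"
    using partial_deriv_test[OF \<phi>, of i] by (auto simp: test_functions_def)
  have c: "continuous_on \<Omega> F" "continuous_on \<Omega> G" using assms(2) by (auto simp: C1_along_def)
  note t = test_continuous[OF \<phi>] test_continuous[OF partial_deriv_test[OF \<phi>, of i]]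
  have "C1_along i \<Omega> (\<lambda>x. F x * \<phi> x) (\<lambda>x. F x * partial_deriv i \<phi> x + G x * \<phi> x)"
    by (intro C1_along_mult C1_along_test[OF \<phi>] assms(2))
  from integral_C1_along_compact_support(2)[OF assms(1) this K(1,2)] K(3)
  have "(LINT x|lebesgue_on \<Omega>. F x * partial_deriv i \<phi> x + G x * \<phi> x) = 0" by simp
  then have "(LINT x|lebesgue_on \<Omega>. F x * partial_deriv i \<phi> x) + (LINT x|lebesgue_on \<Omega>. G x * \<phi> x) = 0"
    using L1_loc_mult_integrable[OF assms(1) _ t(2) K'] L1_loc_mult_integrable[OF assms(1) _ t(1) K]
      continuous_L1_loc[OF assms(1)] c by simp
  then show "(LINT x|lebesgue_on \<Omega>. F x * partial_derivs [i] \<phi> x)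
      = (-1) ^ length [i] * (LINT x|lebesgue_on \<Omega>. G x * \<phi> x)" by simp
qed

section \<open>Mollification recovers a locally integrable function\<close>

text \<open>The profile is the bump with \<open>n = 2\<close>, the one whose rescalings are generated by the Laplacian
  of the bump with \<open>n = 0\<close> (see \<open>has_real_derivative_bump_scale\<close>).\<close>

definition mollifier :: "real \<Rightarrow> real^'n \<Rightarrow> real^'n \<Rightarrow> real" where
  "mollifier s x y = bump 2 s x y / (s ^ CARD('n) * (LINT z|lborel. bump 2 1 (0 :: real^'n) z))"

lemma integrable_bump:
  assumes "s > 0"
  shows "integrable lborel (bump n s (x::real^'n))"
proof -
  have "integrable lborel (\<lambda>y. indicator (cball x s) y *\<^sub>R bump n s x y)"
    by (intro borel_integrable_compact continuous_intros) auto
  moreover have "(\<lambda>y. indicator (cball x s) y *\<^sub>R bump n s x y) = bump n s x"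
    using bump_eq_0[OF assms] by (auto simp: fun_eq_iff indicator_def)
  ultimately show ?thesis by simp
qed

lemma bump_mass_pos: "0 < (LINT z|lborel. bump 2 1 (0 :: real^'n) z)"
proof -
  define c where "c = exp (- 4/3 :: real)"
  have "c * measure lborel (cball (0::real^'n) (1/2)) = (LINT z|lborel. c * indicator (cball (0::real^'n) (1/2)) z)"
    by simp
  also have "\<dots> \<le> (LINT z|lborel. bump 2 1 (0 :: real^'n) z)"
  proof (rule integral_mono)
    show "c * indicator (cball 0 (1/2)) z \<le> bump 2 1 0 z" for z :: "real^'n"
    proof (cases "z \<in> cball 0 (1/2)")
      case True
      then have "(norm z)\<^sup>2 \<le> (1/2)\<^sup>2" by (intro power_mono) auto
      then have t: "3/4 \<le> 1 - (norm z)\<^sup>2" "1 - (norm z)\<^sup>2 \<le> 1" by (auto simp: power2_eq_square)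
      define t where "t = 1 - (norm z)\<^sup>2"
      have t': "3/4 \<le> t" "t \<le> 1" using t by (auto simp: t_def)
      have "1 / t \<le> 4/3" using t' by (simp add: field_simps)
      then have "c \<le> exp (- (1 / t))" by (simp add: c_def)
      also have "\<dots> \<le> exp (- (1 / t)) / t ^ 2"
        using t' by (simp add: field_simps power_le_one)
      finally show ?thesis using True t' by (simp add: bump_def hump_def flip: t_def)
    qed (simp add: bump_nonneg)
  qed (use borel_integrable_compact[of "cball (0::real^'n) (1/2)" "\<lambda>_. 1::real"] in \<open>auto simp: integrable_bump\<close>)
  finally have "c * measure lborel (cball (0::real^'n) (1/2)) \<le> (LINT z|lborel. bump 2 1 (0 :: real^'n) z)" .
  moreover have "measure lborel (cball (0::real^'n) (1/2)) > 0"
    using content_cball_pos[of "1/2" "0::real^'n"] by simp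
  ultimately show ?thesis
    by (smt (verit) c_def exp_gt_zero mult_pos_pos)
qed

lemma mollifier_nonneg: "s > 0 \<Longrightarrow> 0 \<le> mollifier s x y"
  using bump_mass_pos by (auto simp: mollifier_def bump_nonneg intro!: divide_nonneg_nonneg mult_nonneg_nonneg less_imp_le)

lemma mollifier_commute: "mollifier s x y = mollifier s y x"
  by (simp add: mollifier_def bump_def norm_minus_commute)

lemma mollifier_eq_0: "s > 0 \<Longrightarrow> y \<notin> cball x s \<Longrightarrow> mollifier s x y = 0"
  by (simp add: mollifier_def bump_eq_0)

lemma continuous_on_mollifier [continuous_intros]:
  "continuous_on S f \<Longrightarrow> continuous_on S g \<Longrightarrow> continuous_on S (\<lambda>p. mollifier s (f p) (g p))"
  unfolding mollifier_def divide_inverse by (intro continuous_intros)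

lemma mollifier_measurable [measurable]:
  "f \<in> borel_measurable M \<Longrightarrow> g \<in> borel_measurable M \<Longrightarrow> (\<lambda>p. mollifier s (f p) (g p)) \<in> borel_measurable M"
  by (rule borel_measurable_continuous_Pair) (auto intro!: continuous_intros)

lemma integrable_mollifier: "s > 0 \<Longrightarrow> integrable lborel (mollifier s x)"
  unfolding mollifier_def[abs_def] by (simp add: integrable_bump)

lemma integral_mollifier:
  assumes "s > 0"
  shows "(LINT y|lborel. mollifier s (x::real^'n) y) = 1"
proof -
  have "(LINT y|lborel. bump 2 s x y) = (LINT y|density (distr lborel borel (\<lambda>z. x + s *\<^sub>R z)) (\<lambda>_. ennreal (\<bar>s\<bar> ^ DIM(real^'n))). bump 2 s x y)"
    using lborel_affine[of s x] assms by simp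
  also have "\<dots> = (LINT z|lborel. s ^ CARD('n) * bump 2 s x (x + s *\<^sub>R z))"
    using assms by (subst integral_density) (auto simp: integral_distr)
  also have "\<dots> = s ^ CARD('n) * (LINT z|lborel. bump 2 1 (0::real^'n) z)"
    using assms by (simp add: bump_def power_mult_distrib)
  finally show ?thesis
    using bump_mass_pos[where 'n = 'n] assms by (simp add: mollifier_def)
qed

lemma mollifier_le:
  obtains B where "\<And>x y :: real^'n. mollifier s x y \<le> B"
proof -
  define A where "A = (LINT z|lborel. bump 2 1 (0 :: real^'n) z)"
  have "mollifier s x y \<le> fact 2 / \<bar>s ^ CARD('n) * A\<bar>" for x y :: "real^'n"
  proof -
    have "mollifier s x y \<le> \<bar>mollifier s x y\<bar>" by simp
    also have "\<dots> = bump 2 s x y / \<bar>s ^ CARD('n) * A\<bar>"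
      by (simp only: mollifier_def A_def abs_divide abs_of_nonneg[OF bump_nonneg])
    also have "\<dots> \<le> fact 2 / \<bar>s ^ CARD('n) * A\<bar>"
      by (intro divide_right_mono bump_le) auto
    finally show ?thesis .
  qed
  then show ?thesis using that by blast
qed

lemma integral_mollifier_swap:
  fixes g :: "real^'n \<Rightarrow> real"
  assumes g: "integrable lborel g" and s: "s > 0"
  shows "(LINT x|lborel. indicator (cbox a b) x * (LINT y|lborel. g y * mollifier s x y))
       = (LINT y|lborel. g y * (LINT x|lborel. indicator (cbox a b) x * mollifier s y x))"
proof -
  obtain B where B: "\<And>x y :: real^'n. mollifier s x y \<le> B"
    using mollifier_le[where s = s and 'n = 'n] by metis
  have [measurable]: "g \<in> borel_measurable borel" using g by auto
  have cb: "integrable lborel (indicator (cbox a b) :: real^'n \<Rightarrow> real)"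
    using borel_integrable_compact[of "cbox a b" "\<lambda>_. 1::real"] by simp
  let ?f = "\<lambda>(x, y). indicator (cbox a b) x * (g y * mollifier s x y)"
  have meas: "?f \<in> borel_measurable (lborel \<Otimes>\<^sub>M lborel)"
    by (auto simp: split_beta intro!: borel_measurable_times mollifier_measurable)
  have inner: "integrable lborel (\<lambda>y. g y * mollifier s x y)" for x
  proof (rule Bochner_Integration.integrable_bound[where f = "\<lambda>y. B * g y"])
    show "AE y in lborel. norm (g y * mollifier s x y) \<le> norm (B * g y)"
    proof (rule AE_I2)
      fix y
      have "\<bar>mollifier s x y\<bar> \<le> \<bar>B\<bar>" using mollifier_nonneg[OF s, of x y] B[of x y] by simp
      then show "norm (g y * mollifier s x y) \<le> norm (B * g y)"
        by (simp add: abs_mult mult.commute[of "\<bar>B\<bar>"] mult_left_mono)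
    qed
  qed (use g in auto)
  have "integrable (lborel \<Otimes>\<^sub>M lborel) ?f"
  proof (rule lborel_pair.Fubini_integrable[OF meas])
    show "AE x in lborel. integrable lborel (\<lambda>y. ?f (x, y))"
      using inner by simp
    show "integrable lborel (\<lambda>x. LINT y|lborel. norm (?f (x, y)))"
    proof (rule Bochner_Integration.integrable_bound[where f = "\<lambda>x. indicator (cbox a b) x * (LINT y|lborel. B * \<bar>g y\<bar>)"])
      show "integrable lborel (\<lambda>x. indicator (cbox a b) x * (LINT y|lborel. B * \<bar>g y\<bar>))"
        using cb by simp
      show "(\<lambda>x. LINT y|lborel. norm (?f (x, y))) \<in> borel_measurable lborel"
        using meas by measurable
      have "(LINT y|lborel. \<bar>g y\<bar> * mollifier s x y) \<le> (LINT y|lborel. B * \<bar>g y\<bar>)" for x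
        using inner[of x] g B s
        by (intro integral_mono) (auto simp: mult.commute[of B] abs_mult mollifier_nonneg dest: integrable_abs intro!: mult_left_mono)
      moreover have "0 \<le> (LINT y|lborel. \<bar>g y\<bar> * mollifier s x y)" for x
        using s by (intro Bochner_Integration.integral_nonneg) (simp add: mollifier_nonneg)
      moreover have "B \<ge> 0" using B[of 0 0] mollifier_nonneg[OF s, of "0::real^'n" 0] by linarith
      ultimately show "AE x in lborel. norm (LINT y|lborel. norm (?f (x, y))) \<le> norm (indicator (cbox a b) x * (LINT y|lborel. B * \<bar>g y\<bar>))"
        using s by (fastforce simp: abs_mult mollifier_nonneg indicator_def intro!: AE_I2 intro: order_trans[OF _ abs_ge_self])
    qed
  qed
  have "(LINT x|lborel. indicator (cbox a b) x * (LINT y|lborel. g y * mollifier s x y))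
      = (LINT x|lborel. LINT y|lborel. indicator (cbox a b) x * (g y * mollifier s x y))"
    by simp
  also have "\<dots> = (LINT y|lborel. LINT x|lborel. indicator (cbox a b) x * (g y * mollifier s x y))"
    by (rule lborel_pair.Fubini_integral[symmetric]) fact
  also have "\<dots> = (LINT y|lborel. LINT x|lborel. g y * (indicator (cbox a b) x * mollifier s y x))"
    by (simp only: mult.left_commute mollifier_commute[of s])
  finally show ?thesis by simp
qed

definition mollify :: "(real^'n) set \<Rightarrow> real \<Rightarrow> (real^'n \<Rightarrow> real) \<Rightarrow> real^'n \<Rightarrow> real" where
  "mollify \<Omega> s f x = (LINT y|lebesgue_on \<Omega>. f y * mollifier s x y)"

lemma mollify_eq:
  assumes "open \<Omega>" "compact C" "C \<subseteq> \<Omega>" "cball x s \<subseteq> C" "s > 0"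
  shows "mollify \<Omega> s f x = (LINT y|lebesgue_on C. f y * mollifier s x y)"
proof -
  have "f y * mollifier s x y = 0" if "y \<in> \<Omega> - C" for y
  proof -
    have "y \<notin> cball x s" using that assms(4) by blast
    then show ?thesis using mollifier_eq_0[OF assms(5), of y x] by simp
  qed
  then show ?thesis
    unfolding mollify_def using assms
    by (intro integrable_lebesgue_on_supported) (auto dest: lmeasurable_compact)
qed

text \<open>The mollified indicator of a box is bounded by \<open>1\<close> and, off the frontier of the box, eventually
  equal to the indicator.\<close>

lemma integral_mollifier_box_tendsto:
  fixes g :: "real^'n \<Rightarrow> real"
  assumes g: "integrable lborel g" and X: "X \<longlonglongrightarrow> 0" "\<And>k. X k > 0"
  shows "(\<lambda>k. LINT y|lborel. g y * (LINT x|lborel. indicator (cbox a b) x * mollifier (X k) y x))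
    \<longlonglongrightarrow> (LINT y|lborel. g y * indicator (cbox a b) y)"
proof (rule integral_dominated_convergence[where w = "\<lambda>y. \<bar>g y\<bar>"])
  have [measurable]: "g \<in> borel_measurable borel" using g by auto
  show "(\<lambda>y. g y * indicator (cbox a b) y) \<in> borel_measurable lborel" by simp
  show "(\<lambda>y. g y * (LINT x|lborel. indicator (cbox a b) x * mollifier (X k) y x)) \<in> borel_measurable lborel" for k
    by (intro borel_measurable_times lborel.borel_measurable_lebesgue_integral)
       (auto simp: split_beta intro!: borel_measurable_times mollifier_measurable)
  show "integrable lborel (\<lambda>y. \<bar>g y\<bar>)" using g by simp
  have int: "integrable lborel (\<lambda>x. indicator (cbox a b) x * mollifier (X k) y x)" for k y
    by (rule Bochner_Integration.integrable_bound[OF integrable_mollifier[OF X(2)[of k], of y]])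
       (auto simp: indicator_def intro!: borel_measurable_times mollifier_measurable)
  have le1: "\<bar>LINT x|lborel. indicator (cbox a b) x * mollifier (X k) y x\<bar> \<le> 1" for k y
  proof -
    have "0 \<le> (LINT x|lborel. indicator (cbox a b) x * mollifier (X k) y x)"
      using X by (intro Bochner_Integration.integral_nonneg) (auto simp: mollifier_nonneg)
    moreover have "(LINT x|lborel. indicator (cbox a b) x * mollifier (X k) y x) \<le> (LINT x|lborel. mollifier (X k) y x)"
      using X int by (intro integral_mono) (auto simp: mollifier_nonneg indicator_def integrable_mollifier)
    ultimately show ?thesis using integral_mollifier[OF X(2), of k y] by simp
  qed
  show "AE y in lborel. norm (g y * (LINT x|lborel. indicator (cbox a b) x * mollifier (X k) y x)) \<le> \<bar>g y\<bar>" for k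
    by (rule AE_I2) (simp add: abs_mult le1 mult_left_le)
  have "negligible (frontier (cbox a b))"
    by (intro negligible_convex_frontier convex_box)
  then have "AE y in lebesgue. y \<notin> frontier (cbox a b)"
    unfolding negligible_iff_null_sets by (rule AE_not_in)
  then have "AE y in lborel. y \<notin> frontier (cbox a b)" by (simp only: AE_completion_iff)
  then show "AE y in lborel. (\<lambda>k. g y * (LINT x|lborel. indicator (cbox a b) x * mollifier (X k) y x)) \<longlonglongrightarrow> g y * indicator (cbox a b) y"
  proof eventually_elim
    case (elim y)
    have ev: "\<exists>e>0. (\<forall>x\<in>cball y e. indicator (cbox a b) x = (indicator (cbox a b) y :: real))"
    proof (cases "y \<in> cbox a b")
      case True
      then have "y \<in> interior (cbox a b)" using elim by (auto simp: frontier_def)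
      then obtain e where "e > 0" "cball y e \<subseteq> cbox a b" using mem_interior_cball by blast
      then show ?thesis using True by (intro exI[of _ e]) (auto simp: indicator_def subset_iff)
    next
      case False
      have "open (- cbox a b)" by (intro open_Compl closed_cbox)
      then obtain e where "e > 0" "cball y e \<subseteq> - cbox a b" using False open_contains_cball by blast
      then show ?thesis using False by (intro exI[of _ e]) (auto simp: indicator_def subset_iff)
    qed
    then obtain e where e: "e > 0" "\<And>x. x \<in> cball y e \<Longrightarrow> indicator (cbox a b) x = (indicator (cbox a b) y :: real)"
      by blast
    have "\<forall>\<^sub>F k in sequentially. X k < e" using order_tendstoD(2)[OF X(1) e(1)] .
    then have "\<forall>\<^sub>F k in sequentially. (LINT x|lborel. indicator (cbox a b) x * mollifier (X k) y x) = (indicator (cbox a b) y :: real)"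
    proof eventually_elim
      case (elim k)
      have "indicator (cbox a b) x * mollifier (X k) y x = indicator (cbox a b) y * mollifier (X k) y x" for x
      proof (cases "x \<in> cball y (X k)")
        case True
        then have "x \<in> cball y e" using elim by simp
        then show ?thesis using e(2) by simp
      qed (simp add: mollifier_eq_0 X)
      then have "(LINT x|lborel. indicator (cbox a b) x * mollifier (X k) y x) =
          (LINT x|lborel. indicator (cbox a b) y * mollifier (X k) y x)" by (simp only:)
      then show ?case by (simp add: integral_mollifier X)
    qed
    then show ?case by (intro tendsto_mult tendsto_const tendsto_eventually)
  qed
qed

text \<open>The scales \<open>4 ^ - k\<close> make the difference of consecutive mollifications of an \<open>H\<^sup>2\<close> function in
  dimension three of the order \<open>2 ^ - k\<close>.\<close>

definition mollify_limit :: "(real^'n) set \<Rightarrow> (real^'n \<Rightarrow> real) \<Rightarrow> (real^'n \<Rightarrow> real) \<Rightarrow> bool" where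
  "mollify_limit \<Omega> f F \<longleftrightarrow> continuous_on \<Omega> F \<and>
     (\<forall>x\<in>\<Omega>. \<exists>r>0. uniform_limit (ball x r) (\<lambda>k. mollify \<Omega> (1 / 4 ^ k) f) F sequentially)"

text \<open>At almost every point, a locally integrable function is the limit of its averages over small
  cubes with that point as a corner.\<close>

lemma box_integrals_eq_0_imp_negligible:
  fixes h :: "real^'n \<Rightarrow> real"
  assumes h: "integrable lborel h" and "open U"
    and zero: "\<And>a b. cbox a b \<subseteq> U \<Longrightarrow> (LINT x|lborel. indicator (cbox a b) x * h x) = 0"
  shows "negligible {x \<in> U. h x \<noteq> 0}"
proof -
  have int: "h integrable_on cbox a b" for a b
    using integrable_on_subcbox[OF integrable_on_lborel[OF h]] by auto
  then obtain N where N: "negligible N"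
    "\<And>x e. \<lbrakk>x \<notin> N; 0 < e\<rbrakk> \<Longrightarrow> \<exists>d>0. \<forall>t. 0 < t \<and> t < d \<longrightarrow>
       norm (integral (cbox x (x + t *\<^sub>R One)) h /\<^sub>R t ^ DIM(real^'n) - h x) < e"
    using integrable_ccontinuous_explicit by blast
  have "h x = 0" if x: "x \<in> U" "x \<notin> N" for x
  proof (rule ccontr)
    assume "h x \<noteq> 0"
    then obtain d where d: "d > 0" "\<And>t. 0 < t \<Longrightarrow> t < d \<Longrightarrow>
       norm (integral (cbox x (x + t *\<^sub>R One)) h /\<^sub>R t ^ DIM(real^'n) - h x) < \<bar>h x\<bar>"
      using N(2)[OF x(2), of "\<bar>h x\<bar>"] by auto
    obtain r where r: "r > 0" "ball x r \<subseteq> U" using assms(2) x open_contains_ball by blast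
    define t where "t = min (d / 2) (r / (2 * (norm (One :: real^'n) + 1)))"
    have t: "t > 0" "t < d" using d r by (auto simp: t_def add_nonneg_pos)
    have "cbox x (x + t *\<^sub>R One) \<subseteq> ball x r"
    proof
      fix y assume "y \<in> cbox x (x + t *\<^sub>R One)"
      then have "norm (y - x) \<le> norm (t *\<^sub>R (One :: real^'n))"
        by (intro norm_le_componentwise) (auto simp: mem_box inner_simps)
      also have "\<dots> = t * norm (One :: real^'n)" using t by simp
      also have "\<dots> \<le> r / (2 * (norm (One :: real^'n) + 1)) * norm (One :: real^'n)"
        by (intro mult_right_mono) (auto simp: t_def)
      also have "\<dots> < r"
        using r by (simp add: pos_divide_less_eq add_nonneg_pos algebra_simps add_pos_nonneg)
      finally show "y \<in> ball x r" by (simp add: dist_norm norm_minus_commute)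
    qed
    then have "(LINT x'|lborel. indicator (cbox x (x + t *\<^sub>R One)) x' * h x') = 0"
      using zero r by blast
    moreover have "set_integrable lborel (cbox x (x + t *\<^sub>R One)) h"
      unfolding set_integrable_def using integrable_mult_indicator[OF _ h] by auto
    ultimately have "integral (cbox x (x + t *\<^sub>R One)) h = 0"
      using set_borel_integral_eq_integral(2)[of "cbox x (x + t *\<^sub>R One)" h] by (simp add: set_lebesgue_integral_def)
    then show False using d(2)[OF t] by simp
  qed
  then show ?thesis by (intro negligible_subset[OF N(1)]) auto
qed

text \<open>Integrated over a box, the mollifications converge to the integral of \<open>F\<close> by uniform
  convergence, and to that of \<open>f\<close> because mollification can be moved to the indicator of the box.
  So \<open>F\<close> and \<open>f\<close> have the same integral over every small box.\<close>

lemma mollify_limit_ae_eq: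
  assumes "open \<Omega>" "f \<in> L1_loc \<Omega>" "mollify_limit \<Omega> f F"
  shows "ae_eq \<Omega> F f"
  unfolding ae_eq_iff_negligible[OF assms(1)]
proof (subst locally_negligible_alt, rule ballI)
  fix x0 assume "x0 \<in> {x \<in> \<Omega>. F x \<noteq> f x}"
  then have x0: "x0 \<in> \<Omega>" and "F x0 \<noteq> f x0" by auto
  obtain r0 where r0: "r0 > 0" "cball x0 r0 \<subseteq> \<Omega>"
    using assms(1) x0 open_contains_cball by blast
  obtain r1 where r1: "r1 > 0" "uniform_limit (ball x0 r1) (\<lambda>k. mollify \<Omega> (1 / 4 ^ k) f) F sequentially"
    using assms(3) x0 unfolding mollify_limit_def by blast
  define r where "r = min (r0 / 2) r1"
  define C where "C = cball x0 r0"
  have r: "r > 0" "r \<le> r1" "2 * r \<le> r0" using r0 r1 by (auto simp: r_def)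
  have ball_C: "ball x0 r \<subseteq> C" using r by (auto simp: C_def)
  have C: "C \<subseteq> \<Omega>" "compact C" using r0 by (auto simp: C_def)
  have fC: "integrable (lebesgue_on C) f" using assms(2) C by (simp add: L1_loc_def)
  define g0 where "g0 = (\<lambda>y. if y \<in> C then f y else 0)"
  have C_leb: "C \<in> sets lebesgue" using C(2) by (auto dest: lmeasurable_compact)
  have g0: "integrable lebesgue g0"
    unfolding g0_def by (subst Lebesgue_Measure.integrable_restrict_UNIV) (use fC C_leb in auto)
  then obtain g where g: "g \<in> borel_measurable lborel" "AE y in lborel. g0 y = g y"
    using completion_ex_borel_measurable_real[of g0 lborel] by auto
  have g_meas [measurable]: "g \<in> borel_measurable borel" using g by simp
  have "integrable lebesgue g"
    using g0 g by (subst integrable_cong_AE[of _ _ g0]) (auto simp: AE_completion_iff measurable_completion elim: eventually_mono)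
  then have intg: "integrable lborel g" using g by (simp add: integrable_completion)
  have moll: "mollify \<Omega> s f x = (LINT y|lborel. g y * mollifier s x y)" if "x \<in> ball x0 r" "0 < s" "s \<le> r" for x s
  proof -
    have "cball x s \<subseteq> C"
    proof
      fix y assume "y \<in> cball x s"
      then show "y \<in> C" using that r dist_triangle[of x0 y x] by (auto simp: C_def)
    qed
    then have "mollify \<Omega> s f x = (LINT y|lebesgue_on C. f y * mollifier s x y)"
      using that C assms(1) by (intro mollify_eq) auto
    also have "\<dots> = (LINT y|lebesgue. g0 y * mollifier s x y)"
      using Lebesgue_Measure.integral_restrict_UNIV[OF C_leb, of "\<lambda>y. f y * mollifier s x y"]
      by (simp add: g0_def if_distrib[of "\<lambda>t. t * _"] cong: if_cong)
    also have "\<dots> = (LINT y|lebesgue. g y * mollifier s x y)"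
    proof (rule integral_cong_AE)
      have m: "mollifier s x \<in> borel_measurable lebesgue"
        by (intro measurable_completion) simp
      then show "(\<lambda>y. g0 y * mollifier s x y) \<in> borel_measurable lebesgue"
        using g0 by (intro borel_measurable_times) auto
      show "(\<lambda>y. g y * mollifier s x y) \<in> borel_measurable lebesgue"
        using m g by (intro borel_measurable_times measurable_completion[OF g(1)])
      show "AE y in lebesgue. g0 y * mollifier s x y = g y * mollifier s x y"
        using AE_completion[OF g(2)] by eventually_elim simp
    qed
    also have "\<dots> = (LINT y|lborel. g y * mollifier s x y)"
      by (intro integral_completion) simp
    finally show ?thesis .
  qed
  define h where "h = (\<lambda>x. indicator (cball x0 (r / 2)) x * (F x - g x))"
  have contF: "continuous_on (cball x0 (r/2)) F"
    using assms(3) r0 r unfolding mollify_limit_def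
    by (auto elim!: continuous_on_subset intro: order_trans[OF _ r0(2)])
  have inth: "integrable lborel h"
    using borel_integrable_compact[OF compact_cball contF] integrable_mult_indicator[OF _ intg, of "cball x0 (r/2)"]
    by (simp add: h_def right_diff_distrib)
  have "negligible {x \<in> ball x0 (r/2). h x \<noteq> 0}"
  proof (rule box_integrals_eq_0_imp_negligible[OF inth open_ball])
    fix a b assume ab: "cbox a b \<subseteq> ball x0 (r/2)"
    have ab': "cbox a b \<subseteq> ball x0 r1" "cbox a b \<subseteq> ball x0 r" "cbox a b \<subseteq> \<Omega>" using ab r r0 by (auto simp: subset_iff)
    let ?m = "\<lambda>k x. mollify \<Omega> (1 / 4 ^ k) f x"
    have X0: "(\<lambda>k. 1 / 4 ^ k :: real) \<longlonglongrightarrow> 0"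
      using LIMSEQ_power_zero[of "1/4::real"] by (simp add: power_one_over)
    have intF: "integrable lborel (\<lambda>x. indicator (cbox a b) x * F x)"
      using borel_integrable_compact[OF compact_cbox, of a b F] assms(3) ab'
      by (auto simp: mollify_limit_def intro: continuous_on_subset)
    have meas: "(\<lambda>x. indicator (cbox a b) x * (LINT y|lborel. g y * mollifier s x y)) \<in> borel_measurable lborel" for s
      by (intro borel_measurable_times lborel.borel_measurable_lebesgue_integral)
       (auto simp: split_beta intro!: borel_measurable_times mollifier_measurable)
    have ev: "\<forall>\<^sub>F k in sequentially. 1 / 4 ^ k < r"
      using order_tendstoD(2)[OF X0 r(1)] .
    have ev1: "\<forall>\<^sub>F k in sequentially. \<forall>x\<in>cbox a b. \<bar>?m k x - F x\<bar> < e" if "e > 0" for e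
      using uniform_limitD[OF uniform_limit_on_subset[OF r1(2) ab'(1)] that] by (simp add: dist_real_def)
    have "(\<lambda>k. LINT x|lborel. indicator (cbox a b) x * (LINT y|lborel. g y * mollifier (1 / 4 ^ k) x y))
       \<longlonglongrightarrow> (LINT x|lborel. indicator (cbox a b) x * F x)"
    proof -
      obtain N where N: "\<And>k. k \<ge> N \<Longrightarrow> 1 / 4 ^ k < r \<and> (\<forall>x\<in>cbox a b. \<bar>?m k x - F x\<bar> < 1)"
        using eventually_conj[OF ev ev1[of 1]] by (auto simp: eventually_sequentially)
      have "(\<lambda>k. LINT x|lborel. indicator (cbox a b) x * (LINT y|lborel. g y * mollifier (1 / 4 ^ (k + N)) x y))
       \<longlonglongrightarrow> (LINT x|lborel. indicator (cbox a b) x * F x)"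
      proof (rule integral_dominated_convergence[where w = "\<lambda>x. \<bar>indicator (cbox a b) x * F x\<bar> + indicator (cbox a b) x"])
        show "integrable lborel (\<lambda>x. \<bar>indicator (cbox a b) x * F x\<bar> + indicator (cbox a b) x)"
          using intF borel_integrable_compact[of "cbox a b" "\<lambda>_. 1::real"] by auto
        have eq: "(LINT y|lborel. g y * mollifier (1 / 4 ^ (k + N)) x y) = ?m (k + N) x" if "x \<in> cbox a b" for k x
          using moll[of x "1 / 4 ^ (k + N)"] that ab' N[of "k + N"] by auto
        show "AE x in lborel. norm (indicator (cbox a b) x * (LINT y|lborel. g y * mollifier (1 / 4 ^ (k + N)) x y))
            \<le> \<bar>indicator (cbox a b) x * F x\<bar> + indicator (cbox a b) x" for k
        proof (rule AE_I2)
          fix x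
          show "norm (indicator (cbox a b) x * (LINT y|lborel. g y * mollifier (1 / 4 ^ (k + N)) x y))
            \<le> \<bar>indicator (cbox a b) x * F x\<bar> + indicator (cbox a b) x"
          proof (cases "x \<in> cbox a b")
            case True
            then have "\<bar>?m (k + N) x - F x\<bar> < 1" using N[of "k + N"] by auto
            then show ?thesis using True eq[OF True] by simp
          qed simp
        qed
        show "AE x in lborel. (\<lambda>k. indicator (cbox a b) x * (LINT y|lborel. g y * mollifier (1 / 4 ^ (k + N)) x y))
            \<longlonglongrightarrow> indicator (cbox a b) x * F x"
        proof (rule AE_I2)
          fix x
          show "(\<lambda>k. indicator (cbox a b) x * (LINT y|lborel. g y * mollifier (1 / 4 ^ (k + N)) x y))
            \<longlonglongrightarrow> indicator (cbox a b) x * F x"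
          proof (cases "x \<in> cbox a b")
            case True
            have "(\<lambda>k. ?m k x) \<longlonglongrightarrow> F x"
              using tendsto_uniform_limitI[OF r1(2), of x] True ab' by blast
            then have "(\<lambda>k. ?m (k + N) x) \<longlonglongrightarrow> F x" by (rule LIMSEQ_ignore_initial_segment)
            then show ?thesis using True eq[OF True] by simp
          qed simp
        qed
      qed (use meas intF in auto)
      then show ?thesis by (rule LIMSEQ_offset)
    qed
    moreover have "(\<lambda>k. LINT x|lborel. indicator (cbox a b) x * (LINT y|lborel. g y * mollifier (1 / 4 ^ k) x y))
       \<longlonglongrightarrow> (LINT y|lborel. g y * indicator (cbox a b) y)"
      unfolding integral_mollifier_swap[OF intg zero_less_divide_1_iff[THEN iffD2, OF zero_less_power[OF zero_less_numeral]]]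
      by (rule integral_mollifier_box_tendsto[OF intg X0]) simp
    ultimately have "(LINT x|lborel. indicator (cbox a b) x * F x) = (LINT y|lborel. g y * indicator (cbox a b) y)"
      by (rule LIMSEQ_unique)
    moreover have "indicator (cbox a b) x * h x = indicator (cbox a b) x * F x - g x * indicator (cbox a b) x" for x
      using ab by (auto simp: h_def indicator_def subset_iff)
    ultimately show "(LINT x|lborel. indicator (cbox a b) x * h x) = 0"
      using intF integrable_mult_indicator[OF _ intg, of "cbox a b"] by (simp add: mult.commute)
  qed
  moreover have "negligible {x. g0 x \<noteq> g x}"
    using g(2) unfolding negligible_iff_null_sets
    by (subst completion.null_sets_iff_AE) (auto simp: AE_completion_iff elim: eventually_mono)
  ultimately have neg: "negligible ({x \<in> ball x0 (r/2). h x \<noteq> 0} \<union> {x. g0 x \<noteq> g x})"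
    by (rule negligible_Un)
  let ?S = "{x \<in> \<Omega>. F x \<noteq> f x}"
  show "\<exists>U. openin (top_of_set ?S) U \<and> x0 \<in> U \<and> negligible U"
  proof (intro exI conjI)
    show "openin (top_of_set ?S) (?S \<inter> ball x0 (r/2))" by (intro openin_open_Int) auto
    show "x0 \<in> ?S \<inter> ball x0 (r/2)" using x0 r \<open>F x0 \<noteq> f x0\<close> by auto
    show "negligible (?S \<inter> ball x0 (r/2))"
      by (rule negligible_subset[OF neg]) (use ball_C r in \<open>auto simp: h_def g0_def subset_iff\<close>)
  qed
qed

text \<open>A mollifier is a test function, so the difference of two weak derivatives has mollifications
  that are eventually zero.\<close>

lemma weak_deriv_unique:
  assumes "open \<Omega>" "has_weak_deriv \<Omega> is f g" "has_weak_deriv \<Omega> is f' g'" "ae_eq \<Omega> f f'"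
  shows "ae_eq \<Omega> g g'"
proof -
  have L1: "g \<in> L1_loc \<Omega>" "g' \<in> L1_loc \<Omega>" "f \<in> L1_loc \<Omega>" "f' \<in> L1_loc \<Omega>"
    using assms by (auto simp: has_weak_deriv_def)
  then have L1d: "(\<lambda>x. g x - g' x) \<in> L1_loc \<Omega>" by (simp add: L1_loc_def)
  have test: "(LINT x|lebesgue_on \<Omega>. (g x - g' x) * \<phi> x) = 0" if \<phi>: "\<phi> \<in> test_functions \<Omega>" for \<phi>
  proof -
    obtain K where K: "compact K" "K \<subseteq> \<Omega>" "\<And>x. x \<notin> K \<Longrightarrow> \<phi> x = 0"
      using \<phi> by (auto simp: test_functions_def)
    have D: "partial_derivs is \<phi> \<in> test_functions \<Omega>" using \<phi> by (rule partial_derivs_test)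
    then obtain K' where K': "compact K'" "K' \<subseteq> \<Omega>" "\<And>x. x \<notin> K' \<Longrightarrow> partial_derivs is \<phi> x = 0"
      by (auto simp: test_functions_def)
    have "(LINT x|lebesgue_on \<Omega>. f x * partial_derivs is \<phi> x) = (LINT x|lebesgue_on \<Omega>. f' x * partial_derivs is \<phi> x)"
      using assms(4) L1_loc_mult_integrable[OF assms(1) L1(3) test_continuous[OF D] K']
        L1_loc_mult_integrable[OF assms(1) L1(4) test_continuous[OF D] K']
      unfolding ae_eq_def by (intro integral_cong_AE) (auto elim: eventually_mono)
    then have "(LINT x|lebesgue_on \<Omega>. g x * \<phi> x) = (LINT x|lebesgue_on \<Omega>. g' x * \<phi> x)"
      using assms(2,3) \<phi> by (simp add: has_weak_deriv_def)
    then show ?thesis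
      using L1_loc_mult_integrable[OF assms(1) L1(1) test_continuous[OF \<phi>] K]
        L1_loc_mult_integrable[OF assms(1) L1(2) test_continuous[OF \<phi>] K]
      by (simp add: left_diff_distrib)
  qed
  have "mollify_limit \<Omega> (\<lambda>x. g x - g' x) (\<lambda>_. 0)"
    unfolding mollify_limit_def
  proof (intro conjI ballI)
    fix x assume "x \<in> \<Omega>"
    then obtain r where r: "r > 0" "cball x (2 * r) \<subseteq> \<Omega>"
      using assms(1) open_contains_cball[of \<Omega>] by (metis mult_2 half_gt_zero field_sum_of_halves)
    have "\<forall>\<^sub>F k in sequentially. 1 / 4 ^ k < r"
      using order_tendstoD(2)[OF LIMSEQ_power_zero[of "1/4::real"] r(1)] by (simp add: power_one_over)
    then have "\<forall>\<^sub>F k in sequentially. \<forall>y\<in>ball x r. mollify \<Omega> (1 / 4 ^ k) (\<lambda>x. g x - g' x) y = 0"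
    proof eventually_elim
      case (elim k)
      show ?case
      proof
        fix y assume y: "y \<in> ball x r"
        have "cball y (1 / 4 ^ k) \<subseteq> cball x (2 * r)"
        proof
          fix z assume "z \<in> cball y (1 / 4 ^ k)"
          then show "z \<in> cball x (2 * r)" using y elim dist_triangle[of x z y] by auto
        qed
        then have "bump 2 (1 / 4 ^ k) y \<in> test_functions \<Omega>"
          using r by (intro bump_test) auto
        from test[OF this] show "mollify \<Omega> (1 / 4 ^ k) (\<lambda>x. g x - g' x) y = 0"
          by (simp add: mollify_def mollifier_def)
      qed
    qed
    then show "\<exists>r>0. uniform_limit (ball x r) (\<lambda>k. mollify \<Omega> (1 / 4 ^ k) (\<lambda>x. g x - g' x)) (\<lambda>_. 0) sequentially"
      using r by (intro exI[of _ r]) (auto simp: uniform_limit_iff elim!: eventually_mono)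
  qed auto
  from mollify_limit_ae_eq[OF assms(1) L1d this] show ?thesis
    unfolding ae_eq_def by (auto elim: eventually_mono)
qed

section \<open>Mollifications at consecutive scales\<close>

lemma bump_quadratic_bound:
  assumes "s > 0"
  shows "bump n s x y * (norm (y - x))\<^sup>2 \<le> fact n * s\<^sup>2"
proof (cases "y \<in> cball x s")
  case True
  then have "(norm (y - x))\<^sup>2 \<le> s\<^sup>2"
    by (intro power_mono) (auto simp: dist_norm norm_minus_commute)
  then show ?thesis by (intro mult_mono bump_le) (auto simp: bump_nonneg)
qed (use assms in \<open>simp add: bump_eq_0\<close>)

lemma second_partial_deriv_bump:
  "partial_derivs [i, i] (bump 0 s x) y =
     (bump 4 s x y - 2 * bump 3 s x y) * (4 / s ^ 4 * (y $ i - x $ i)\<^sup>2) - 2 / s\<^sup>2 * bump 2 s x y"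
proof -
  have "((\<lambda>y. bump 2 s x y * (- 2 / s\<^sup>2 * (y $ i - x $ i))) has_derivative
     (\<lambda>h. bump 2 s x y * (- 2 / s\<^sup>2 * h $ i) +
       ((bump (2 + 2) s x y - real 2 * bump (2 + 1) s x y) * (- 2 / s\<^sup>2 * ((y - x) \<bullet> h))) * (- 2 / s\<^sup>2 * (y $ i - x $ i)))) (at y)"
    by (intro has_derivative_mult has_derivative_bump)
       (auto intro!: derivative_eq_intros bounded_linear_imp_has_derivative
         simp: fun_eq_iff divide_inverse algebra_simps)
  from partial_deriv_has_derivative[OF this, of i]
  have "partial_deriv i (\<lambda>y. bump 2 s x y * (- 2 / s\<^sup>2 * (y $ i - x $ i))) y = 
      bump 2 s x y * (- 2 / s\<^sup>2) +
       ((bump 4 s x y - 2 * bump 3 s x y) * (- 2 / s\<^sup>2 * (y $ i - x $ i))) * (- 2 / s\<^sup>2 * (y $ i - x $ i))"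
    by (simp add: inner_axis)
  moreover have "partial_deriv i (bump 0 s x) = (\<lambda>y. bump 2 s x y * (- 2 / s\<^sup>2 * (y $ i - x $ i)))"
    by (simp add: partial_deriv_bump numeral_2_eq_2)
  moreover have "p * (- 2 / s\<^sup>2) + (q * (- 2 / s\<^sup>2 * w)) * (- 2 / s\<^sup>2 * w) = q * (4 / s ^ 4 * w\<^sup>2) - 2 / s\<^sup>2 * p" for p q w
    by (simp add: power2_eq_square power4_eq_xxxx mult_ac)
  ultimately show ?thesis
    by (simp only: partial_derivs.simps)
qed

text \<open>This identity is why the profile is chosen as it is: if \<open>\<eta>\<close> satisfies \<open>\<eta>(z) z = - \<nabla>g(z)\<close>, then
  the derivative in \<open>s\<close> of \<open>s ^ - 3 \<eta>(w / s)\<close> is the Laplacian of \<open>s ^ - 2 g(w / s)\<close>. Here \<open>\<eta>\<close> is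
  twice the bump with \<open>n = 2\<close> and \<open>g\<close> the bump with \<open>n = 0\<close>.\<close>

lemma has_real_derivative_bump_scale:
  fixes x y :: "real^3"
  assumes "s > 0"
  shows "((\<lambda>s. bump 2 s x y / s ^ 3) has_real_derivative
     (\<Sum>i\<in>UNIV. partial_derivs [i, i] (bump 0 s x) y) / (2 * s\<^sup>2)) (at s)"
proof -
  define N where "N = (norm (y - x))\<^sup>2"
  have N: "(\<Sum>i\<in>UNIV. (y $ i - x $ i)\<^sup>2) = N"
    by (simp add: N_def power2_norm_eq_inner inner_vec_def) (simp add: power2_eq_square)
  have "((\<lambda>s. 1 - N / s\<^sup>2) has_real_derivative 2 * N / s ^ 3) (at s)"
    using assms by (auto intro!: derivative_eq_intros simp: field_simps power2_eq_square power3_eq_cube)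
  from DERIV_chain2[OF has_real_derivative_hump[of 2] this]
  have "((\<lambda>s. bump 2 s x y) has_real_derivative (bump 4 s x y - 2 * bump 3 s x y) * (2 * N / s ^ 3)) (at s)"
    by (simp add: bump_def N_def)
  then have "((\<lambda>s. bump 2 s x y / s ^ 3) has_real_derivative
      ((bump 4 s x y - 2 * bump 3 s x y) * (2 * N / s ^ 3) * s ^ 3 - bump 2 s x y * (3 * s\<^sup>2)) / (s ^ 3 * s ^ 3)) (at s)"
    using assms by (auto intro!: derivative_eq_intros)
  moreover have "(\<Sum>i\<in>UNIV. partial_derivs [i, i] (bump 0 s x) y) / (2 * s\<^sup>2) =
     ((bump 4 s x y - 2 * bump 3 s x y) * (4 / s ^ 4 * N) - 6 / s\<^sup>2 * bump 2 s x y) / (2 * s\<^sup>2)"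
    unfolding second_partial_deriv_bump sum_subtractf N[symmetric]
    by (simp add: sum_distrib_left sum_divide_distrib)
  moreover have "\<dots> = ((bump 4 s x y - 2 * bump 3 s x y) * (2 * N / s ^ 3) * s ^ 3 - bump 2 s x y * (3 * s\<^sup>2)) / (s ^ 3 * s ^ 3)"
    using assms by (simp add: field_simps eval_nat_numeral)
  ultimately show ?thesis by (simp only:)
qed

lemma sum_partial_derivs_bump_bound:
  fixes x y :: "real^3"
  assumes "s > 0"
  shows "\<bar>\<Sum>i\<in>UNIV. partial_derivs [i, i] (bump 0 s x) y\<bar> \<le> 156 / s\<^sup>2"
proof -
  define N where "N = (norm (y - x))\<^sup>2"
  have N: "(\<Sum>i\<in>UNIV. (y $ i - x $ i)\<^sup>2) = N"
    by (simp add: N_def power2_norm_eq_inner inner_vec_def) (simp add: power2_eq_square)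
  have eq: "(\<Sum>i\<in>UNIV. partial_derivs [i, i] (bump 0 s x) y) =
     (bump 4 s x y * N - 2 * (bump 3 s x y * N)) * (4 / s ^ 4) - 6 / s\<^sup>2 * bump 2 s x y"
  proof -
    have "(\<Sum>i\<in>UNIV. partial_derivs [i, i] (bump 0 s x) y) =
       (bump 4 s x y - 2 * bump 3 s x y) * (4 / s ^ 4 * N) - 6 / s\<^sup>2 * bump 2 s x y"
      unfolding second_partial_deriv_bump sum_subtractf N[symmetric]
      by (simp add: sum_distrib_left sum_divide_distrib)
    then show ?thesis by (simp add: algebra_simps)
  qed
  have b: "bump 4 s x y * N \<le> 24 * s\<^sup>2" "bump 3 s x y * N \<le> 6 * s\<^sup>2" "bump 2 s x y \<le> 2"
    using bump_quadratic_bound[OF assms, of 4 x y] bump_quadratic_bound[OF assms, of 3 x y] bump_le[of 2 s x y]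
    by (auto simp: N_def fact_numeral)
  have nn: "bump 4 s x y * N \<ge> 0" "bump 3 s x y * N \<ge> 0" "bump 2 s x y \<ge> 0" by (auto simp: N_def bump_nonneg)
  have "\<bar>(bump 4 s x y * N - 2 * (bump 3 s x y * N)) * (4 / s ^ 4)\<bar> \<le> (36 * s\<^sup>2) * (4 / s ^ 4)"
    unfolding abs_mult using b nn by (intro mult_mono) auto
  also have "\<dots> = 144 / s\<^sup>2" using assms by (simp add: field_simps eval_nat_numeral)
  finally have 1: "\<bar>(bump 4 s x y * N - 2 * (bump 3 s x y * N)) * (4 / s ^ 4)\<bar> \<le> 144 / s\<^sup>2" .
  have "\<bar>6 / s\<^sup>2 * bump 2 s x y\<bar> \<le> 6 / s\<^sup>2 * 2"
    unfolding abs_mult using b nn by (intro mult_mono) auto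
  then have "\<bar>6 / s\<^sup>2 * bump 2 s x y\<bar> \<le> 12 / s\<^sup>2" by simp
  with 1 show ?thesis unfolding eq by (auto simp: add_divide_distrib[symmetric] intro!: order_trans[OF abs_triangle_ineq4])
qed

text \<open>This is the Cauchy-Schwarz inequality on a ball in its additive form: \<open>2 \<bar>D\<bar> \<le> c + D\<^sup>2 / c\<close> for
  every positive \<open>c\<close>. Powers of two suffice for \<open>c\<close> below, so no square roots appear.\<close>

lemma L2_ball_bound:
  fixes D :: "real^'n \<Rightarrow> real"
  assumes "open \<Omega>" "D \<in> L2 \<Omega>" "D \<in> L1_loc \<Omega>" "cball x s \<subseteq> \<Omega>" "s > 0" "c > 0"
    and \<psi>: "continuous_on UNIV \<psi>" "\<And>y. y \<notin> cball x s \<Longrightarrow> \<psi> y = 0" "\<And>y. \<bar>\<psi> y\<bar> \<le> 1"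
  shows "\<bar>LINT y|lebesgue_on \<Omega>. D y * \<psi> y\<bar> \<le>
     (c * (unit_ball_vol (real CARD('n)) * s ^ CARD('n)) + (LINT y|lebesgue_on \<Omega>. (D y)\<^sup>2) / c) / 2"
proof -
  have \<Omega>: "\<Omega> \<in> sets lebesgue" using assms(1) by auto
  have int1: "integrable (lebesgue_on \<Omega>) (\<lambda>y. D y * \<psi> y)"
    by (rule L1_loc_mult_integrable[of _ _ _ "cball x s"]) (use assms in auto)
  have int2: "integrable (lebesgue_on \<Omega>) (\<lambda>y. (D y)\<^sup>2)" using assms(2) by (simp add: L2_def)
  let ?I = "indicator (cball x s) :: real^'n \<Rightarrow> real"
  have iI: "integrable lborel ?I" using borel_integrable_compact[of "cball x s" "\<lambda>_. 1::real"] by simp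
  have eq: "(\<lambda>y. if y \<in> \<Omega> then ?I y else 0) = ?I" using assms(4) by (auto simp: fun_eq_iff indicator_def)
  have int3: "integrable (lebesgue_on \<Omega>) ?I"
    using Lebesgue_Measure.integrable_restrict_UNIV[OF \<Omega>, of ?I] iI by (simp add: eq integrable_completion)
  have vol: "(LINT y|lebesgue_on \<Omega>. ?I y) = unit_ball_vol (real CARD('n)) * s ^ CARD('n)"
    using Lebesgue_Measure.integral_restrict_UNIV[OF \<Omega>, of ?I] assms(5)
    by (simp add: eq integral_completion content_cball)
  have "\<bar>LINT y|lebesgue_on \<Omega>. D y * \<psi> y\<bar> \<le> (LINT y|lebesgue_on \<Omega>. \<bar>D y * \<psi> y\<bar>)"
    using integral_norm_bound[of "lebesgue_on \<Omega>" "\<lambda>y. D y * \<psi> y"] by simp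
  also have "\<dots> \<le> (LINT y|lebesgue_on \<Omega>. (c * ?I y + (D y)\<^sup>2 / c) / 2)"
  proof (rule integral_mono)
    fix y
    show "\<bar>D y * \<psi> y\<bar> \<le> (c * ?I y + (D y)\<^sup>2 / c) / 2"
    proof (cases "y \<in> cball x s")
      case True
      have "\<bar>D y * \<psi> y\<bar> \<le> \<bar>D y\<bar>" using \<psi>(3)[of y] by (simp add: abs_mult mult_left_le)
      also have "\<bar>D y\<bar> \<le> (c + (D y)\<^sup>2 / c) / 2"
      proof -
        have "0 \<le> (c - \<bar>D y\<bar>)\<^sup>2 / c" using assms by simp
        also have "\<dots> = c + (D y)\<^sup>2 / c - 2 * \<bar>D y\<bar>" using assms by (simp add: field_simps power2_eq_square)
        finally show ?thesis by simp
      qed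
      finally show ?thesis using True by simp
    next
      case False
      then show ?thesis using assms by (simp add: \<psi>(2))
    qed
  qed (use int1 int2 int3 in auto)
  also have "\<dots> = (c * (unit_ball_vol (real CARD('n)) * s ^ CARD('n)) + (LINT y|lebesgue_on \<Omega>. (D y)\<^sup>2) / c) / 2"
    using int2 int3 vol by simp
  finally show ?thesis .
qed

text \<open>Differentiation under the integral produces a Laplacian on the kernel, which the second weak
  derivatives of \<open>f\<close> absorb.\<close>

lemma has_real_derivative_mollify_scale:
  fixes f :: "real^3 \<Rightarrow> real"
  assumes "open \<Omega>" and D: "\<And>i. has_weak_deriv \<Omega> [i, i] f (D i)"
    and s: "0 < s" "s < S" "cball x S \<subseteq> \<Omega>"
  shows "((\<lambda>s. mollify \<Omega> s f x) has_real_derivative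
     (\<Sum>i\<in>UNIV. LINT y|lebesgue_on \<Omega>. D i y * bump 0 s x y) / (2 * s\<^sup>2 * (LINT z|lborel. bump 2 1 (0 :: real^3) z))) (at s)"
proof -
  define M where "M = (LINT z|lborel. bump 2 1 (0 :: real^3) z)"
  have M: "M > 0" unfolding M_def by (rule bump_mass_pos)
  define C where "C = cball x S"
  have C: "compact C" "C \<subseteq> \<Omega>" "C \<in> sets lebesgue" using s by (auto simp: C_def dest: lmeasurable_compact)
  have f: "f \<in> L1_loc \<Omega>" using D by (auto simp: has_weak_deriv_def)
  have fC: "integrable (lebesgue_on C) f" using f C by (auto simp: L1_loc_def)
  define d where "d = min (s / 2) (S - s)"
  have d: "d > 0" using s by (auto simp: d_def)
  have near: "0 < t" "s / 2 \<le> t" "t < S" if "\<bar>t - s\<bar> < d" for t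
    using that s unfolding d_def by (auto simp: abs_less_iff min_def split: if_splits)
  let ?K' = "\<lambda>t y. (\<Sum>i\<in>UNIV. partial_derivs [i, i] (bump 0 t x) y) / (2 * t\<^sup>2) / M"
  have "((\<lambda>t. LINT y|lebesgue_on C. f y * (bump 2 t x y / t ^ 3 / M)) has_real_derivative
      (LINT y|lebesgue_on C. f y * ?K' s y)) (at s)"
  proof (rule has_real_derivative_integral[OF fC d, where B = "156 / (s / 2)\<^sup>2 / (2 * (s / 2)\<^sup>2) / M"])
    fix t assume "\<bar>t - s\<bar> < d"
    note t = near[OF this]
    show "((\<lambda>t. bump 2 t x y / t ^ 3 / M) has_real_derivative ?K' t y) (at t)" for y
      by (intro DERIV_cdivide has_real_derivative_bump_scale t)
    have cont: "continuous_on UNIV (\<lambda>y. bump 2 t x y / t ^ 3 / M)"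
      by (auto simp: divide_inverse intro!: continuous_intros)
    show "(\<lambda>y. bump 2 t x y / t ^ 3 / M) \<in> borel_measurable (lebesgue_on C)"
      using cont C by (intro continuous_imp_measurable_on_sets_lebesgue) (auto intro: continuous_on_subset)
    have "integrable (lebesgue_on \<Omega>) (\<lambda>y. f y * (bump 2 t x y / t ^ 3 / M))"
      by (rule L1_loc_mult_integrable[OF assms(1) f cont, of "cball x t"]) (use t s in \<open>auto simp: bump_eq_0\<close>)
    moreover have "f y * (bump 2 t x y / t ^ 3 / M) = 0" if "y \<in> \<Omega> - C" for y
      using bump_eq_0[of t y x 2] t that by (auto simp: C_def)
    ultimately show "integrable (lebesgue_on C) (\<lambda>y. f y * (bump 2 t x y / t ^ 3 / M))"
      using integrable_lebesgue_on_supported(1)[of C \<Omega>] C assms(1) by auto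
    show "\<bar>?K' t y\<bar> \<le> 156 / (s / 2)\<^sup>2 / (2 * (s / 2)\<^sup>2) / M" for y
    proof -
      have "\<bar>?K' t y\<bar> = \<bar>\<Sum>i\<in>UNIV. partial_derivs [i, i] (bump 0 t x) y\<bar> / (2 * t\<^sup>2) / M"
        using M by simp
      also have "\<dots> \<le> 156 / t\<^sup>2 / (2 * t\<^sup>2) / M"
        using M by (intro divide_right_mono sum_partial_derivs_bump_bound t) auto
      also have "\<dots> \<le> 156 / (s / 2)\<^sup>2 / (2 * (s / 2)\<^sup>2) / M"
        using M t s by (intro divide_right_mono frac_le mult_left_mono power_mono mult_pos_pos) auto
      finally show ?thesis .
    qed
  qed
  moreover have "(LINT y|lebesgue_on C. f y * ?K' s y) = (\<Sum>i\<in>UNIV. LINT y|lebesgue_on \<Omega>. D i y * bump 0 s x y) / (2 * s\<^sup>2 * M)"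
  proof -
    have b: "bump 0 s x \<in> test_functions \<Omega>" using s by (intro bump_test) (auto intro: order_trans[OF _ s(3)])
    have zero: "partial_derivs [i, i] (bump 0 s x) y = 0" if "y \<notin> cball x s" for i y
      using that s unfolding second_partial_deriv_bump by (simp add: bump_eq_0)
    have int: "integrable (lebesgue_on \<Omega>) (\<lambda>y. f y * partial_derivs [i, i] (bump 0 s x) y)" for i
      by (rule L1_loc_mult_integrable[OF assms(1) f test_continuous[OF partial_derivs_test[OF b]], of "cball x s"])
         (use zero s in auto)
    have "(LINT y|lebesgue_on C. f y * ?K' s y) = (LINT y|lebesgue_on \<Omega>. f y * ?K' s y)"
      using C assms(1) zero s
      by (intro integrable_lebesgue_on_supported(2)[symmetric]) (auto simp: C_def simp del: partial_derivs.simps)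
    also have "\<dots> = (LINT y|lebesgue_on \<Omega>. (\<Sum>i\<in>UNIV. f y * partial_derivs [i, i] (bump 0 s x) y) / (2 * s\<^sup>2 * M))"
      by (simp add: sum_distrib_left)
    also have "\<dots> = (\<Sum>i\<in>UNIV. LINT y|lebesgue_on \<Omega>. f y * partial_derivs [i, i] (bump 0 s x) y) / (2 * s\<^sup>2 * M)"
      using int by (simp del: partial_derivs.simps)
    also have "\<dots> = (\<Sum>i\<in>UNIV. LINT y|lebesgue_on \<Omega>. D i y * bump 0 s x y) / (2 * s\<^sup>2 * M)"
      using D b unfolding has_weak_deriv_def by (simp del: partial_derivs.simps)
    finally show ?thesis .
  qed
  ultimately have "((\<lambda>t. LINT y|lebesgue_on C. f y * (bump 2 t x y / t ^ 3 / M)) has_real_derivative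
      (\<Sum>i\<in>UNIV. LINT y|lebesgue_on \<Omega>. D i y * bump 0 s x y) / (2 * s\<^sup>2 * M)) (at s)" by (simp only:)
  then show ?thesis unfolding M_def[symmetric]
  proof (rule has_field_derivative_transform_within_open)
    show "open (ball s d)" "s \<in> ball s d" using d by auto
    fix t assume "t \<in> ball s d"
    then have t: "0 < t" "t < S" using near[of t] by (auto simp: dist_real_def abs_minus_commute)
    show "(LINT y|lebesgue_on C. f y * (bump 2 t x y / t ^ 3 / M)) = mollify \<Omega> t f x"
      using mollify_eq[OF assms(1) C(1,2), of x t f] t subset_cball[of t S x] by (simp add: C_def mollifier_def M_def)
  qed
qed

text \<open>The derivative with respect to the scale \<open>s\<close> is at most of the order \<open>s ^ - 2\<close> times the
  \<open>L\<^sup>1\<close> norm of the second derivatives on a ball of radius \<open>s\<close>, hence of the order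
  \<open>s ^ - 2 * s ^ (3 / 2)\<close>. This is integrable at zero, which is where dimension three enters.\<close>

lemma mollify_dyadic_bound:
  fixes f :: "real^3 \<Rightarrow> real"
  assumes "open \<Omega>" and D: "\<And>i. has_weak_deriv \<Omega> [i, i] f (D i)" "\<And>i. D i \<in> L2 \<Omega>"
  obtains c where "c \<ge> 0" "\<And>x k. cball x (2 / 4 ^ k) \<subseteq> \<Omega> \<Longrightarrow>
     \<bar>mollify \<Omega> (1 / 4 ^ Suc k) f x - mollify \<Omega> (1 / 4 ^ k) f x\<bar> \<le> c / 2 ^ k"
proof -
  define M where "M = (LINT z|lborel. bump 2 1 (0 :: real^3) z)"
  have M: "M > 0" unfolding M_def by (rule bump_mass_pos)
  define V where "V = unit_ball_vol 3"
  have V: "V \<ge> 0" by (simp add: V_def)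
  define E where "E = (\<Sum>i\<in>UNIV. LINT y|lebesgue_on \<Omega>. (D i y)\<^sup>2)"
  have E: "E \<ge> 0" unfolding E_def by (intro sum_nonneg Bochner_Integration.integral_nonneg) auto
  show ?thesis
  proof
    show "4 * (3 * V + E) / M \<ge> 0" using V E M by simp
    fix x :: "real^3" and k :: nat assume sub: "cball x (2 / 4 ^ k) \<subseteq> \<Omega>"
    let ?a = "1 / 4 ^ Suc k :: real" and ?b = "1 / 4 ^ k :: real"
    let ?d = "\<lambda>s. (\<Sum>i\<in>UNIV. LINT y|lebesgue_on \<Omega>. D i y * bump 0 s x y) / (2 * s\<^sup>2 * M)"
    have ab: "0 < ?a" "?a < ?b" by (auto simp: divide_simps)
    have "\<exists>z>?a. z < ?b \<and> mollify \<Omega> ?b f x - mollify \<Omega> ?a f x = (?b - ?a) * ?d z"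
    proof (rule MVT2[OF ab(2)])
      fix s assume s: "?a \<le> s" "s \<le> ?b"
      have "0 < s" "s < 2 / 4 ^ k" using s ab by (linarith, auto intro: le_less_trans simp: divide_strict_right_mono)
      then show "((\<lambda>s. mollify \<Omega> s f x) has_real_derivative ?d s) (at s)"
        unfolding M_def
        by (intro has_real_derivative_mollify_scale[OF assms(1) D(1) _ _ sub])
    qed
    then obtain s where s: "?a < s" "s < ?b" "mollify \<Omega> ?b f x - mollify \<Omega> ?a f x = (?b - ?a) * ?d s" by blast
    have s0: "s > 0" using s ab by linarith
    have ball: "cball x s \<subseteq> \<Omega>"
      using s(2) by (intro order_trans[OF _ sub] cball_subset_cball_iff[THEN iffD2]) (auto simp: divide_simps)
    have s3: "s ^ 3 \<le> ?b ^ 3" using s s0 by (intro power_mono) auto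
    \<comment> \<open>The choice \<open>c = 8 ^ k\<close> balances the two terms, because \<open>s\<close> is of the order \<open>4 ^ - k\<close>.\<close>
    have each: "\<bar>LINT y|lebesgue_on \<Omega>. D i y * bump 0 s x y\<bar> \<le> (V / 8 ^ k + (LINT y|lebesgue_on \<Omega>. (D i y)\<^sup>2) / 8 ^ k) / 2" for i
    proof -
      have "\<bar>LINT y|lebesgue_on \<Omega>. D i y * bump 0 s x y\<bar> \<le> (8 ^ k * (V * s ^ 3) + (LINT y|lebesgue_on \<Omega>. (D i y)\<^sup>2) / 8 ^ k) / 2"
        using L2_ball_bound[OF assms(1) D(2) _ ball s0, of i "8 ^ k" "bump 0 s x"] D(1)[of i]
          bump_le[of 0 s x] bump_nonneg[of 0 s x] bump_eq_0[OF s0, of _ x 0]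
          continuous_on_bump[OF continuous_on_const continuous_on_id, of UNIV 0 s x]
        by (auto simp: V_def has_weak_deriv_def)
      also have "\<dots> \<le> (8 ^ k * (V * ?b ^ 3) + (LINT y|lebesgue_on \<Omega>. (D i y)\<^sup>2) / 8 ^ k) / 2"
        using V s3 by (intro divide_right_mono add_right_mono mult_left_mono) auto
      also have "8 ^ k * (V * ?b ^ 3) = V / 8 ^ k"
      proof -
        have "(4 ^ k) ^ 3 = (8 ^ k * 8 ^ k :: real)"
          by (simp add: power_mult[symmetric] mult.commute[of k] power_mult power_mult_distrib[symmetric])
        then show ?thesis by (simp add: power_divide field_simps)
      qed
      finally show ?thesis by (simp add: V_def)
    qed
    have "\<bar>\<Sum>i\<in>UNIV. LINT y|lebesgue_on \<Omega>. D i y * bump 0 s x y\<bar> \<le> (\<Sum>i\<in>(UNIV :: 3 set). (V / 8 ^ k + (LINT y|lebesgue_on \<Omega>. (D i y)\<^sup>2) / 8 ^ k) / 2)"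
      by (rule order_trans[OF sum_abs sum_mono[OF each]])
    also have "\<dots> = (3 * V + E) / 8 ^ k / 2"
      by (simp add: E_def sum.distrib sum_divide_distrib[symmetric] add_divide_distrib)
    finally have num: "\<bar>\<Sum>i\<in>UNIV. LINT y|lebesgue_on \<Omega>. D i y * bump 0 s x y\<bar> \<le> (3 * V + E) / 8 ^ k / 2" .
    have s2: "?a\<^sup>2 \<le> s\<^sup>2" using s ab by (intro power_mono) auto
    have "\<bar>?d s\<bar> = \<bar>\<Sum>i\<in>UNIV. LINT y|lebesgue_on \<Omega>. D i y * bump 0 s x y\<bar> / (2 * s\<^sup>2 * M)"
      using M by (simp add: abs_mult)
    also have "\<dots> \<le> ((3 * V + E) / 8 ^ k / 2) / (2 * ?a\<^sup>2 * M)"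
      using M V E s2 s0 by (intro frac_le num mult_right_mono mult_left_mono) auto
    also have "\<dots> = 4 * (3 * V + E) / M * 2 ^ k"
    proof -
      have "(4 ^ k)\<^sup>2 = (8 ^ k * 2 ^ k :: real)"
        by (simp add: power_mult[symmetric] mult.commute[of k] power_mult power_mult_distrib[symmetric])
      then show ?thesis using M by (simp add: power_divide power_mult_distrib field_simps)
    qed
    finally have dn: "\<bar>?d s\<bar> \<le> 4 * (3 * V + E) / M * 2 ^ k" .
    have "\<bar>mollify \<Omega> ?a f x - mollify \<Omega> ?b f x\<bar> = (?b - ?a) * \<bar>?d s\<bar>"
      using s(3) ab by (subst abs_minus_commute) (simp add: abs_mult)
    also have "\<dots> \<le> ?b * (4 * (3 * V + E) / M * 2 ^ k)"
      using ab by (intro mult_mono dn) auto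
    also have "\<dots> = 4 * (3 * V + E) / M / 2 ^ k"
    proof -
      have "(4 ^ k) = (2 ^ k * 2 ^ k :: real)" by (simp add: power_mult_distrib[symmetric])
      then show ?thesis using M by (simp only:) (simp add: field_simps)
    qed
    finally show "\<bar>mollify \<Omega> ?a f x - mollify \<Omega> ?b f x\<bar> \<le> 4 * (3 * V + E) / M / 2 ^ k" .
  qed
qed

section \<open>The embedding of second order Sobolev functions into continuous functions\<close>

lemma continuous_on_mollify:
  fixes f :: "real^'n \<Rightarrow> real"
  assumes "open \<Omega>" "f \<in> L1_loc \<Omega>" "s > 0" "compact C" "C \<subseteq> \<Omega>" "\<And>x. x \<in> U \<Longrightarrow> cball x s \<subseteq> C"
  shows "continuous_on U (mollify \<Omega> s f)"
proof -
  have fC: "integrable (lebesgue_on C) f" and C: "C \<in> sets lebesgue"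
    using assms by (auto simp: L1_loc_def dest: lmeasurable_compact)
  obtain B where B: "\<And>x y :: real^'n. mollifier s x y \<le> B"
    using mollifier_le[where s = s and 'n = 'n] by metis
  have m: "mollifier s x \<in> borel_measurable (lebesgue_on C)" for x
    using C by (intro continuous_imp_measurable_on_sets_lebesgue continuous_intros)
  have "continuous_on U (\<lambda>x. LINT y|lebesgue_on C. f y * mollifier s x y)"
    unfolding continuous_on_sequentially o_def
  proof safe
    fix X :: "nat \<Rightarrow> real^'n" and x assume "(\<forall>n. X n \<in> U)" "x \<in> U" and lim: "X \<longlonglongrightarrow> x"
    show "(\<lambda>n. LINT y|lebesgue_on C. f y * mollifier s (X n) y) \<longlonglongrightarrow> (LINT y|lebesgue_on C. f y * mollifier s x y)"
    proof (rule integral_dominated_convergence[where w = "\<lambda>y. \<bar>f y\<bar> * B"])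
      show "AE y in lebesgue_on C. (\<lambda>n. f y * mollifier s (X n) y) \<longlonglongrightarrow> f y * mollifier s x y"
      proof (rule AE_I2)
        fix y :: "real^'n"
        have c: "continuous_on UNIV (\<lambda>x. mollifier s x y)" by (intro continuous_intros)
        have "(\<lambda>n. mollifier s (X n) y) \<longlonglongrightarrow> mollifier s x y"
          using continuous_on_tendsto_compose[OF c lim] by simp
        then show "(\<lambda>n. f y * mollifier s (X n) y) \<longlonglongrightarrow> f y * mollifier s x y"
          by (intro tendsto_intros)
      qed
      show "AE y in lebesgue_on C. norm (f y * mollifier s (X n) y) \<le> \<bar>f y\<bar> * B" for n
        using B by (intro AE_I2) (simp add: abs_mult mollifier_nonneg[OF assms(3)] mult_left_mono)
    qed (use fC m in auto)
  qed
  then show ?thesis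
    by (rule continuous_on_eq) (use mollify_eq[OF assms(1,4,5,6,3)] in auto)
qed

text \<open>The local form of the Sobolev embedding of \<open>H\<^sup>2\<close> into continuous functions in dimension three:
  the geometric bound makes the mollifications uniformly Cauchy near each point.\<close>

theorem ex_mollify_limit:
  fixes f :: "real^3 \<Rightarrow> real"
  assumes "open \<Omega>" and "\<And>i. \<exists>D\<in>L2 \<Omega>. has_weak_deriv \<Omega> [i, i] f D"
  shows "\<exists>F. mollify_limit \<Omega> f F"
proof -
  obtain D where D: "\<And>i. has_weak_deriv \<Omega> [i, i] f (D i)" "\<And>i. D i \<in> L2 \<Omega>"
    using assms(2) by metis
  obtain c where c: "c \<ge> 0" "\<And>x k. cball x (2 / 4 ^ k) \<subseteq> \<Omega> \<Longrightarrow>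
     \<bar>mollify \<Omega> (1 / 4 ^ Suc k) f x - mollify \<Omega> (1 / 4 ^ k) f x\<bar> \<le> c / 2 ^ k"
    using mollify_dyadic_bound[OF assms(1) D] by metis
  have f: "f \<in> L1_loc \<Omega>" using D by (auto simp: has_weak_deriv_def)
  let ?m = "\<lambda>k x. mollify \<Omega> (1 / 4 ^ k) f x"
  define F where "F x = lim (\<lambda>k. ?m k x)" for x
  have local: "\<exists>r>0. (\<forall>e>0. \<forall>\<^sub>F k in sequentially. \<forall>y\<in>ball x r. \<bar>?m k y - F y\<bar> < e) \<and>
      (\<forall>\<^sub>F k in sequentially. continuous_on (ball x r) (?m k))" if x: "x \<in> \<Omega>" for x
  proof -
    obtain R where R: "R > 0" "cball x R \<subseteq> \<Omega>" using assms(1) x open_contains_cball by blast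
    have "\<forall>\<^sub>F k in sequentially. 4 * (1 / 4) ^ k < R"
      using order_tendstoD(2)[OF tendsto_mult[OF tendsto_const LIMSEQ_power_zero[of "1/4::real"]], of 4 R] R(1) by simp
    then obtain N where "4 * (1 / 4) ^ N < R"
      unfolding eventually_sequentially by blast
    then have N: "4 / 4 ^ N < R" by (simp add: power_one_over)
    define r :: real where "r = 1 / 4 ^ N"
    have r: "r > 0" "4 * r < R" using N by (auto simp: r_def)
    have sk: "1 / 4 ^ k \<le> r" if "k \<ge> N" for k using that by (auto simp: r_def frac_le)
    have sub: "cball y (2 / 4 ^ k) \<subseteq> cball x R" if "y \<in> ball x r" "k \<ge> N" for y k
    proof
      fix z assume "z \<in> cball y (2 / 4 ^ k)"
      then have "dist y z \<le> 2 * r" using sk[OF that(2)] by auto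
      then show "z \<in> cball x R" using that r dist_triangle[of x z y] by auto
    qed
    have tele: "\<bar>?m (k + i) y - ?m k y\<bar> \<le> 2 * c / 2 ^ k - 2 * c / 2 ^ (k + i)" if y: "y \<in> ball x r" "k \<ge> N" for y k i
    proof (induction i)
      case (Suc i)
      have "\<bar>?m (Suc (k + i)) y - ?m (k + i) y\<bar> \<le> c / 2 ^ (k + i)"
        by (rule c(2)) (rule order_trans[OF sub[OF y(1)] R(2)], use y in simp)
      moreover have "c / 2 ^ (k + i) = 2 * c / 2 ^ (k + i) - 2 * c / 2 ^ Suc (k + i)" by simp
      ultimately show ?case using Suc.IH unfolding add_Suc_right by linarith
    qed simp
    have tele': "\<bar>?m j y - ?m k y\<bar> \<le> 2 * c / 2 ^ k" if "y \<in> ball x r" "k \<ge> N" "j \<ge> k" for y j k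
    proof -
      have "0 \<le> 2 * c / 2 ^ j" using c by simp
      then show ?thesis using tele[OF that(1,2), of "j - k"] that(3) by simp
    qed
    have c0: "(\<lambda>k. 2 * c / 2 ^ k) \<longlonglongrightarrow> 0"
    proof -
      have "(\<lambda>k. 2 * c * (1 / 2) ^ k) \<longlonglongrightarrow> 0" by (auto intro!: tendsto_eq_intros LIMSEQ_power_zero)
      then show ?thesis by (simp add: power_one_over)
    qed
    have conv: "(\<lambda>k. ?m k y) \<longlonglongrightarrow> F y" if y: "y \<in> ball x r" for y
    proof -
      have "Cauchy (\<lambda>k. ?m k y)"
      proof (rule CauchyI')
        fix e :: real assume "e > 0"
        then have "\<forall>\<^sub>F k in sequentially. 2 * c / 2 ^ k < e \<and> k \<ge> N"
          using order_tendstoD(2)[OF c0] eventually_ge_at_top[of N] by (intro eventually_conj) auto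
        then obtain k0 where k0: "\<And>k. k \<ge> k0 \<Longrightarrow> 2 * c / 2 ^ k < e \<and> k \<ge> N"
          by (auto simp: eventually_sequentially)
        show "\<exists>M. \<forall>m\<ge>M. \<forall>n>m. dist (?m m y) (?m n y) < e"
        proof (intro exI[of _ k0] allI impI)
          fix m n assume mn: "m \<ge> k0" "n > m"
          have "\<bar>?m n y - ?m m y\<bar> \<le> 2 * c / 2 ^ m"
            by (rule tele'[OF y]) (use mn k0[OF mn(1)] in simp_all)
          also have "\<dots> < e" using k0[OF mn(1)] by simp
          finally show "dist (?m m y) (?m n y) < e" by (simp only: dist_real_def abs_minus_commute)
        qed
      qed
      then show ?thesis unfolding F_def by (simp add: Cauchy_convergent convergent_LIMSEQ_iff[symmetric])
    qed
    have bound: "\<bar>?m k y - F y\<bar> \<le> 2 * c / 2 ^ k" if y: "y \<in> ball x r" "k \<ge> N" for y k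
    proof -
      have "(\<lambda>j. \<bar>?m j y - ?m k y\<bar>) \<longlonglongrightarrow> \<bar>F y - ?m k y\<bar>"
        by (intro tendsto_intros conv y)
      then have "\<bar>F y - ?m k y\<bar> \<le> 2 * c / 2 ^ k"
        by (rule LIMSEQ_le_const2) (use tele'[OF y] in auto)
      then show ?thesis by (simp add: abs_minus_commute)
    qed
    show ?thesis
    proof (intro exI[of _ r] conjI allI impI)
      fix e :: real assume "e > 0"
      then have "\<forall>\<^sub>F k in sequentially. 2 * c / 2 ^ k < e \<and> k \<ge> N"
        using order_tendstoD(2)[OF c0] eventually_ge_at_top[of N] by (intro eventually_conj) auto
      then show "\<forall>\<^sub>F k in sequentially. \<forall>y\<in>ball x r. \<bar>?m k y - F y\<bar> < e"
      proof eventually_elim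
        case (elim k)
        show ?case
          by (intro ballI le_less_trans[OF bound]) (use elim in simp_all)
      qed
    next
      show "\<forall>\<^sub>F k in sequentially. continuous_on (ball x r) (?m k)"
        using eventually_ge_at_top[of N]
      proof eventually_elim
        case (elim k)
        have "cball y (1 / 4 ^ k) \<subseteq> cball x R" if "y \<in> ball x r" for y
          by (rule order_trans[OF subset_cball sub[OF that elim]]) (simp add: divide_right_mono)
        then show ?case
          using R by (intro continuous_on_mollify[OF assms(1) f _ compact_cball[of x R]]) auto
      qed
    qed (use r in auto)
  qed
  have unif: "\<exists>r>0. uniform_limit (ball x r) ?m F sequentially \<and> (\<forall>\<^sub>F k in sequentially. continuous_on (ball x r) (?m k))"
    if "x \<in> \<Omega>" for x
    using local[OF that] by (auto simp: uniform_limit_iff dist_real_def)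
  have "isCont F x" if x: "x \<in> \<Omega>" for x
  proof -
    obtain r where r: "r > 0" "uniform_limit (ball x r) ?m F sequentially"
      "\<forall>\<^sub>F k in sequentially. continuous_on (ball x r) (?m k)" using unif[OF x] by blast
    have "continuous_on (ball x r) F"
      by (rule uniform_limit_theorem[OF r(3,2)]) simp
    then show ?thesis using r(1) by (simp add: continuous_on_eq_continuous_at)
  qed
  then have "continuous_on \<Omega> F" by (simp add: continuous_at_imp_continuous_on)
  then have "mollify_limit \<Omega> f F" unfolding mollify_limit_def using unif by blast
  then show ?thesis by (intro exI[of _ F])
qed

lemma has_real_derivative_mollify_translate:
  fixes f :: "real^'n \<Rightarrow> real"
  assumes "open \<Omega>" "has_weak_deriv \<Omega> [i] f g" "s > 0" "d > 0"
    and C: "compact C" "C \<subseteq> \<Omega>" "\<And>t. \<bar>t - t0\<bar> < d \<Longrightarrow> cball (x + t *\<^sub>R axis i 1) s \<subseteq> C"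
  shows "((\<lambda>t. mollify \<Omega> s f (x + t *\<^sub>R axis i 1)) has_real_derivative mollify \<Omega> s g (x + t0 *\<^sub>R axis i 1)) (at t0)"
proof -
  let ?e = "axis i 1 :: real^'n"
  define A where "A = s ^ CARD('n) * (LINT z|lborel. bump 2 1 (0 :: real^'n) z)"
  have A: "A > 0" using assms(3) bump_mass_pos[where 'n = 'n] by (simp add: A_def)
  have mol: "mollifier s x y = bump 2 s x y / A" for x y :: "real^'n" by (simp add: mollifier_def A_def)
  have f: "f \<in> L1_loc \<Omega>" using assms(2) by (simp add: has_weak_deriv_def)
  have Cl: "C \<in> sets lebesgue" using C by (auto dest: lmeasurable_compact)
  have fC: "integrable (lebesgue_on C) f" using f C by (auto simp: L1_loc_def)
  let ?K' = "\<lambda>t y. - partial_deriv i (bump 2 s (x + t *\<^sub>R ?e)) y / A"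
  have "((\<lambda>t. LINT y|lebesgue_on C. f y * mollifier s (x + t *\<^sub>R ?e) y) has_real_derivative
      (LINT y|lebesgue_on C. f y * ?K' t0 y)) (at t0)"
  proof (rule has_real_derivative_integral[OF fC assms(4), where B = "36 * (2 / s) / A"])
    fix t assume t: "\<bar>t - t0\<bar> < d"
    show "((\<lambda>t. mollifier s (x + t *\<^sub>R ?e) y) has_real_derivative ?K' t y) (at t)" for y
    proof -
      have "((\<lambda>t. bump 2 s y (x + t *\<^sub>R ?e)) has_real_derivative
          (bump 4 s y (x + t *\<^sub>R ?e) - 2 * bump 3 s y (x + t *\<^sub>R ?e)) * (- 2 / s\<^sup>2 * ((x + t *\<^sub>R ?e - y) \<bullet> ?e))) (at t)"
          using has_directional_derivative[OF has_derivative_bump[of 2 s y "x + t *\<^sub>R ?e"]] by simp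
      moreover have "(bump 4 s y z - 2 * bump 3 s y z) * (- 2 / s\<^sup>2 * ((z - y) \<bullet> ?e)) = - partial_deriv i (bump 2 s z) y" for z
        by (simp add: partial_deriv_bump inner_axis bump_commute[of _ s y] divide_inverse algebra_simps eval_nat_numeral)
      ultimately have "((\<lambda>t. bump 2 s (x + t *\<^sub>R ?e) y) has_real_derivative - partial_deriv i (bump 2 s (x + t *\<^sub>R ?e)) y) (at t)"
        by (simp only: bump_commute[of _ _ _ y])
      then show ?thesis unfolding mol by (rule DERIV_cdivide)
    qed
    show m: "mollifier s (x + t *\<^sub>R ?e) \<in> borel_measurable (lebesgue_on C)"
      using Cl by (intro continuous_imp_measurable_on_sets_lebesgue continuous_intros)
    have "integrable (lebesgue_on \<Omega>) (\<lambda>y. f y * mollifier s (x + t *\<^sub>R ?e) y)"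
      by (rule L1_loc_mult_integrable[OF assms(1) f _ compact_cball[of "x + t *\<^sub>R ?e" s]])
         (use C(2) C(3)[OF t] assms(3) mollifier_eq_0 in \<open>auto intro!: continuous_intros\<close>)
    moreover have "f y * mollifier s (x + t *\<^sub>R ?e) y = 0" if "y \<in> \<Omega> - C" for y
    proof -
      have "y \<notin> cball (x + t *\<^sub>R ?e) s" using that C(3)[OF t] by blast
      then show ?thesis using mollifier_eq_0[OF assms(3), of y "x + t *\<^sub>R ?e"] by simp
    qed
    ultimately show "integrable (lebesgue_on C) (\<lambda>y. f y * mollifier s (x + t *\<^sub>R ?e) y)"
      using integrable_lebesgue_on_supported(1)[of C \<Omega>] C Cl assms(1) by auto
    show "\<bar>?K' t y\<bar> \<le> 36 * (2 / s) / A" for y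
    proof (cases "y \<in> cball (x + t *\<^sub>R ?e) s")
      case True
      let ?x = "x + t *\<^sub>R ?e"
      have "\<bar>y $ i - ?x $ i\<bar> \<le> norm (y - ?x)" using component_le_norm_cart[of "y - ?x" i] by simp
      also have "\<dots> \<le> s" using True by (simp add: dist_norm norm_minus_commute)
      finally have 1: "\<bar>y $ i - ?x $ i\<bar> \<le> s" .
      have 2: "\<bar>bump 4 s ?x y - 2 * bump 3 s ?x y\<bar> \<le> 36"
        using bump_le[of 4 s ?x y] bump_le[of 3 s ?x y] bump_nonneg[of 4 s ?x y] bump_nonneg[of 3 s ?x y]
        by (simp add: fact_numeral abs_le_iff)
      have "\<bar>partial_deriv i (bump 2 s ?x) y\<bar> = \<bar>bump 4 s ?x y - 2 * bump 3 s ?x y\<bar> * (2 / s\<^sup>2 * \<bar>y $ i - ?x $ i\<bar>)"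
      proof -
        have *: "\<bar>p * (- 2 / s\<^sup>2 * w)\<bar> = \<bar>p\<bar> * (2 / s\<^sup>2 * \<bar>w\<bar>)" for p w :: real
          by (simp add: abs_mult)
        show ?thesis unfolding partial_deriv_bump * by simp
      qed
      also have "\<dots> \<le> 36 * (2 / s\<^sup>2 * s)"
        by (intro mult_mono 2 mult_left_mono 1) auto
      also have "2 / s\<^sup>2 * s = 2 / s" using assms(3) by (simp add: power2_eq_square)
      finally have "\<bar>partial_deriv i (bump 2 s ?x) y\<bar> / A \<le> 36 * (2 / s) / A"
        using A by (intro divide_right_mono) auto
      then show ?thesis using A by simp
    next
      case False
      then show ?thesis using assms(3) A by (simp add: partial_deriv_bump bump_eq_0)
    qed
  qed
  moreover have "(LINT y|lebesgue_on C. f y * ?K' t0 y) = mollify \<Omega> s g (x + t0 *\<^sub>R ?e)"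
  proof -
    let ?x = "x + t0 *\<^sub>R ?e"
    have ball: "cball ?x s \<subseteq> C" using C(3)[of t0] assms(4) by simp
    then have b: "bump 2 s ?x \<in> test_functions \<Omega>" using C assms(3) by (intro bump_test) auto
    have zero: "f y * ?K' t0 y = 0" if "y \<in> \<Omega> - C" for y
    proof -
      have "y \<notin> cball ?x s" using ball that by blast
      then have "bump n s ?x y = 0" for n using bump_eq_0[OF assms(3), of y ?x n] by simp
      then show ?thesis by (simp add: partial_deriv_bump)
    qed
    have "(LINT y|lebesgue_on C. f y * ?K' t0 y) = (LINT y|lebesgue_on \<Omega>. f y * ?K' t0 y)"
      using C Cl assms(1) zero by (intro integrable_lebesgue_on_supported(2)[symmetric]) auto
    also have "\<dots> = - (LINT y|lebesgue_on \<Omega>. f y * partial_derivs [i] (bump 2 s ?x) y) / A"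
      by simp
    also have "\<dots> = (LINT y|lebesgue_on \<Omega>. g y * bump 2 s ?x y) / A"
      using assms(2) b by (simp add: has_weak_deriv_def)
    finally show ?thesis by (simp add: mollify_def mol)
  qed
  ultimately have "((\<lambda>t. LINT y|lebesgue_on C. f y * mollifier s (x + t *\<^sub>R ?e) y) has_real_derivative
      mollify \<Omega> s g (x + t0 *\<^sub>R ?e)) (at t0)" by (simp only:)
  then show ?thesis
  proof (rule has_field_derivative_transform_within_open)
    show "open (ball t0 d)" "t0 \<in> ball t0 d" using assms(4) by auto
    fix t assume "t \<in> ball t0 d"
    then have "\<bar>t - t0\<bar> < d" by (auto simp: dist_real_def abs_minus_commute)
    then show "(LINT y|lebesgue_on C. f y * mollifier s (x + t *\<^sub>R ?e) y) = mollify \<Omega> s f (x + t *\<^sub>R ?e)"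
      using mollify_eq[OF assms(1) C(1,2) C(3) assms(3), of t f] by simp
  qed
qed

text \<open>Mollification commutes with the weak derivative, so both the mollifications of \<open>f\<close> and their
  derivatives along the axis converge uniformly.\<close>

lemma mollify_limit_C1_along:
  fixes f :: "real^'n \<Rightarrow> real"
  assumes "open \<Omega>" "has_weak_deriv \<Omega> [i] f g" "mollify_limit \<Omega> f F" "mollify_limit \<Omega> g G"
  shows "C1_along i \<Omega> F G"
  unfolding C1_along_def
proof (intro conjI ballI)
  show "continuous_on \<Omega> F" "continuous_on \<Omega> G" using assms by (auto simp: mollify_limit_def)
  fix x assume x: "x \<in> \<Omega>"
  let ?e = "axis i 1 :: real^'n"
  obtain r1 where r1: "r1 > 0" "uniform_limit (ball x r1) (\<lambda>k. mollify \<Omega> (1 / 4 ^ k) f) F sequentially"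
    using assms(3) x by (auto simp: mollify_limit_def)
  obtain r2 where r2: "r2 > 0" "uniform_limit (ball x r2) (\<lambda>k. mollify \<Omega> (1 / 4 ^ k) g) G sequentially"
    using assms(4) x by (auto simp: mollify_limit_def)
  obtain R where R: "R > 0" "cball x R \<subseteq> \<Omega>" using assms(1) x open_contains_cball by blast
  define r where "r = min (R / 2) (min r1 r2)"
  have r: "r > 0" "r \<le> r1" "r \<le> r2" "2 * r \<le> R" using r1 r2 R by (auto simp: r_def)
  have "\<forall>\<^sub>F k in sequentially. 1 / 4 ^ k < r"
    using order_tendstoD(2)[OF LIMSEQ_power_zero[of "1/4::real"] r(1)] by (simp add: power_one_over)
  then obtain N where N: "\<And>k. k \<ge> N \<Longrightarrow> 1 / 4 ^ k < r" by (auto simp: eventually_sequentially)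
  define S where "S = ball (0::real) r"
  have inb: "x + t *\<^sub>R ?e \<in> ball x r" if "t \<in> S" for t
    using that by (simp add: S_def dist_norm)
  let ?f = "\<lambda>n t. mollify \<Omega> (1 / 4 ^ (n + N)) f (x + t *\<^sub>R ?e)" and ?g = "\<lambda>n t. mollify \<Omega> (1 / 4 ^ (n + N)) g (x + t *\<^sub>R ?e)"
  have lim: "(\<lambda>n. ?f n t) \<longlonglongrightarrow> F (x + t *\<^sub>R ?e)" if "t \<in> S" for t
  proof -
    have "x + t *\<^sub>R ?e \<in> ball x r1" using inb[OF that] r by auto
    from tendsto_uniform_limitI[OF r1(2) this] show ?thesis by (rule LIMSEQ_ignore_initial_segment)
  qed
  have "\<exists>\<Phi>. \<forall>t\<in>S. (\<lambda>n. ?f n t) \<longlonglongrightarrow> \<Phi> t \<and> (\<Phi> has_derivative (\<lambda>h. G (x + t *\<^sub>R ?e) * h)) (at t within S)"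
  proof (rule has_derivative_sequence[where f' = "\<lambda>n t h. ?g n t * h"])
    show "convex S" "0 \<in> S" using r by (auto simp: S_def)
    show "(?f n has_derivative (\<lambda>h. ?g n t * h)) (at t within S)" if t: "t \<in> S" for n t
    proof -
      have "(?f n has_real_derivative ?g n t) (at t)"
      proof (rule has_real_derivative_mollify_translate[OF assms(1,2), where d = "r - \<bar>t\<bar>" and C = "cball x R"])
        show "0 < r - \<bar>t\<bar>" using t by (simp add: S_def)
        show "cball (x + t' *\<^sub>R ?e) (1 / 4 ^ (n + N)) \<subseteq> cball x R" if "\<bar>t' - t\<bar> < r - \<bar>t\<bar>" for t'
        proof
          fix y assume y: "y \<in> cball (x + t' *\<^sub>R ?e) (1 / 4 ^ (n + N))"
          have "t' \<in> S" using that by (auto simp: S_def)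
          then show "y \<in> cball x R"
            using inb[of t'] y N[of "n + N"] r dist_triangle[of x y "x + t' *\<^sub>R ?e"] by auto
        qed
      qed (use R in auto)
      then show ?thesis by (simp add: has_field_derivative_def has_derivative_at_withinI)
    qed
    show "(\<lambda>n. ?f n 0) \<longlonglongrightarrow> F (x + 0 *\<^sub>R ?e)" using lim[of 0] r by (simp add: S_def)
    show "\<forall>\<^sub>F n in sequentially. \<forall>t\<in>S. \<forall>h. norm (?g n t * h - G (x + t *\<^sub>R ?e) * h) \<le> e * norm h" if "e > 0" for e
    proof -
      have "\<forall>\<^sub>F n in sequentially. \<forall>y\<in>ball x r2. dist (mollify \<Omega> (1 / 4 ^ n) g y) (G y) < e"
        using uniform_limitD[OF r2(2) that] .
      then have "\<forall>\<^sub>F n in sequentially. \<forall>y\<in>ball x r2. dist (mollify \<Omega> (1 / 4 ^ (n + N)) g y) (G y) < e"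
        by (rule eventually_compose_filterlim) (rule filterlim_add_const_nat_at_top)
      then show ?thesis
      proof eventually_elim
        case (elim n)
        show ?case
        proof (intro ballI allI)
          fix t h assume "t \<in> S"
          then have "x + t *\<^sub>R ?e \<in> ball x r2" using inb r(3) by force
          then have "\<bar>?g n t - G (x + t *\<^sub>R ?e)\<bar> \<le> e" using elim by (auto simp: dist_real_def intro: less_imp_le)
          then show "norm (?g n t * h - G (x + t *\<^sub>R ?e) * h) \<le> e * norm h"
            by (simp add: left_diff_distrib[symmetric] abs_mult mult_right_mono)
        qed
      qed
    qed
  qed
  then obtain \<Phi> where \<Phi>: "\<And>t. t \<in> S \<Longrightarrow> (\<lambda>n. ?f n t) \<longlonglongrightarrow> \<Phi> t"
    "\<And>t. t \<in> S \<Longrightarrow> (\<Phi> has_derivative (\<lambda>h. G (x + t *\<^sub>R ?e) * h)) (at t within S)" by blast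
  have S0: "open S" "0 \<in> S" using r by (auto simp: S_def)
  have "(\<Phi> has_real_derivative G x) (at 0)"
    using \<Phi>(2)[OF S0(2)] unfolding has_field_derivative_def at_within_open[OF S0(2,1)] by simp
  then show "((\<lambda>t. F (x + t *\<^sub>R ?e)) has_real_derivative G x) (at 0)"
    by (rule has_field_derivative_transform_within_open[OF _ S0]) (rule LIMSEQ_unique[OF \<Phi>(1) lim])
qed

section \<open>Smooth representatives of Sobolev functions\<close>

lemma ae_eq_refl [simp]: "ae_eq \<Omega> f f"
  by (simp add: ae_eq_def)

lemma ae_eq_sym: "ae_eq \<Omega> f g \<Longrightarrow> ae_eq \<Omega> g f"
  unfolding ae_eq_def by (auto elim: eventually_mono)

lemma ae_eq_trans: "ae_eq \<Omega> f g \<Longrightarrow> ae_eq \<Omega> g h \<Longrightarrow> ae_eq \<Omega> f h"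
  unfolding ae_eq_def by (auto elim: eventually_elim2)

lemma ae_eq_continuous_imp_eq:
  fixes f g :: "real^'n \<Rightarrow> 'b::real_normed_vector"
  assumes "open \<Omega>" "ae_eq \<Omega> f g" "continuous_on \<Omega> f" "continuous_on \<Omega> g" "x \<in> \<Omega>"
  shows "f x = g x"
proof -
  have "open (\<Omega> \<inter> (\<lambda>x. f x - g x) -` (- {0}))"
    using assms by (intro continuous_open_preimage continuous_intros) auto
  moreover have "\<Omega> \<inter> (\<lambda>x. f x - g x) -` (- {0}) = {x \<in> \<Omega>. f x \<noteq> g x}" by auto
  moreover have "negligible {x \<in> \<Omega>. f x \<noteq> g x}" using assms ae_eq_iff_negligible by blast
  ultimately have "{x \<in> \<Omega>. f x \<noteq> g x} = {}" using open_not_negligible by metis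
  then show ?thesis using assms(5) by blast
qed

text \<open>The choice in \<open>cont_rep\<close> is harmless: on an open set, two continuous functions that agree
  almost everywhere agree.\<close>

lemma cont_rep_eq:
  fixes f g :: "real^'n \<Rightarrow> 'b::real_normed_vector"
  assumes "open \<Omega>" "continuous_on \<Omega> g" "ae_eq \<Omega> g f" "x \<in> \<Omega>"
  shows "cont_rep \<Omega> f x = g x"
proof -
  have "continuous_on \<Omega> (cont_rep \<Omega> f) \<and> ae_eq \<Omega> (cont_rep \<Omega> f) f"
    unfolding cont_rep_def by (rule someI[where x = g]) (use assms in auto)
  then show ?thesis
    using assms by (intro ae_eq_continuous_imp_eq[of \<Omega>]) (auto intro: ae_eq_trans ae_eq_sym)
qed

lemma L1_loc_ae_eq:
  assumes "open \<Omega>" "f \<in> L1_loc \<Omega>" "ae_eq \<Omega> f g"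
  shows "g \<in> L1_loc \<Omega>"
  unfolding L1_loc_def
proof safe
  fix K assume K: "compact K" "K \<subseteq> \<Omega>"
  then have Kl: "K \<in> sets lebesgue" by (auto dest: lmeasurable_compact)
  have f: "integrable (lebesgue_on K) f" using assms K by (simp add: L1_loc_def)
  have "negligible {x \<in> K. g x \<noteq> f x}"
    using assms(3) K unfolding ae_eq_iff_negligible[OF assms(1)] by (elim negligible_subset) auto
  then have ae: "AE x in lebesgue_on K. g x = f x" using AE_lebesgue_on_iff_negligible[OF Kl] by blast
  have "g \<in> borel_measurable (lebesgue_on K)"
    using f by (intro measurable_lebesgue_on_AE[OF _ ae Kl]) auto
  then show "integrable (lebesgue_on K) g" using f ae by (subst integrable_cong_AE[of _ _ f]) auto
qed

lemma L2_ae_eq: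
  assumes "open \<Omega>" "f \<in> L2 \<Omega>" "ae_eq \<Omega> f g"
  shows "g \<in> L2 \<Omega>"
proof -
  have \<Omega>: "\<Omega> \<in> sets lebesgue" using assms(1) by auto
  have ae: "AE x in lebesgue_on \<Omega>. g x = f x" using ae_eq_sym[OF assms(3)] by (simp add: ae_eq_def)
  have f: "f \<in> borel_measurable (lebesgue_on \<Omega>)" "integrable (lebesgue_on \<Omega>) (\<lambda>x. (f x)\<^sup>2)"
    using assms(2) by (auto simp: L2_def)
  have g: "g \<in> borel_measurable (lebesgue_on \<Omega>)"
    by (rule measurable_lebesgue_on_AE[OF f(1) ae \<Omega>])
  moreover have "integrable (lebesgue_on \<Omega>) (\<lambda>x. (g x)\<^sup>2)"
  proof (subst integrable_cong_AE)
    show "AE x in lebesgue_on \<Omega>. (g x)\<^sup>2 = (f x)\<^sup>2" using ae by eventually_elim simp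
  qed (use f g in auto)
  ultimately show ?thesis by (simp add: L2_def)
qed

lemma integral_test_ae_eq:
  assumes "open \<Omega>" "f \<in> L1_loc \<Omega>" "ae_eq \<Omega> f g" "\<phi> \<in> test_functions \<Omega>"
  shows "(LINT x|lebesgue_on \<Omega>. f x * \<phi> x) = (LINT x|lebesgue_on \<Omega>. g x * \<phi> x)"
proof -
  obtain K where K: "compact K" "K \<subseteq> \<Omega>" "\<And>x. x \<notin> K \<Longrightarrow> \<phi> x = 0"
    using assms(4) by (auto simp: test_functions_def)
  show ?thesis
    using L1_loc_mult_integrable[OF assms(1,2) test_continuous[OF assms(4)] K]
      L1_loc_mult_integrable[OF assms(1) L1_loc_ae_eq[OF assms(1-3)] test_continuous[OF assms(4)] K] assms(3)
    unfolding ae_eq_def by (intro integral_cong_AE) (auto elim: eventually_mono)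
qed

lemma has_weak_deriv_ae_eq:
  assumes "open \<Omega>" "has_weak_deriv \<Omega> is f g" "ae_eq \<Omega> f f'"
  shows "has_weak_deriv \<Omega> is f' g"
  using assms integral_test_ae_eq[OF assms(1) _ assms(3) partial_derivs_test[of _ \<Omega> "is"]] L1_loc_ae_eq[OF assms(1) _ assms(3)]
  by (auto simp: has_weak_deriv_def)

lemma weak_partial_has_weak_deriv:
  "has_weak_deriv \<Omega> [i] f g \<Longrightarrow> has_weak_deriv \<Omega> [i] f (weak_partial \<Omega> i f)"
  unfolding weak_partial_def by (rule someI[of "has_weak_deriv \<Omega> [i] f"])

lemma weak_partial_ae_eq:
  assumes "open \<Omega>" "has_weak_deriv \<Omega> [i] f g" "ae_eq \<Omega> f f'"
  shows "ae_eq \<Omega> (weak_partial \<Omega> i f') g"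
  using weak_partial_has_weak_deriv[OF has_weak_deriv_ae_eq[OF assms]] assms
  by (intro weak_deriv_unique[OF assms(1) _ assms(2) ae_eq_sym[OF assms(3)]])

lemma weak_partial_ae_eq_0:
  assumes "open \<Omega>" "ae_eq \<Omega> f (\<lambda>_. 0)"
  shows "ae_eq \<Omega> (weak_partial \<Omega> i f) (\<lambda>_. 0)"
proof (rule weak_partial_ae_eq[OF assms(1) _ ae_eq_sym[OF assms(2)]])
  show "has_weak_deriv \<Omega> [i] (\<lambda>_. 0) (\<lambda>_. 0)"
    using continuous_L1_loc[OF assms(1), of "\<lambda>_. 0"] by (simp add: has_weak_deriv_def)
qed

lemma weak_partial_sobolev:
  assumes "open \<Omega>" "f \<in> sobolev (Suc k) \<Omega>"
  shows "weak_partial \<Omega> i f \<in> sobolev k \<Omega>" "has_weak_deriv \<Omega> [i] f (weak_partial \<Omega> i f)"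
proof -
  have "length [i] \<le> Suc k" by simp
  then obtain g where g: "g \<in> L2 \<Omega>" "has_weak_deriv \<Omega> [i] f g"
    using assms(2) unfolding sobolev_def by blast
  then have w: "has_weak_deriv \<Omega> [i] f (weak_partial \<Omega> i f)" by (intro weak_partial_has_weak_deriv)
  then show "has_weak_deriv \<Omega> [i] f (weak_partial \<Omega> i f)" .
  have "weak_partial \<Omega> i f \<in> L2 \<Omega>"
    using L2_ae_eq[OF assms(1) g(1)] weak_deriv_unique[OF assms(1) g(2) w] by simp
  from sobolev_weak_deriv[OF assms(2) _ w this] show "weak_partial \<Omega> i f \<in> sobolev k \<Omega>" by simp
qed

lemma sobolev_L2: "f \<in> sobolev k \<Omega> \<Longrightarrow> f \<in> L2 \<Omega>"
  by (simp add: sobolev_def)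

text \<open>A canonical limit, rather than a chosen one, lets the representative of a function and those of
  its weak derivatives be compared without further choices.\<close>

definition smooth_rep :: "(real^'n) set \<Rightarrow> (real^'n \<Rightarrow> real) \<Rightarrow> real^'n \<Rightarrow> real" where
  "smooth_rep \<Omega> f x = lim (\<lambda>k. mollify \<Omega> (1 / 4 ^ k) f x)"

lemma sobolev_L1_loc:
  fixes f :: "real^'n \<Rightarrow> real"
  assumes "f \<in> sobolev k \<Omega>"
  shows "f \<in> L1_loc \<Omega>"
proof -
  obtain g where "has_weak_deriv \<Omega> ([] :: 'n list) f g"
    using assms by (force simp: sobolev_def)
  then show ?thesis by (simp add: has_weak_deriv_def)
qed

lemma mollify_limit_smooth_rep:
  fixes f :: "real^3 \<Rightarrow> real"
  assumes "open \<Omega>" "f \<in> sobolev k \<Omega>" "k \<ge> 2"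
  shows "mollify_limit \<Omega> f (smooth_rep \<Omega> f)"
proof -
  have "\<exists>D\<in>L2 \<Omega>. has_weak_deriv \<Omega> [i, i] f D" for i
  proof -
    have "length [i, i] \<le> k" using assms(3) by simp
    then show ?thesis using assms(2) unfolding sobolev_def by blast
  qed
  from ex_mollify_limit[OF assms(1) this] obtain F where F: "mollify_limit \<Omega> f F" by blast
  have eq: "smooth_rep \<Omega> f x = F x" if "x \<in> \<Omega>" for x
  proof -
    obtain r where "r > 0" "uniform_limit (ball x r) (\<lambda>k. mollify \<Omega> (1 / 4 ^ k) f) F sequentially"
      using F \<open>x \<in> \<Omega>\<close> by (auto simp: mollify_limit_def)
    from tendsto_uniform_limitI[OF this(2), of x] this(1)
    show ?thesis unfolding smooth_rep_def by (simp add: limI)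
  qed
  have "\<exists>r>0. uniform_limit (ball x r) (\<lambda>k. mollify \<Omega> (1 / 4 ^ k) f) (smooth_rep \<Omega> f) sequentially" if x: "x \<in> \<Omega>" for x
  proof -
    obtain r where r: "r > 0" "uniform_limit (ball x r) (\<lambda>k. mollify \<Omega> (1 / 4 ^ k) f) F sequentially"
      using F x by (auto simp: mollify_limit_def)
    obtain R where R: "R > 0" "ball x R \<subseteq> \<Omega>" using assms(1) x open_contains_ball by blast
    have "uniform_limit (ball x (min r R)) (\<lambda>k. mollify \<Omega> (1 / 4 ^ k) f) F sequentially"
      by (rule uniform_limit_on_subset[OF r(2)]) auto
    then have "uniform_limit (ball x (min r R)) (\<lambda>k. mollify \<Omega> (1 / 4 ^ k) f) (smooth_rep \<Omega> f) sequentially"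
      by (rule uniform_limit_cong'[THEN iffD1, rotated -1]) (use eq R in \<open>auto simp: subset_iff\<close>)
    then show ?thesis using r(1) R(1) by (intro exI[of _ "min r R"]) auto
  qed
  moreover have "continuous_on \<Omega> (smooth_rep \<Omega> f)"
    using F eq unfolding mollify_limit_def by (metis continuous_on_cong)
  ultimately show ?thesis by (simp add: mollify_limit_def)
qed

lemma smooth_rep_sobolev:
  fixes f :: "real^3 \<Rightarrow> real"
  assumes "open \<Omega>" "f \<in> sobolev k \<Omega>" "k \<ge> 2"
  shows "continuous_on \<Omega> (smooth_rep \<Omega> f)" "ae_eq \<Omega> (smooth_rep \<Omega> f) f"
  using mollify_limit_smooth_rep[OF assms] mollify_limit_ae_eq[OF assms(1) sobolev_L1_loc[OF assms(2)]]
  by (auto simp: mollify_limit_def)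

lemma smooth_rep_C1:
  fixes f :: "real^3 \<Rightarrow> real"
  assumes "open \<Omega>" "f \<in> sobolev (Suc k) \<Omega>" "k \<ge> 2"
  shows "C1_along i \<Omega> (smooth_rep \<Omega> f) (smooth_rep \<Omega> (weak_partial \<Omega> i f))"
proof (rule mollify_limit_C1_along[OF assms(1)])
  show "has_weak_deriv \<Omega> [i] f (weak_partial \<Omega> i f)"
    by (rule weak_partial_sobolev(2)[OF assms(1,2)])
  show "mollify_limit \<Omega> f (smooth_rep \<Omega> f)"
    by (rule mollify_limit_smooth_rep[OF assms(1,2)]) (use assms(3) in simp)
  show "mollify_limit \<Omega> (weak_partial \<Omega> i f) (smooth_rep \<Omega> (weak_partial \<Omega> i f))"
    by (rule mollify_limit_smooth_rep[OF assms(1) weak_partial_sobolev(1)[OF assms(1,2)] assms(3)])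
qed

section \<open>Smooth substitutes for the sign and for a cutoff\<close>

text \<open>With \<open>p\<close> the positive part of \<open>t - \<delta>\<close>, this is \<open>p\<^sup>2 / (p\<^sup>2 + \<delta>\<^sup>2)\<close>: zero up to \<open>\<delta>\<close>,
  continuously differentiable, and tending to the indicator of the positive reals as \<open>\<delta>\<close> tends
  to zero. The derivative is \<open>cutoff'\<close>.\<close>

definition cutoff :: "real \<Rightarrow> real \<Rightarrow> real" where
  "cutoff \<delta> t = (max 0 (t - \<delta>))\<^sup>2 / ((max 0 (t - \<delta>))\<^sup>2 + \<delta>\<^sup>2)"

definition cutoff' :: "real \<Rightarrow> real \<Rightarrow> real" where
  "cutoff' \<delta> t = 2 * max 0 (t - \<delta>) * \<delta>\<^sup>2 / ((max 0 (t - \<delta>))\<^sup>2 + \<delta>\<^sup>2)\<^sup>2"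

lemma has_real_derivative_max_square: "((\<lambda>t::real. (max 0 t)\<^sup>2) has_real_derivative 2 * max 0 t) (at t)"
proof (cases t "0::real" rule: linorder_cases)
  case less
  have "((\<lambda>t::real. 0) has_real_derivative 2 * max 0 t) (at t)" using less by simp
  then show ?thesis
    by (rule has_field_derivative_transform_within_open[where S = "{..<0}"]) (use less in auto)
next
  case equal
  have "((\<lambda>h::real. (max 0 h)\<^sup>2 / h) \<longlongrightarrow> 0) (at 0)"
  proof (rule Lim_null_comparison)
    show "\<forall>\<^sub>F h::real in at 0. norm ((max 0 h)\<^sup>2 / h) \<le> \<bar>h\<bar>"
      by (rule always_eventually) (auto simp: max_def power2_eq_square)
    show "((\<lambda>h. \<bar>h\<bar>) \<longlongrightarrow> 0) (at (0::real))" by (auto intro!: tendsto_eq_intros)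
  qed
  then show ?thesis using equal by (simp add: DERIV_def)
next
  case greater
  have "((\<lambda>t::real. t\<^sup>2) has_real_derivative 2 * max 0 t) (at t)"
    using greater by (auto intro!: derivative_eq_intros)
  then show ?thesis
    by (rule has_field_derivative_transform_within_open[where S = "{0<..}"]) (use greater in auto)
qed

lemma has_real_derivative_cutoff:
  assumes "\<delta> > 0"
  shows "(cutoff \<delta> has_real_derivative cutoff' \<delta> t) (at t)"
proof -
  let ?p = "\<lambda>t. (max 0 (t - \<delta>))\<^sup>2"
  have p: "(?p has_real_derivative 2 * max 0 (t - \<delta>)) (at t)"
  proof -
    have "((\<lambda>t. t - \<delta>) has_real_derivative 1) (at t)" by (auto intro!: derivative_eq_intros)
    from DERIV_chain2[OF has_real_derivative_max_square this] show ?thesis by simp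
  qed
  have pos: "?p t + \<delta>\<^sup>2 > 0" using assms by (intro add_nonneg_pos) auto
  have "((\<lambda>t. ?p t / (?p t + \<delta>\<^sup>2)) has_real_derivative
     (2 * max 0 (t - \<delta>) * (?p t + \<delta>\<^sup>2) - ?p t * (2 * max 0 (t - \<delta>))) / ((?p t + \<delta>\<^sup>2) * (?p t + \<delta>\<^sup>2))) (at t)"
    using pos by (intro DERIV_divide p DERIV_add[OF p DERIV_const, simplified]) auto
  then show ?thesis
    by (simp add: cutoff_def[abs_def] cutoff'_def power2_eq_square algebra_simps)
qed

lemma cutoff_bounds: "\<delta> > 0 \<Longrightarrow> 0 \<le> cutoff \<delta> t \<and> cutoff \<delta> t \<le> 1"
  unfolding cutoff_def by (auto simp: divide_le_eq_1 add_nonneg_pos intro!: divide_nonneg_nonneg add_nonneg_nonneg)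

lemma cutoff_eq_0: "t \<le> \<delta> \<Longrightarrow> cutoff \<delta> t = 0"
  by (simp add: cutoff_def)

lemma cutoff'_nonneg: "0 \<le> cutoff' \<delta> t"
  by (auto simp: cutoff'_def intro!: divide_nonneg_nonneg mult_nonneg_nonneg)

text \<open>Uniformity in \<open>\<delta>\<close> provides the dominating function for the term in which the cutoff is
  differentiated.\<close>

lemma cutoff'_bound:
  assumes "\<delta> > 0" "t \<ge> 0"
  shows "t * cutoff' \<delta> t \<le> 3"
proof (cases "t \<le> \<delta>")
  case False
  define p where "p = t - \<delta>"
  have p: "p > 0" using False by (simp add: p_def)
  have pos: "p\<^sup>2 + \<delta>\<^sup>2 > 0" using p by (simp add: sum_power2_gt_zero_iff)
  have "2 * p * t * \<delta>\<^sup>2 = (2 * p\<^sup>2 + 2 * p * \<delta>) * \<delta>\<^sup>2" by (simp add: p_def power2_eq_square algebra_simps)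
  also have "\<dots> \<le> (3 * (p\<^sup>2 + \<delta>\<^sup>2)) * (p\<^sup>2 + \<delta>\<^sup>2)"
  proof (intro mult_mono)
    have "3 * (p\<^sup>2 + \<delta>\<^sup>2) = 2 * p\<^sup>2 + 2 * p * \<delta> + ((p - \<delta>)\<^sup>2 + 2 * \<delta>\<^sup>2)"
      by (simp add: power2_eq_square algebra_simps)
    moreover have "0 \<le> (p - \<delta>)\<^sup>2 + 2 * \<delta>\<^sup>2" by (intro add_nonneg_nonneg) auto
    ultimately show "2 * p\<^sup>2 + 2 * p * \<delta> \<le> 3 * (p\<^sup>2 + \<delta>\<^sup>2)" by linarith
  qed auto
  finally have "2 * p * t * \<delta>\<^sup>2 \<le> 3 * (p\<^sup>2 + \<delta>\<^sup>2)\<^sup>2" by (simp only: power2_eq_square mult.assoc)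
  then have "2 * p * t * \<delta>\<^sup>2 / (p\<^sup>2 + \<delta>\<^sup>2)\<^sup>2 \<le> 3" using zero_less_power[OF pos, of 2]
    by (simp only: pos_divide_le_eq)
  moreover have "max 0 (t - \<delta>) = p" using p by (simp add: p_def)
  ultimately show ?thesis by (simp add: cutoff'_def mult_ac)
qed (simp add: cutoff'_def)

lemma cutoff_tendsto:
  assumes "X \<longlonglongrightarrow> 0" "\<And>n. X n > 0" "t \<ge> 0"
  shows "(\<lambda>n. cutoff (X n) t) \<longlonglongrightarrow> (if t > 0 then 1 else 0)" "(\<lambda>n. cutoff' (X n) t) \<longlonglongrightarrow> 0"
proof -
  have p: "(\<lambda>n. max 0 (t - X n)) \<longlonglongrightarrow> max 0 (t - 0)" by (intro tendsto_intros assms)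
  show "(\<lambda>n. cutoff (X n) t) \<longlonglongrightarrow> (if t > 0 then 1 else 0)"
  proof (cases "t > 0")
    case True
    have "(\<lambda>n. cutoff (X n) t) \<longlonglongrightarrow> (max 0 (t - 0))\<^sup>2 / ((max 0 (t - 0))\<^sup>2 + 0\<^sup>2)"
      unfolding cutoff_def using True by (intro tendsto_intros p assms(1)) auto
    then show ?thesis using True by simp
  next
    case False
    then show ?thesis using assms by (simp add: cutoff_eq_0 less_imp_le)
  qed
  show "(\<lambda>n. cutoff' (X n) t) \<longlonglongrightarrow> 0"
  proof (cases "t > 0")
    case True
    have "(\<lambda>n. cutoff' (X n) t) \<longlonglongrightarrow> 2 * max 0 (t - 0) * 0\<^sup>2 / ((max 0 (t - 0))\<^sup>2 + 0\<^sup>2)\<^sup>2"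
      unfolding cutoff'_def using True by (intro tendsto_intros p assms(1)) auto
    then show ?thesis by simp
  next
    case False
    then have "max 0 (t - X n) = 0" for n using assms(2)[of n] by simp
    then show ?thesis by (simp add: cutoff'_def)
  qed
qed

text \<open>With \<open>q = sqrt (m\<^sup>2 + \<kappa>\<^sup>2)\<close>, this is \<open>m / (q + \<kappa> * q\<^sup>2)\<close>. The first summand of the denominator
  smooths the sign at zero; the second one makes the function decay at infinity, so that
  \<open>m * sgn_approx \<kappa> m\<close> stays bounded. The derivative is \<open>sgn_approx'\<close>.\<close>

definition sgn_approx :: "real \<Rightarrow> real \<Rightarrow> real" where
  "sgn_approx \<kappa> m = m / (sqrt (m\<^sup>2 + \<kappa>\<^sup>2) + \<kappa> * (m\<^sup>2 + \<kappa>\<^sup>2))"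

definition sgn_approx' :: "real \<Rightarrow> real \<Rightarrow> real" where
  "sgn_approx' \<kappa> m = (\<kappa>\<^sup>2 / sqrt (m\<^sup>2 + \<kappa>\<^sup>2) + \<kappa> ^ 3 - \<kappa> * m\<^sup>2) / (sqrt (m\<^sup>2 + \<kappa>\<^sup>2) + \<kappa> * (m\<^sup>2 + \<kappa>\<^sup>2))\<^sup>2"

lemma has_real_derivative_sgn_approx:
  assumes "\<kappa> > 0"
  shows "(sgn_approx \<kappa> has_real_derivative sgn_approx' \<kappa> m) (at m)"
proof -
  define q where "q = sqrt (m\<^sup>2 + \<kappa>\<^sup>2)"
  have pos: "m\<^sup>2 + \<kappa>\<^sup>2 > 0" using assms by (simp add: sum_power2_gt_zero_iff)
  have q: "q > 0" "q\<^sup>2 = m\<^sup>2 + \<kappa>\<^sup>2" using pos by (auto simp: q_def)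
  have D: "((\<lambda>m. sqrt (m\<^sup>2 + \<kappa>\<^sup>2) + \<kappa> * (m\<^sup>2 + \<kappa>\<^sup>2)) has_real_derivative m / q + 2 * \<kappa> * m) (at m)"
    using pos by (auto intro!: derivative_eq_intros simp: q_def field_simps)
  have den: "q + \<kappa> * q\<^sup>2 > 0" using q(1) assms by (intro add_pos_pos mult_pos_pos zero_less_power)
  have "((\<lambda>m. m / (sqrt (m\<^sup>2 + \<kappa>\<^sup>2) + \<kappa> * (m\<^sup>2 + \<kappa>\<^sup>2))) has_real_derivative
      (1 * (q + \<kappa> * q\<^sup>2) - m * (m / q + 2 * \<kappa> * m)) / ((q + \<kappa> * q\<^sup>2) * (q + \<kappa> * q\<^sup>2))) (at m)"
    unfolding q(2) using den unfolding q(2) q_def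
    by (intro DERIV_divide DERIV_ident D[unfolded q_def]) auto
  moreover have "1 * (q + \<kappa> * q\<^sup>2) - m * (m / q + 2 * \<kappa> * m) = \<kappa>\<^sup>2 / q + \<kappa> ^ 3 - \<kappa> * m\<^sup>2"
  proof -
    have "q = (m\<^sup>2 + \<kappa>\<^sup>2) / q" using q by (simp add: field_simps power2_eq_square)
    then have "q - m * m / q = \<kappa>\<^sup>2 / q" by (simp add: add_divide_distrib power2_eq_square)
    then show ?thesis unfolding q(2) by (simp add: algebra_simps power2_eq_square power3_eq_cube)
  qed
  moreover have "sgn_approx' \<kappa> m = (\<kappa>\<^sup>2 / q + \<kappa> ^ 3 - \<kappa> * m\<^sup>2) / ((q + \<kappa> * q\<^sup>2) * (q + \<kappa> * q\<^sup>2))"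
  proof -
    have "sqrt (m\<^sup>2 + \<kappa>\<^sup>2) + \<kappa> * (m\<^sup>2 + \<kappa>\<^sup>2) = q + \<kappa> * q\<^sup>2"
      unfolding q(2) by (simp add: q_def)
    then show ?thesis unfolding sgn_approx'_def power2_eq_square[of "_ + _ * _"] by (simp only: q_def)
  qed
  ultimately show ?thesis
    by (simp only: sgn_approx_def[abs_def])
qed

text \<open>The derivative of a sign approximation is only harmless together with the factor \<open>m\<^sup>2\<close>. The
  third bound gives pointwise convergence to zero as \<open>\<kappa>\<close> does, the fourth one domination by a
  multiple of \<open>1 + \<bar>m\<bar>\<close>, which is square integrable in the application.\<close>

lemma sgn_approx_bounds:
  assumes "\<kappa> > 0"
  shows "0 \<le> m * sgn_approx \<kappa> m" "m * sgn_approx \<kappa> m \<le> 1 / \<kappa>"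
    "\<bar>m\<^sup>2 * sgn_approx' \<kappa> m\<bar> \<le> \<kappa> + \<kappa> ^ 3 + \<kappa> * m\<^sup>2"
    "\<bar>m\<^sup>2 * sgn_approx' \<kappa> m\<bar> \<le> \<kappa> + \<kappa> ^ 3 + \<bar>m\<bar>"
proof -
  define q where "q = sqrt (m\<^sup>2 + \<kappa>\<^sup>2)"
  have pos: "m\<^sup>2 + \<kappa>\<^sup>2 > 0" using assms by (simp add: sum_power2_gt_zero_iff)
  have q: "q > 0" "q\<^sup>2 = m\<^sup>2 + \<kappa>\<^sup>2" using pos by (auto simp: q_def)
  have qm: "\<bar>m\<bar> \<le> q" "\<kappa> \<le> q" unfolding q_def using assms by (auto intro: real_le_rsqrt)
  have den: "q + \<kappa> * q\<^sup>2 > 0" using q(1) assms by (intro add_pos_pos mult_pos_pos zero_less_power)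
  have den_eq: "sqrt (m\<^sup>2 + \<kappa>\<^sup>2) + \<kappa> * (m\<^sup>2 + \<kappa>\<^sup>2) = q + \<kappa> * q\<^sup>2"
    unfolding q(2) by (simp add: q_def)
  have eq: "m * sgn_approx \<kappa> m = m\<^sup>2 / (q + \<kappa> * q\<^sup>2)"
    unfolding sgn_approx_def den_eq by (simp add: power2_eq_square)
  show "0 \<le> m * sgn_approx \<kappa> m" unfolding eq using den by simp
  have "m\<^sup>2 / (q + \<kappa> * q\<^sup>2) \<le> q\<^sup>2 / (\<kappa> * q\<^sup>2)"
  proof (rule frac_le)
    show "0 < \<kappa> * q\<^sup>2" using q(1) assms by (intro mult_pos_pos zero_less_power)
    show "m\<^sup>2 \<le> q\<^sup>2" unfolding q(2) by simp
  qed (use q(1) in auto)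
  then show "m * sgn_approx \<kappa> m \<le> 1 / \<kappa>" unfolding eq using q(1) by simp
  define r where "r = m\<^sup>2 / (q + \<kappa> * q\<^sup>2)\<^sup>2"
  have r0: "r \<ge> 0" by (simp add: r_def)
  have "q\<^sup>2 \<le> (q + \<kappa> * q\<^sup>2)\<^sup>2" using q assms by (intro power_mono) auto
  moreover have "m\<^sup>2 \<le> q\<^sup>2" unfolding q(2) by simp
  ultimately have "m\<^sup>2 \<le> (q + \<kappa> * q\<^sup>2)\<^sup>2" by linarith
  then have r1: "r \<le> 1"
    unfolding r_def divide_le_eq_1_pos[OF zero_less_power[OF den]] .
  have eq': "m\<^sup>2 * sgn_approx' \<kappa> m = r * (\<kappa>\<^sup>2 / q + \<kappa> ^ 3) - r * (\<kappa> * m\<^sup>2)"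
  proof -
    have "m\<^sup>2 * (a / d) = m\<^sup>2 / d * a" for a d by simp
    then show ?thesis
      unfolding sgn_approx'_def den_eq unfolding q_def[symmetric] r_def by (simp only: right_diff_distrib)
  qed
  have "\<kappa>\<^sup>2 / q \<le> \<kappa>\<^sup>2 / \<kappa>" using qm assms by (intro divide_left_mono) auto
  then have k: "\<kappa>\<^sup>2 / q \<le> \<kappa>" using assms by (simp add: power2_eq_square)
  have 1: "r * (\<kappa>\<^sup>2 / q + \<kappa> ^ 3) \<le> 1 * (\<kappa> + \<kappa> ^ 3)"
    using r0 r1 k q assms by (intro mult_mono) auto
  have 2: "0 \<le> r * (\<kappa>\<^sup>2 / q + \<kappa> ^ 3)" using r0 q assms by simp
  have 3: "0 \<le> r * (\<kappa> * m\<^sup>2)" using r0 assms by simp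
  have 4: "r * (\<kappa> * m\<^sup>2) \<le> 1 * (\<kappa> * m\<^sup>2)" using r1 assms by (intro mult_right_mono) auto
  have 5: "r * (\<kappa> * m\<^sup>2) \<le> \<bar>m\<bar>"
  proof -
    have "m\<^sup>2 * (\<kappa> * m\<^sup>2) = \<bar>m\<bar> * (\<kappa> * \<bar>m\<bar> * m\<^sup>2)" by (simp add: power2_eq_square)
    also have "\<dots> \<le> \<bar>m\<bar> * (\<kappa> * q * q\<^sup>2)"
      using qm assms q by (intro mult_left_mono mult_mono) auto
    also have "\<kappa> * q * q\<^sup>2 \<le> (q + \<kappa> * q\<^sup>2)\<^sup>2"
    proof -
      have "(q + \<kappa> * q\<^sup>2)\<^sup>2 = \<kappa> * q * q\<^sup>2 + (q\<^sup>2 + \<kappa> * q * q\<^sup>2 + (\<kappa> * q\<^sup>2)\<^sup>2)"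
        by (simp add: power2_eq_square algebra_simps)
      moreover have "0 \<le> q\<^sup>2 + \<kappa> * q * q\<^sup>2 + (\<kappa> * q\<^sup>2)\<^sup>2"
        using assms q(1) by (intro add_nonneg_nonneg mult_nonneg_nonneg zero_le_power2) auto
      ultimately show ?thesis by linarith
    qed
    finally have "m\<^sup>2 * (\<kappa> * m\<^sup>2) \<le> \<bar>m\<bar> * (q + \<kappa> * q\<^sup>2)\<^sup>2" by (simp add: mult_left_mono)
    then show ?thesis using den by (simp add: r_def pos_divide_le_eq)
  qed
  have diff: "\<bar>a - b\<bar> \<le> c + d" if "a \<le> c" "0 \<le> a" "0 \<le> b" "b \<le> d" for a b c d :: real
    using that by linarith
  show "\<bar>m\<^sup>2 * sgn_approx' \<kappa> m\<bar> \<le> \<kappa> + \<kappa> ^ 3 + \<kappa> * m\<^sup>2"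
    using diff[OF 1 2 3 4] unfolding eq' mult_1 .
  show "\<bar>m\<^sup>2 * sgn_approx' \<kappa> m\<bar> \<le> \<kappa> + \<kappa> ^ 3 + \<bar>m\<bar>"
    using diff[OF 1 2 3 5] unfolding eq' mult_1 .
qed

lemma sgn_approx_lower:
  assumes "0 < \<kappa>" "\<kappa> \<le> 1"
  shows "m * sgn_approx 1 m \<le> m * sgn_approx \<kappa> m"
proof -
  have pos: "m\<^sup>2 + \<kappa>\<^sup>2 > 0" using assms by (simp add: sum_power2_gt_zero_iff)
  have le: "m\<^sup>2 + \<kappa>\<^sup>2 \<le> m\<^sup>2 + 1\<^sup>2" using assms by (intro add_left_mono power_mono) auto
  have "m\<^sup>2 / (sqrt (m\<^sup>2 + 1\<^sup>2) + 1 * (m\<^sup>2 + 1\<^sup>2)) \<le> m\<^sup>2 / (sqrt (m\<^sup>2 + \<kappa>\<^sup>2) + \<kappa> * (m\<^sup>2 + \<kappa>\<^sup>2))"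
  proof (rule frac_le)
    show "0 < sqrt (m\<^sup>2 + \<kappa>\<^sup>2) + \<kappa> * (m\<^sup>2 + \<kappa>\<^sup>2)"
      using real_sqrt_gt_zero[OF pos] mult_pos_pos[OF assms(1) pos] by (rule add_pos_pos)
    show "sqrt (m\<^sup>2 + \<kappa>\<^sup>2) + \<kappa> * (m\<^sup>2 + \<kappa>\<^sup>2) \<le> sqrt (m\<^sup>2 + 1\<^sup>2) + 1 * (m\<^sup>2 + 1\<^sup>2)"
      using le pos assms by (intro add_mono real_sqrt_le_mono mult_mono) auto
  qed auto
  then show ?thesis by (simp add: sgn_approx_def power2_eq_square)
qed

lemma sgn_approx_1_eq_0_iff: "m * sgn_approx 1 m = 0 \<longleftrightarrow> m = 0"
proof -
  have "sqrt (m\<^sup>2 + 1) + (m\<^sup>2 + 1) > 0" by (intro add_nonneg_pos) (auto intro: add_nonneg_pos)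
  then show ?thesis by (auto simp: sgn_approx_def)
qed

lemma continuous_cutoff': "\<delta> > 0 \<Longrightarrow> continuous_on UNIV (cutoff' \<delta>)"
  unfolding cutoff'_def by (intro continuous_intros) (auto simp: add_nonneg_eq_0_iff)

lemma continuous_sgn_approx': "\<kappa> > 0 \<Longrightarrow> continuous_on UNIV (sgn_approx' \<kappa>)"
proof -
  assume k: "\<kappa> > 0"
  have "sqrt (m\<^sup>2 + \<kappa>\<^sup>2) \<noteq> 0" for m using k by (simp add: add_nonneg_eq_0_iff)
  moreover have "sqrt (m\<^sup>2 + \<kappa>\<^sup>2) + \<kappa> * (m\<^sup>2 + \<kappa>\<^sup>2) > 0" for m
    using k by (intro add_nonneg_pos mult_pos_pos) (auto simp: sum_power2_gt_zero_iff)
  then have "(sqrt (m\<^sup>2 + \<kappa>\<^sup>2) + \<kappa> * (m\<^sup>2 + \<kappa>\<^sup>2))\<^sup>2 \<noteq> 0" for m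
    by (metis less_irrefl power_eq_0_iff)
  ultimately show ?thesis unfolding sgn_approx'_def by (intro continuous_intros) auto
qed

section \<open>The energy identity for a divergence free weighted strain\<close>

lemma L2_mult_integrable:
  assumes "f \<in> L2 \<Omega>" "g \<in> L2 \<Omega>"
  shows "integrable (lebesgue_on \<Omega>) (\<lambda>x. f x * g x)"
proof (rule Bochner_Integration.integrable_bound[where f = "\<lambda>x. (f x)\<^sup>2 + (g x)\<^sup>2"])
  have "\<bar>a * b\<bar> \<le> \<bar>a\<^sup>2 + b\<^sup>2\<bar>" for a b :: real
  proof -
    have "0 \<le> (\<bar>a\<bar> - \<bar>b\<bar>)\<^sup>2 + a\<^sup>2 + b\<^sup>2" by simp
    also have "\<dots> = 2 * (a\<^sup>2 + b\<^sup>2 - \<bar>a * b\<bar>)" by (simp add: power2_diff abs_mult)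
    finally show ?thesis by simp
  qed
  then show "AE x in lebesgue_on \<Omega>. norm (f x * g x) \<le> norm ((f x)\<^sup>2 + (g x)\<^sup>2)"
    by (intro AE_I2) simp
qed (use assms in \<open>auto simp: L2_def\<close>)

lemma L2_abs: "f \<in> L2 \<Omega> \<Longrightarrow> (\<lambda>x. \<bar>f x\<bar>) \<in> L2 \<Omega>"
  by (auto simp: L2_def)

lemma L2_const:
  assumes "open \<Omega>" "bounded \<Omega>"
  shows "(\<lambda>_. c) \<in> L2 \<Omega>"
proof -
  have "finite_measure (lebesgue_on \<Omega>)"
    using assms by (intro finite_measure_lebesgue_on lmeasurable_open)
  then show ?thesis by (simp add: L2_def finite_measure.integrable_const)
qed

lemma continuous_measurable_open:
  "open \<Omega> \<Longrightarrow> continuous_on \<Omega> f \<Longrightarrow> f \<in> borel_measurable (lebesgue_on \<Omega>)"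
  by (intro continuous_imp_measurable_on_sets_lebesgue) auto

text \<open>A function that tends to zero at the boundary is small near it, so the boundary condition
  enters only through this compactness.\<close>

lemma compact_superlevel_set:
  fixes q :: "real^'n \<Rightarrow> real"
  assumes "open \<Omega>" "bounded \<Omega>" "continuous_on \<Omega> q" "\<delta> > 0"
    and "\<And>p. p \<in> frontier \<Omega> \<Longrightarrow> (q \<longlongrightarrow> 0) (at p within \<Omega>)"
  shows "compact {x \<in> \<Omega>. q x \<ge> \<delta>}"
proof -
  have "closed {x \<in> \<Omega>. q x \<ge> \<delta>}"
    unfolding closed_sequential_limits
  proof safe
    fix X x assume X: "\<forall>n. X n \<in> {x \<in> \<Omega>. \<delta> \<le> q x}" and lim: "X \<longlonglongrightarrow> x"
    have X\<Omega>: "X n \<in> \<Omega>" "\<delta> \<le> q (X n)" for n using X by auto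
    have "x \<in> closure \<Omega>" using X\<Omega> lim closure_sequential by blast
    show x: "x \<in> \<Omega>"
    proof (rule ccontr)
      assume "x \<notin> \<Omega>"
      then have "(q \<longlongrightarrow> 0) (at x within \<Omega>)"
        using \<open>x \<in> closure \<Omega>\<close> assms(1) by (intro assms(5)) (simp add: frontier_def interior_open)
      then have "(q \<circ> X) \<longlonglongrightarrow> 0"
        using X\<Omega> lim \<open>x \<notin> \<Omega>\<close> unfolding tendsto_at_iff_sequentially by auto
      then have "\<delta> \<le> 0"
        by (rule LIMSEQ_le_const) (use X\<Omega> in auto)
      then show False using assms(4) by simp
    qed
    have "(\<lambda>n. q (X n)) \<longlonglongrightarrow> q x"
      by (rule continuous_on_tendsto_compose[OF assms(3) lim x]) (use X\<Omega> in auto)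
    then show "\<delta> \<le> q x" by (rule LIMSEQ_le_const) (use X\<Omega> in auto)
  qed
  moreover have "bounded {x \<in> \<Omega>. q x \<ge> \<delta>}" using assms(2) by (rule bounded_subset) auto
  ultimately show ?thesis by (simp add: compact_eq_bounded_closed)
qed

text \<open>The classical situation: a weight \<open>M\<close> and a displacement \<open>U\<close> with symmetric gradient \<open>E\<close>, such
  that the field \<open>M E\<close> is divergence free in \<open>\<Omega>\<close> and \<open>U\<close> vanishes on the boundary. In \<open>DM i\<close>,
  \<open>DU i j\<close> and \<open>DE k i j\<close> the first index is the direction of differentiation.\<close>

locale weighted_strain =
  fixes \<Omega> :: "(real^'n) set"
    and M :: "real^'n \<Rightarrow> real" and DM :: "'n \<Rightarrow> real^'n \<Rightarrow> real"
    and U :: "'n \<Rightarrow> real^'n \<Rightarrow> real" and DU :: "'n \<Rightarrow> 'n \<Rightarrow> real^'n \<Rightarrow> real"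
    and E :: "'n \<Rightarrow> 'n \<Rightarrow> real^'n \<Rightarrow> real" and DE :: "'n \<Rightarrow> 'n \<Rightarrow> 'n \<Rightarrow> real^'n \<Rightarrow> real"
  assumes open_\<Omega>: "open \<Omega>" and bounded_\<Omega>: "bounded \<Omega>"
    and M_C1: "\<And>i. C1_along i \<Omega> M (DM i)" and M_L2: "M \<in> L2 \<Omega>"
    and U_C1: "\<And>i j. C1_along i \<Omega> (U j) (DU i j)" and DU_L2: "\<And>i j. DU i j \<in> L2 \<Omega>"
    and E_C1: "\<And>k i j. C1_along k \<Omega> (E i j) (DE k i j)" and E_L2: "\<And>i j. E i j \<in> L2 \<Omega>"
    and DE_L2: "\<And>k i j. DE k i j \<in> L2 \<Omega>"
    and E_eq: "\<And>i j x. x \<in> \<Omega> \<Longrightarrow> E i j x = (DU i j x + DU j i x) / 2"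
    and divergence_free: "\<And>j x. x \<in> \<Omega> \<Longrightarrow> (\<Sum>i\<in>UNIV. M x * DE i i j x + DM i x * E i j x) = 0"
    and boundary: "\<And>j p. p \<in> frontier \<Omega> \<Longrightarrow> (U j \<longlongrightarrow> 0) (at p within \<Omega>)"
begin

text \<open>Here \<open>q\<close> is the squared length of the displacement, \<open>S\<close> that of the strain, \<open>P\<close> the inner
  product of the displacement with the divergence of the strain, and \<open>R\<close> the strain contracted
  with the displacement and the gradient of \<open>q\<close>.\<close>

definition q :: "real^'n \<Rightarrow> real" where "q x = (\<Sum>k\<in>UNIV. U k x * U k x)"
definition Dq :: "'n \<Rightarrow> real^'n \<Rightarrow> real" where "Dq i x = (\<Sum>k\<in>UNIV. U k x * DU i k x + DU i k x * U k x)"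
definition S :: "real^'n \<Rightarrow> real" where "S x = (\<Sum>i\<in>UNIV. \<Sum>j\<in>UNIV. (E i j x)\<^sup>2)"
definition R :: "real^'n \<Rightarrow> real" where "R x = (\<Sum>i\<in>UNIV. \<Sum>j\<in>UNIV. E i j x * (Dq i x * U j x))"
definition P :: "real^'n \<Rightarrow> real" where "P x = (\<Sum>j\<in>UNIV. U j x * (\<Sum>i\<in>UNIV. DE i i j x))"

lemma q_C1: "C1_along i \<Omega> q (Dq i)"
  unfolding q_def[abs_def] Dq_def[abs_def] by (intro C1_along_sum C1_along_mult U_C1)

lemma field_continuous: "continuous_on \<Omega> M" "continuous_on \<Omega> (U j)" "continuous_on \<Omega> (DU i j)" "continuous_on \<Omega> (E i j)"
  "continuous_on \<Omega> (DE k i j)" "continuous_on \<Omega> q" "continuous_on \<Omega> (Dq i)"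
  using M_C1[of undefined] U_C1[of i j] E_C1[of k i j] q_C1[of i] by (auto simp: C1_along_def)

lemma derived_continuous: "continuous_on \<Omega> S" "continuous_on \<Omega> R" "continuous_on \<Omega> P"
  unfolding S_def[abs_def] R_def[abs_def] P_def[abs_def] by (intro continuous_intros field_continuous)+

lemma q_nonneg: "0 \<le> q x"
  unfolding q_def by (intro sum_nonneg) simp

lemma U_sq_le_q: "\<bar>U j x\<bar>\<^sup>2 \<le> q x"
  unfolding q_def power2_eq_square using member_le_sum[of j UNIV "\<lambda>k. U k x * U k x"] by simp

lemma compact_q: "\<delta> > 0 \<Longrightarrow> compact {x \<in> \<Omega>. q x \<ge> \<delta>}"
proof (rule compact_superlevel_set[OF open_\<Omega> bounded_\<Omega> field_continuous(6)])
  fix p assume "p \<in> frontier \<Omega>"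
  then have "((\<lambda>x. \<Sum>k\<in>UNIV. U k x * U k x) \<longlongrightarrow> (\<Sum>k\<in>(UNIV::'n set). 0 * 0)) (at p within \<Omega>)"
    by (intro tendsto_intros boundary)
  then show "(q \<longlongrightarrow> 0) (at p within \<Omega>)" by (simp add: q_def[abs_def])
qed

lemma U_bounded: obtains B where "B \<ge> 0" "\<And>j x. x \<in> \<Omega> \<Longrightarrow> \<bar>U j x\<bar> \<le> B"
proof -
  have "bounded (q ` {x \<in> \<Omega>. q x \<ge> 1})"
    by (intro compact_imp_bounded compact_continuous_image compact_q continuous_on_subset[OF field_continuous(6)]) auto
  then obtain b where b: "\<And>x. x \<in> \<Omega> \<Longrightarrow> q x \<ge> 1 \<Longrightarrow> q x \<le> b"
    unfolding bounded_iff by fastforce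
  have "\<bar>U j x\<bar> \<le> 1 + \<bar>b\<bar>" if "x \<in> \<Omega>" for j x
  proof -
    have "\<bar>U j x\<bar>\<^sup>2 \<le> 1 + \<bar>b\<bar>" using U_sq_le_q[of j x] b[OF that] by (cases "q x \<ge> 1") auto
    also have "\<dots> \<le> (1 + \<bar>b\<bar>)\<^sup>2" by (simp add: power2_eq_square algebra_simps)
    finally show ?thesis by (rule power2_le_imp_le) simp
  qed
  then show ?thesis using that[of "1 + \<bar>b\<bar>"] by simp
qed

text \<open>The antisymmetric part of the gradient is orthogonal to the symmetric strain.\<close>

lemma strain_contraction:
  assumes "x \<in> \<Omega>"
  shows "(\<Sum>i\<in>UNIV. \<Sum>j\<in>UNIV. E i j x * DU i j x) = S x"
proof -
  have sym: "E j i x = E i j x" for i j using E_eq[OF assms, of i j] E_eq[OF assms, of j i] by simp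
  have "(\<Sum>i\<in>UNIV. \<Sum>j\<in>UNIV. E i j x * DU i j x) = (\<Sum>i\<in>UNIV. \<Sum>j\<in>UNIV. E i j x * DU j i x)"
    by (subst sum.swap) (simp add: sym)
  then have "2 * (\<Sum>i\<in>UNIV. \<Sum>j\<in>UNIV. E i j x * DU i j x) = (\<Sum>i\<in>UNIV. \<Sum>j\<in>UNIV. E i j x * (DU i j x + DU j i x))"
    by (simp add: distrib_left sum.distrib)
  also have "\<dots> = (\<Sum>i\<in>UNIV. \<Sum>j\<in>UNIV. 2 * (E i j x)\<^sup>2)"
    by (intro sum.cong refl) (simp add: E_eq[OF assms] power2_eq_square)
  also have "\<dots> = 2 * S x" by (simp add: S_def sum_distrib_left)
  finally show ?thesis by simp
qed

text \<open>The equation is tested with the vector field \<open>cutoff \<delta> q * sgn_approx \<kappa> M * U\<close>, which has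
  compact support. Where the derivative falls on \<open>M\<close>, the equation itself replaces the product of
  the strain with the gradient of \<open>M\<close> by \<open>- M\<close> times the divergence of the strain; this is the
  origin of the factor \<open>M\<^sup>2\<close> in the last term.\<close>

lemma energy_identity:
  assumes k: "\<kappa> > 0" and d: "\<delta> > 0"
  shows "(LINT x|lebesgue_on \<Omega>. cutoff \<delta> (q x) * (M x * sgn_approx \<kappa> (M x)) * S x
      + cutoff' \<delta> (q x) * (M x * sgn_approx \<kappa> (M x)) * R x
      - cutoff \<delta> (q x) * ((M x)\<^sup>2 * sgn_approx' \<kappa> (M x)) * P x) = 0"
proof -
  let ?c = "\<lambda>x. cutoff \<delta> (q x)" and ?c' = "\<lambda>x. cutoff' \<delta> (q x)"
  let ?t = "\<lambda>x. sgn_approx \<kappa> (M x)" and ?t' = "\<lambda>x. sgn_approx' \<kappa> (M x)"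
  let ?G = "\<lambda>i j x. (M x * E i j x) * ((?c x * ?t x) * DU i j x + (?c x * (?t' x * DM i x) + (?c' x * Dq i x) * ?t x) * U j x)
     + (M x * DE i i j x + DM i x * E i j x) * ((?c x * ?t x) * U j x)"
  have C1: "C1_along i \<Omega> (\<lambda>x. (M x * E i j x) * ((?c x * ?t x) * U j x)) (?G i j)" for i j
    using d k
    by (intro C1_along_mult M_C1 E_C1 U_C1 C1_along_chain q_C1 has_real_derivative_cutoff
        has_real_derivative_sgn_approx continuous_cutoff' continuous_sgn_approx')
  have zero: "M x * E i j x * (?c x * ?t x * U j x) = 0" if "x \<in> \<Omega> - {x \<in> \<Omega>. \<delta> \<le> q x}" for i j x
  proof -
    have "q x \<le> \<delta>" using that by auto
    then show ?thesis by (simp add: cutoff_eq_0)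
  qed
  note G = integral_C1_along_compact_support[OF open_\<Omega> C1 compact_q[OF d] _ zero, OF Collect_restrict]
  have "(LINT x|lebesgue_on \<Omega>. (\<Sum>i\<in>UNIV. \<Sum>j\<in>UNIV. ?G i j x)) = 0"
    using G by simp
  moreover have "(\<Sum>i\<in>UNIV. \<Sum>j\<in>UNIV. ?G i j x) = ?c x * (M x * ?t x) * S x + ?c' x * (M x * ?t x) * R x
      - ?c x * ((M x)\<^sup>2 * ?t' x) * P x" if x: "x \<in> \<Omega>" for x
  proof -
    \<comment> \<open>The summands are the derivative falling on \<open>U\<close>, on \<open>M\<close>, on the cutoff, and on the field \<open>M E\<close>.\<close>
    have G_eq: "?G i j x = (M x * ?t x * ?c x) * (E i j x * DU i j x) + (M x * ?c x * ?t' x) * (U j x * (DM i x * E i j x))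
        + (?c' x * (M x * ?t x)) * (E i j x * (Dq i x * U j x)) + (?c x * ?t x) * (U j x * (M x * DE i i j x + DM i x * E i j x))" for i j
      by (simp add: algebra_simps)
    have sw: "(\<Sum>i\<in>UNIV. \<Sum>j\<in>UNIV. U j x * f i j) = (\<Sum>j\<in>UNIV. U j x * (\<Sum>i\<in>UNIV. f i j))" for f :: "'n \<Rightarrow> 'n \<Rightarrow> real"
      by (subst sum.swap) (simp add: sum_distrib_left)
    have div: "(\<Sum>i\<in>UNIV. DM i x * E i j x) = - (M x * (\<Sum>i\<in>UNIV. DE i i j x))" for j
      using divergence_free[OF x, of j] by (simp add: sum.distrib sum_distrib_left)
    have "(\<Sum>i\<in>UNIV. \<Sum>j\<in>UNIV. ?G i j x) = (M x * ?t x * ?c x) * (\<Sum>i\<in>UNIV. \<Sum>j\<in>UNIV. E i j x * DU i j x)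
        + (M x * ?c x * ?t' x) * (\<Sum>i\<in>UNIV. \<Sum>j\<in>UNIV. U j x * (DM i x * E i j x))
        + (?c' x * (M x * ?t x)) * (\<Sum>i\<in>UNIV. \<Sum>j\<in>UNIV. E i j x * (Dq i x * U j x))
        + (?c x * ?t x) * (\<Sum>i\<in>UNIV. \<Sum>j\<in>UNIV. U j x * (M x * DE i i j x + DM i x * E i j x))"
      unfolding G_eq by (simp add: sum.distrib sum_distrib_left)
    also have "(\<Sum>i\<in>UNIV. \<Sum>j\<in>UNIV. U j x * (DM i x * E i j x)) = - M x * P x"
      unfolding sw div P_def by (simp add: sum_distrib_left sum_negf mult_ac)
    also have "(\<Sum>i\<in>UNIV. \<Sum>j\<in>UNIV. U j x * (M x * DE i i j x + DM i x * E i j x)) = 0"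
      unfolding sw by (simp add: divergence_free[OF x])
    also have "(\<Sum>i\<in>UNIV. \<Sum>j\<in>UNIV. E i j x * (Dq i x * U j x)) = R x" by (simp add: R_def)
    finally show ?thesis unfolding strain_contraction[OF x] by (simp add: power2_eq_square algebra_simps)
  qed
  ultimately show ?thesis
    by (subst Bochner_Integration.integral_cong[OF refl, symmetric]) auto
qed

definition nonzero_set where "nonzero_set = {x \<in> \<Omega>. q x > 0}"

lemma open_nonzero_set: "open nonzero_set"
proof -
  have "nonzero_set = \<Omega> \<inter> q -` {0<..}" by (auto simp: nonzero_set_def)
  then show ?thesis using open_\<Omega> field_continuous(6) by (simp add: continuous_open_preimage)
qed

lemma measurable_nonzero_set: "(indicator nonzero_set :: _ \<Rightarrow> real) \<in> borel_measurable (lebesgue_on \<Omega>)"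
  using open_nonzero_set by (intro measurable_restrict_space1 measurable_completion) auto

text \<open>Every summand of \<open>R\<close> contains two factors of \<open>U\<close>, hence is controlled by \<open>q\<close>, and \<open>q\<close> times the
  derivative of the cutoff is at most \<open>3\<close>.\<close>

lemma R_bound:
  assumes d: "\<delta> > 0"
  shows "\<bar>cutoff' \<delta> (q x) * R x\<bar> \<le> (\<Sum>i\<in>UNIV. \<Sum>j\<in>UNIV. \<Sum>k\<in>UNIV. 6 * (\<bar>E i j x\<bar> * \<bar>DU i k x\<bar>))"
proof -
  let ?c = "cutoff' \<delta> (q x)"
  have c: "0 \<le> ?c" by (rule cutoff'_nonneg)
  have UU: "?c * (\<bar>U k x\<bar> * \<bar>U j x\<bar>) \<le> 3" for j k
  proof -
    have sq: "\<bar>U l x\<bar> \<le> sqrt (q x)" for l using U_sq_le_q[of l x] by (intro real_le_rsqrt)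
    have "\<bar>U k x\<bar> * \<bar>U j x\<bar> \<le> sqrt (q x) * sqrt (q x)" by (intro mult_mono sq) (auto simp: q_nonneg)
    then have "?c * (\<bar>U k x\<bar> * \<bar>U j x\<bar>) \<le> ?c * q x" using c q_nonneg[of x] by (intro mult_left_mono) auto
    also have "\<dots> \<le> 3" using cutoff'_bound[OF d q_nonneg[of x]] by (simp add: mult.commute)
    finally show ?thesis .
  qed
  have summand: "\<bar>?c * (E i j x * ((U k x * DU i k x + DU i k x * U k x) * U j x))\<bar> \<le> 6 * (\<bar>E i j x\<bar> * \<bar>DU i k x\<bar>)" for i j k
  proof -
    have "?c * (E i j x * ((U k x * DU i k x + DU i k x * U k x) * U j x))
        = (?c * (U k x * U j x)) * (2 * (E i j x * DU i k x))"
      by (simp add: algebra_simps)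
    then have "\<bar>?c * (E i j x * ((U k x * DU i k x + DU i k x * U k x) * U j x))\<bar>
        = (?c * (\<bar>U k x\<bar> * \<bar>U j x\<bar>)) * (2 * (\<bar>E i j x\<bar> * \<bar>DU i k x\<bar>))"
      using c by (simp add: abs_mult)
    also have "\<dots> \<le> 3 * (2 * (\<bar>E i j x\<bar> * \<bar>DU i k x\<bar>))" by (intro mult_right_mono UU) auto
    finally show ?thesis by simp
  qed
  have "?c * R x = (\<Sum>i\<in>UNIV. \<Sum>j\<in>UNIV. \<Sum>k\<in>UNIV. ?c * (E i j x * ((U k x * DU i k x + DU i k x * U k x) * U j x)))"
    unfolding R_def Dq_def by (simp only: sum_distrib_left sum_distrib_right)
  also have "\<bar>\<dots>\<bar> \<le> (\<Sum>i\<in>UNIV. \<Sum>j\<in>UNIV. \<Sum>k\<in>UNIV. 6 * (\<bar>E i j x\<bar> * \<bar>DU i k x\<bar>))"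
    by (intro order_trans[OF sum_abs] sum_mono summand)
  finally show ?thesis .
qed

lemma S_nonneg: "0 \<le> S x"
  unfolding S_def by (intro sum_nonneg) simp

lemma S_integrable: "integrable (lebesgue_on \<Omega>) S"
  unfolding S_def[abs_def] using E_L2 by (auto simp: L2_def)

lemma P_dominated:
  obtains w where "integrable (lebesgue_on \<Omega>) w" "\<And>x. x \<in> \<Omega> \<Longrightarrow> (2 + \<bar>M x\<bar>) * \<bar>P x\<bar> \<le> w x"
proof -
  obtain B where B: "B \<ge> 0" "\<And>j x. x \<in> \<Omega> \<Longrightarrow> \<bar>U j x\<bar> \<le> B" using U_bounded by blast
  let ?w = "\<lambda>x. \<Sum>j\<in>UNIV. \<Sum>i\<in>UNIV. B * (2 * \<bar>DE i i j x\<bar> + \<bar>M x\<bar> * \<bar>DE i i j x\<bar>)"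
  have "integrable (lebesgue_on \<Omega>) (\<lambda>x. 2 * \<bar>DE i i j x\<bar>)" for i j
    using L2_mult_integrable[OF L2_const[OF open_\<Omega> bounded_\<Omega>, of 2] L2_abs[OF DE_L2]] .
  moreover have "integrable (lebesgue_on \<Omega>) (\<lambda>x. \<bar>M x\<bar> * \<bar>DE i i j x\<bar>)" for i j
    using L2_mult_integrable[OF L2_abs[OF M_L2] L2_abs[OF DE_L2]] .
  ultimately have "integrable (lebesgue_on \<Omega>) ?w"
    by (intro Bochner_Integration.integrable_sum Bochner_Integration.integrable_mult_right[OF Bochner_Integration.integrable_add])
  moreover have "(2 + \<bar>M x\<bar>) * \<bar>P x\<bar> \<le> ?w x" if x: "x \<in> \<Omega>" for x
  proof -
    have "\<bar>P x\<bar> \<le> (\<Sum>j\<in>UNIV. \<bar>U j x\<bar> * (\<Sum>i\<in>UNIV. \<bar>DE i i j x\<bar>))"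
      unfolding P_def
      by (rule order_trans[OF sum_abs]) (auto simp: abs_mult intro!: sum_mono mult_left_mono sum_abs)
    also have "\<dots> \<le> (\<Sum>j\<in>UNIV. B * (\<Sum>i\<in>UNIV. \<bar>DE i i j x\<bar>))"
      using B(2)[OF x] by (intro sum_mono mult_right_mono sum_nonneg) auto
    finally have "(2 + \<bar>M x\<bar>) * \<bar>P x\<bar> \<le> (2 + \<bar>M x\<bar>) * (\<Sum>j\<in>UNIV. B * (\<Sum>i\<in>UNIV. \<bar>DE i i j x\<bar>))"
      by (intro mult_left_mono) auto
    also have "\<dots> = ?w x"
      unfolding sum_distrib_left by (intro sum.cong refl) (simp add: algebra_simps)
    finally show ?thesis .
  qed
  ultimately show ?thesis by (rule that)
qed

lemma sgn_approx'_dominated: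
  assumes k: "\<kappa> > 0" "\<kappa> \<le> 1"
  shows "\<bar>(M x)\<^sup>2 * sgn_approx' \<kappa> (M x) * P x\<bar> \<le> (2 + \<bar>M x\<bar>) * \<bar>P x\<bar>"
proof -
  have "\<kappa> ^ 3 \<le> 1" using k by (simp add: power_le_one)
  then have "\<bar>(M x)\<^sup>2 * sgn_approx' \<kappa> (M x)\<bar> \<le> 2 + \<bar>M x\<bar>"
    using sgn_approx_bounds(4)[OF k(1), of "M x"] k by linarith
  then show ?thesis by (subst abs_mult) (intro mult_right_mono, auto)
qed

lemma continuous_sgn_approx_M:
  assumes "\<kappa> > 0"
  shows "continuous_on \<Omega> (\<lambda>x. sgn_approx \<kappa> (M x))" "continuous_on \<Omega> (\<lambda>x. sgn_approx' \<kappa> (M x))"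
  using C1_along_chain[OF M_C1 has_real_derivative_sgn_approx[OF assms] continuous_sgn_approx'[OF assms], of undefined]
    continuous_on_compose2[OF continuous_sgn_approx'[OF assms] field_continuous(1)] by (auto simp: C1_along_def)

text \<open>The limit \<open>\<delta> \<longlongrightarrow> 0\<close> in the energy identity. Near the boundary \<open>M\<close> is only controlled in the mean
  square, while \<open>S\<close> and the bound on \<open>R\<close> are merely integrable; the bound \<open>1 / \<kappa>\<close> on
  \<open>M * sgn_approx \<kappa> M\<close> is what makes their products with this factor dominated.\<close>

lemma limit_identity:
  assumes k: "\<kappa> > 0" "\<kappa> \<le> 1"
  shows "integrable (lebesgue_on \<Omega>) (\<lambda>x. indicator nonzero_set x * (M x * sgn_approx \<kappa> (M x) * S x))"
    "integrable (lebesgue_on \<Omega>) (\<lambda>x. indicator nonzero_set x * ((M x)\<^sup>2 * sgn_approx' \<kappa> (M x) * P x))"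
    "(LINT x|lebesgue_on \<Omega>. indicator nonzero_set x * (M x * sgn_approx \<kappa> (M x) * S x))
     = (LINT x|lebesgue_on \<Omega>. indicator nonzero_set x * ((M x)\<^sup>2 * sgn_approx' \<kappa> (M x) * P x))"
proof -
  obtain w where w: "integrable (lebesgue_on \<Omega>) w" "\<And>x. x \<in> \<Omega> \<Longrightarrow> (2 + \<bar>M x\<bar>) * \<bar>P x\<bar> \<le> w x"
    using P_dominated by blast
  let ?a = "\<lambda>x. M x * sgn_approx \<kappa> (M x)" and ?b = "\<lambda>x. (M x)\<^sup>2 * sgn_approx' \<kappa> (M x)"
  have a: "0 \<le> ?a x" "?a x \<le> 1 / \<kappa>" for x using sgn_approx_bounds[OF k(1)] by auto
  have bP: "\<bar>?b x * P x\<bar> \<le> w x" if "x \<in> \<Omega>" for x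
    using sgn_approx'_dominated[OF k] w(2)[OF that] by (rule order_trans)
  have aS: "\<bar>?a x * S x\<bar> \<le> 1 / \<kappa> * S x" for x
    unfolding abs_mult using a[of x] S_nonneg[of x] k(1) by (intro mult_mono) auto
  have mb: "(\<lambda>x. ?a x * S x) \<in> borel_measurable (lebesgue_on \<Omega>)" "(\<lambda>x. ?b x * P x) \<in> borel_measurable (lebesgue_on \<Omega>)"
    by (intro continuous_measurable_open[OF open_\<Omega>] continuous_intros field_continuous derived_continuous continuous_sgn_approx_M k)+
  show ia: "integrable (lebesgue_on \<Omega>) (\<lambda>x. indicator nonzero_set x * (?a x * S x))"
  proof (rule Bochner_Integration.integrable_bound[where f = "\<lambda>x. 1 / \<kappa> * S x"])
    show "AE x in lebesgue_on \<Omega>. norm (indicator nonzero_set x * (?a x * S x)) \<le> norm (1 / \<kappa> * S x)"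
      using order_trans[OF aS abs_ge_self] by (intro AE_I2) (simp add: indicator_def abs_mult)
  qed (use S_integrable mb measurable_nonzero_set in auto)
  show ib: "integrable (lebesgue_on \<Omega>) (\<lambda>x. indicator nonzero_set x * (?b x * P x))"
  proof (rule Bochner_Integration.integrable_bound[OF w(1)])
    show "AE x in lebesgue_on \<Omega>. norm (indicator nonzero_set x * (?b x * P x)) \<le> norm (w x)"
      using order_trans[OF bP abs_ge_self] by (intro AE_I2) (auto simp: indicator_def abs_mult)
  qed (use mb measurable_nonzero_set in auto)
  define X where "X n = inverse (real (Suc n))" for n
  have X: "X \<longlonglongrightarrow> 0" "X n > 0" for n
    unfolding X_def using LIMSEQ_inverse_real_of_nat by auto
  let ?f = "\<lambda>n x. cutoff (X n) (q x) * ?a x * S x + cutoff' (X n) (q x) * ?a x * R x - cutoff (X n) (q x) * ?b x * P x"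
  let ?g = "\<lambda>x. indicator nonzero_set x * (?a x * S x) - indicator nonzero_set x * (?b x * P x)"
  let ?r = "\<lambda>x. \<Sum>i\<in>UNIV. \<Sum>j\<in>UNIV. \<Sum>k\<in>UNIV. 6 * (\<bar>E i j x\<bar> * \<bar>DU i k x\<bar>)"
  have "(\<lambda>n. LINT x|lebesgue_on \<Omega>. ?f n x) \<longlonglongrightarrow> (LINT x|lebesgue_on \<Omega>. ?g x)"
  proof (rule integral_dominated_convergence[where w = "\<lambda>x. 1 / \<kappa> * S x + 1 / \<kappa> * ?r x + w x"])
    show "?g \<in> borel_measurable (lebesgue_on \<Omega>)" using ia ib by auto
    have "integrable (lebesgue_on \<Omega>) ?r"
      by (intro Bochner_Integration.integrable_sum Bochner_Integration.integrable_mult_right L2_mult_integrable L2_abs E_L2 DU_L2)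
    then show "integrable (lebesgue_on \<Omega>) (\<lambda>x. 1 / \<kappa> * S x + 1 / \<kappa> * ?r x + w x)"
      using S_integrable w(1) by (intro Bochner_Integration.integrable_add Bochner_Integration.integrable_mult_right)
    show "?f n \<in> borel_measurable (lebesgue_on \<Omega>)" for n
    proof -
      have c: "continuous_on \<Omega> (\<lambda>x. cutoff (X n) (q x))"
        by (rule C1_along_continuous[OF C1_along_chain[OF q_C1 has_real_derivative_cutoff[OF X(2)] continuous_cutoff'[OF X(2)]]])
      have c': "continuous_on \<Omega> (\<lambda>x. cutoff' (X n) (q x))"
        by (rule continuous_on_compose2[OF continuous_cutoff'[OF X(2)] field_continuous(6)]) simp
      show ?thesis
        by (intro continuous_measurable_open[OF open_\<Omega>] continuous_on_add continuous_on_diff continuous_on_mult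
            continuous_on_power c c' field_continuous derived_continuous continuous_sgn_approx_M k)
    qed
    show "AE x in lebesgue_on \<Omega>. (\<lambda>n. ?f n x) \<longlonglongrightarrow> ?g x"
    proof (rule AE_I2)
      fix x assume "x \<in> space (lebesgue_on \<Omega>)"
      then have x: "x \<in> \<Omega>" by simp
      have "(\<lambda>n. ?f n x) \<longlonglongrightarrow> (if q x > 0 then 1 else 0) * ?a x * S x + 0 * ?a x * R x - (if q x > 0 then 1 else 0) * ?b x * P x"
        by (intro tendsto_intros cutoff_tendsto[OF X q_nonneg])
      moreover have "(if q x > 0 then 1 else 0) * ?a x * S x + 0 * ?a x * R x - (if q x > 0 then 1 else 0) * ?b x * P x = ?g x"
        using x by (simp add: nonzero_set_def indicator_def)
      ultimately show "(\<lambda>n. ?f n x) \<longlonglongrightarrow> ?g x" by (simp only:)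
    qed
    show "AE x in lebesgue_on \<Omega>. norm (?f n x) \<le> 1 / \<kappa> * S x + 1 / \<kappa> * ?r x + w x" for n
    proof (rule AE_I2)
      fix x assume "x \<in> space (lebesgue_on \<Omega>)"
      then have x: "x \<in> \<Omega>" by simp
      have c: "0 \<le> cutoff (X n) (q x)" "cutoff (X n) (q x) \<le> 1" using cutoff_bounds[OF X(2)] by auto
      have "\<bar>cutoff (X n) (q x) * (?a x * S x)\<bar> \<le> 1 * (1 / \<kappa> * S x)"
        unfolding abs_mult[of "cutoff _ _"] using c aS[of x] by (intro mult_mono) auto
      moreover have "\<bar>cutoff (X n) (q x) * (?b x * P x)\<bar> \<le> 1 * w x"
        unfolding abs_mult[of "cutoff _ _"] using c bP[OF x] by (intro mult_mono) auto
      moreover have "\<bar>?a x * (cutoff' (X n) (q x) * R x)\<bar> \<le> 1 / \<kappa> * ?r x"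
        unfolding abs_mult[of "_ * sgn_approx _ _"] using a[of x] k(1) R_bound[OF X(2)[of n], of x] by (intro mult_mono) auto
      moreover have "?f n x = cutoff (X n) (q x) * (?a x * S x) + ?a x * (cutoff' (X n) (q x) * R x) - cutoff (X n) (q x) * (?b x * P x)"
        by (simp add: mult_ac)
      ultimately show "norm (?f n x) \<le> 1 / \<kappa> * S x + 1 / \<kappa> * ?r x + w x"
        unfolding real_norm_def by linarith
    qed
  qed
  moreover have "(LINT x|lebesgue_on \<Omega>. ?f n x) = 0" for n
    by (rule energy_identity[OF k(1) X(2)])
  ultimately have "(LINT x|lebesgue_on \<Omega>. ?g x) = 0" by (simp add: LIMSEQ_const_iff)
  then show "(LINT x|lebesgue_on \<Omega>. indicator nonzero_set x * (?a x * S x)) = (LINT x|lebesgue_on \<Omega>. indicator nonzero_set x * (?b x * P x))"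
    using ia ib by simp
qed

text \<open>The limit \<open>\<kappa> \<longlongrightarrow> 0\<close>. The right-hand side of the limit identity tends to zero, while its left-hand
  side is bounded below by the value of the integral at \<open>\<kappa> = 1\<close>, whose integrand is nonnegative
  and, on the set where \<open>q\<close> is positive, vanishes only where \<open>M\<close> or \<open>S\<close> does.\<close>

lemma weighted_strain_eq_0_on_nonzero_set:
  assumes x: "x \<in> nonzero_set"
  shows "M x * S x = 0"
proof -
  obtain w where w: "integrable (lebesgue_on \<Omega>) w" "\<And>x. x \<in> \<Omega> \<Longrightarrow> (2 + \<bar>M x\<bar>) * \<bar>P x\<bar> \<le> w x"
    using P_dominated by blast
  define X where "X n = inverse (real (Suc n))" for n
  have X: "X \<longlonglongrightarrow> 0" "X n > 0" "X n \<le> 1" for n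
    unfolding X_def using LIMSEQ_inverse_real_of_nat by (auto simp: inverse_le_1_iff)
  let ?b = "\<lambda>n x. indicator nonzero_set x * ((M x)\<^sup>2 * sgn_approx' (X n) (M x) * P x)"
  let ?h = "\<lambda>x. indicator nonzero_set x * (M x * sgn_approx 1 (M x) * S x)"
  have "(\<lambda>n. LINT x|lebesgue_on \<Omega>. ?b n x) \<longlonglongrightarrow> (LINT x|lebesgue_on \<Omega>. 0)"
  proof (rule integral_dominated_convergence[OF _ _ w(1)])
    show "?b n \<in> borel_measurable (lebesgue_on \<Omega>)" for n using limit_identity(2)[OF X(2,3)] by auto
    show "AE x in lebesgue_on \<Omega>. (\<lambda>n. ?b n x) \<longlonglongrightarrow> 0"
    proof (rule AE_I2)
      fix x
      have "(\<lambda>n. (M x)\<^sup>2 * sgn_approx' (X n) (M x)) \<longlonglongrightarrow> 0"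
      proof (rule Lim_null_comparison)
        show "\<forall>\<^sub>F n in sequentially. norm ((M x)\<^sup>2 * sgn_approx' (X n) (M x)) \<le> X n + X n ^ 3 + X n * (M x)\<^sup>2"
          using sgn_approx_bounds(3)[OF X(2)] by simp
        show "(\<lambda>n. X n + X n ^ 3 + X n * (M x)\<^sup>2) \<longlonglongrightarrow> 0"
          by (rule tendsto_eq_intros X(1) refl | simp)+
      qed
      from tendsto_mult_left[OF tendsto_mult_right[OF this, of "P x"], of "indicator nonzero_set x"]
      show "(\<lambda>n. ?b n x) \<longlonglongrightarrow> 0" by simp
    qed
    show "AE x in lebesgue_on \<Omega>. norm (?b n x) \<le> w x" for n
    proof (rule AE_I2)
      fix x assume "x \<in> space (lebesgue_on \<Omega>)"
      then have "\<bar>(M x)\<^sup>2 * sgn_approx' (X n) (M x) * P x\<bar> \<le> w x"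
        using order_trans[OF sgn_approx'_dominated[OF X(2,3)] w(2)] by simp
      then show "norm (?b n x) \<le> w x" by (auto simp: indicator_def)
    qed
  qed simp
  moreover have "(LINT x|lebesgue_on \<Omega>. ?h x) \<le> (LINT x|lebesgue_on \<Omega>. ?b n x)" for n
  proof -
    have "(LINT x|lebesgue_on \<Omega>. ?h x) \<le> (LINT x|lebesgue_on \<Omega>. indicator nonzero_set x * (M x * sgn_approx (X n) (M x) * S x))"
    proof (rule integral_mono)
      fix x
      have "M x * sgn_approx 1 (M x) * S x \<le> M x * sgn_approx (X n) (M x) * S x"
        by (intro mult_right_mono sgn_approx_lower X S_nonneg)
      then show "?h x \<le> indicator nonzero_set x * (M x * sgn_approx (X n) (M x) * S x)"
        by (intro mult_left_mono) auto
    qed (use limit_identity(1)[of 1] limit_identity(1)[OF X(2,3)] in auto)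
    then show ?thesis using limit_identity(3)[OF X(2,3)] by simp
  qed
  ultimately have le0: "(LINT x|lebesgue_on \<Omega>. ?h x) \<le> 0" by (intro LIMSEQ_le_const) auto
  have h0: "0 \<le> ?h x" for x using sgn_approx_bounds(1)[of 1] S_nonneg by simp
  have "(LINT x|lebesgue_on \<Omega>. ?h x) = 0"
    by (rule order_antisym[OF le0 Bochner_Integration.integral_nonneg[OF h0]])
  then have "AE x in lebesgue_on \<Omega>. ?h x = 0"
    using limit_identity(1)[of 1] h0 by (subst (asm) integral_nonneg_eq_0_iff_AE) auto
  then have "negligible {x \<in> \<Omega>. ?h x \<noteq> 0}"
    using open_\<Omega> by (subst (asm) AE_lebesgue_on_iff_negligible) auto
  moreover have "{x \<in> \<Omega>. ?h x \<noteq> 0} = nonzero_set \<inter> (\<lambda>x. M x * S x) -` (- {0})"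
  proof -
    have eq: "?h x \<noteq> 0 \<longleftrightarrow> x \<in> nonzero_set \<and> M x * S x \<noteq> 0" for x
    proof -
      have "M x * sgn_approx 1 (M x) * S x = 0 \<longleftrightarrow> M x = 0 \<or> S x = 0"
        unfolding mult_eq_0_iff[of "_ * _"] sgn_approx_1_eq_0_iff ..
      then show ?thesis by (simp only: mult_eq_0_iff[of "indicator _ _"] mult_eq_0_iff[of "M x" "S x"] indicator_eq_0_iff) blast
    qed
    have "{x \<in> \<Omega>. ?h x \<noteq> 0} = {x \<in> \<Omega>. x \<in> nonzero_set \<and> M x * S x \<noteq> 0}" by (simp only: eq)
    also have "\<dots> = nonzero_set \<inter> (\<lambda>x. M x * S x) -` (- {0})" by (auto simp: nonzero_set_def)
    finally show ?thesis .
  qed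
  moreover have "open (nonzero_set \<inter> (\<lambda>x. M x * S x) -` (- {0}))"
    using open_nonzero_set continuous_on_subset[OF continuous_on_mult[OF field_continuous(1) derived_continuous(1)], of nonzero_set]
    by (intro continuous_open_preimage) (auto simp: nonzero_set_def)
  ultimately have "nonzero_set \<inter> (\<lambda>x. M x * S x) -` (- {0}) = {}" using open_not_negligible by metis
  then show ?thesis using x by auto
qed

text \<open>The open set where \<open>M E\<close> does not vanish avoids the set where \<open>U\<close> does not vanish. So \<open>U\<close> is zero on
  this open set, hence so is its gradient; this forces the set to be empty.\<close>

theorem weighted_strain_eq_0:
  assumes x: "x \<in> \<Omega>"
  shows "M x * E i j x = 0"
proof -
  let ?W = "\<lambda>x. M x * E i j x"
  define G where "G = \<Omega> \<inter> ?W -` (- {0})"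
  have G: "open G" unfolding G_def using open_\<Omega> field_continuous by (intro continuous_open_preimage continuous_on_mult) auto
  have "G \<inter> nonzero_set = {}"
  proof safe
    fix y assume y: "y \<in> G" "y \<in> nonzero_set"
    then have "M y \<noteq> 0" "E i j y \<noteq> 0" by (auto simp: G_def)
    then have "S y = 0" using weighted_strain_eq_0_on_nonzero_set[OF y(2)] by simp
    then have "(\<Sum>j\<in>UNIV. (E i j y)\<^sup>2) = 0"
      unfolding S_def by (subst (asm) sum_nonneg_eq_0_iff) (auto intro: sum_nonneg)
    then have "(E i j y)\<^sup>2 = 0" by (subst (asm) sum_nonneg_eq_0_iff) auto
    then show "y \<in> {}" using \<open>E i j y \<noteq> 0\<close> by simp
  qed
  then have q0: "q y = 0" if "y \<in> G" for y using that q_nonneg[of y] by (auto simp: nonzero_set_def G_def)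
  have U0: "U k y = 0" if "y \<in> G" for k y using U_sq_le_q[of k y] q0[OF that] by simp
  have DU0: "DU l k y = 0" if y: "y \<in> G" for l k y
  proof -
    have "((\<lambda>t. U k (y + t *\<^sub>R axis l 1)) has_real_derivative 0) (at 0)"
    proof (rule has_field_derivative_transform_within_open[OF DERIV_const])
      show "open ((\<lambda>t. y + t *\<^sub>R axis l 1) -` G)" using G by (intro open_vimage continuous_intros)
    qed (use y U0 in auto)
    moreover have "((\<lambda>t. U k (y + t *\<^sub>R axis l 1)) has_real_derivative DU l k y) (at 0)"
      using U_C1[of l k] y by (auto simp: C1_along_def G_def)
    ultimately show ?thesis using DERIV_unique by blast
  qed
  have "x \<notin> G"
  proof
    assume "x \<in> G"
    then have "E i j x = 0" using E_eq[OF x, of i j] DU0 by simp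
    then show False using \<open>x \<in> G\<close> by (simp add: G_def)
  qed
  then show ?thesis using x by (auto simp: G_def)
qed

end

section \<open>The kernel of the linearized operator\<close>

lemma frontier_not_isolated:
  assumes "open \<Omega>" "p \<in> frontier \<Omega>"
  shows "at p within \<Omega> \<noteq> bot"
proof -
  have "p \<notin> \<Omega>" "p \<in> closure \<Omega>" using assms by (auto simp: frontier_def interior_open)
  then have "p islimpt \<Omega>" by (auto simp: closure_def)
  then show ?thesis by (simp add: trivial_limit_within)
qed

text \<open>The continuous representative of a null function is zero on all of \<open>\<Omega>\<close>; the limit is unique
  because a boundary point of an open set is a limit point of it.\<close>

lemma boundary_trace_ae_eq_0:
  fixes v :: "real^'n \<Rightarrow> real^'m"
  assumes "open \<Omega>" "ae_eq \<Omega> v (\<lambda>_. 0)" "p \<in> frontier \<Omega>"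
  shows "boundary_trace \<Omega> v p = 0"
  unfolding boundary_trace_def
proof (rule tendsto_Lim[OF frontier_not_isolated[OF assms(1,3)]])
  have "cont_rep \<Omega> v x = 0" if "x \<in> \<Omega>" for x
    using cont_rep_eq[OF assms(1) continuous_on_const ae_eq_sym[OF assms(2)] that] .
  then show "(cont_rep \<Omega> v \<longlongrightarrow> 0) (at p within \<Omega>)"
    by (intro tendsto_eventually) (auto simp: eventually_at_filter)
qed

lemma ae_eq_component: "ae_eq \<Omega> v (\<lambda>_. 0) \<Longrightarrow> ae_eq \<Omega> (\<lambda>x. v x $ i) (\<lambda>_. 0)"
  unfolding ae_eq_def by (auto elim: eventually_mono)

lemma ae_eq_vec:
  assumes "\<And>j. ae_eq \<Omega> (\<lambda>x. f x $ j) (\<lambda>x. g x $ j)"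
  shows "ae_eq \<Omega> f g"
proof -
  have "AE x in lebesgue_on \<Omega>. \<forall>j\<in>UNIV. f x $ j = g x $ j"
    using assms by (intro AE_finite_allI) (auto simp: ae_eq_def)
  then show ?thesis unfolding ae_eq_def by (auto simp: vec_eq_iff elim: eventually_mono)
qed

lemma ae_eq_sum:
  assumes "finite I" "\<And>i. i \<in> I \<Longrightarrow> ae_eq \<Omega> (f i) (g i)"
  shows "ae_eq \<Omega> (\<lambda>x. \<Sum>i\<in>I. f i x) (\<lambda>x. \<Sum>i\<in>I. g i x)"
proof -
  have "AE x in lebesgue_on \<Omega>. \<forall>i\<in>I. f i x = g i x"
    using assms by (intro AE_finite_allI) (auto simp: ae_eq_def)
  then show ?thesis unfolding ae_eq_def by (auto elim: eventually_mono)
qed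

lemma strain_ae_eq_0:
  assumes "open \<Omega>" "ae_eq \<Omega> v (\<lambda>_. 0)"
  shows "ae_eq \<Omega> (\<lambda>x. strain \<Omega> v x $ i $ j) (\<lambda>_. 0)"
  using weak_partial_ae_eq_0[OF assms(1) ae_eq_component[OF assms(2)], of i j]
    weak_partial_ae_eq_0[OF assms(1) ae_eq_component[OF assms(2)], of j i]
  unfolding ae_eq_def strain_def by eventually_elim simp

lemma weak_div_mat_ae_eq_0:
  assumes "open \<Omega>" "\<And>i j. ae_eq \<Omega> (\<lambda>x. A x $ i $ j) (\<lambda>_. 0)"
  shows "ae_eq \<Omega> (weak_div_mat \<Omega> A) (\<lambda>_. 0)"
proof (rule ae_eq_vec)
  fix j
  show "ae_eq \<Omega> (\<lambda>x. weak_div_mat \<Omega> A x $ j) (\<lambda>x. 0 $ j)"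
    using ae_eq_sum[OF finite weak_partial_ae_eq_0[OF assms(1,2)]] by (simp add: weak_div_mat_def)
qed

lemma ae_eq_mult_0:
  assumes "ae_eq \<Omega> f (\<lambda>_. 0) \<or> ae_eq \<Omega> g (\<lambda>_. 0)"
  shows "ae_eq \<Omega> (\<lambda>x. f x * g x :: real) (\<lambda>_. 0)"
  using assms unfolding ae_eq_def by (auto elim: eventually_mono)

lemma zero_triple_subset_ker:
  assumes "open \<Omega>"
  shows "zero_triple l \<Omega> \<subseteq> linearized_ker l \<Omega> \<mu> u\<^sub>1 u\<^sub>2"
proof safe
  fix m v\<^sub>1 v\<^sub>2 assume z: "(m, v\<^sub>1, v\<^sub>2) \<in> zero_triple l \<Omega>"
  have m: "ae_eq \<Omega> m (\<lambda>_. 0)" and v: "ae_eq \<Omega> v\<^sub>1 (\<lambda>_. 0)" "ae_eq \<Omega> v\<^sub>2 (\<lambda>_. 0)"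
    using z by (auto simp: zero_triple_def)
  have f: "ae_eq \<Omega> (\<lambda>x. 2 *\<^sub>R weak_div_mat \<Omega> (\<lambda>y. m y *\<^sub>R strain \<Omega> u y) x + 2 *\<^sub>R weak_div_mat \<Omega> (\<lambda>y. \<mu> y *\<^sub>R strain \<Omega> v y) x) (\<lambda>_. 0)"
    if "ae_eq \<Omega> v (\<lambda>_. 0)" for u v
  proof -
    have "ae_eq \<Omega> (weak_div_mat \<Omega> (\<lambda>y. m y *\<^sub>R strain \<Omega> u y)) (\<lambda>_. 0)"
      "ae_eq \<Omega> (weak_div_mat \<Omega> (\<lambda>y. \<mu> y *\<^sub>R strain \<Omega> v y)) (\<lambda>_. 0)"
      using m strain_ae_eq_0[OF assms that] by (auto intro!: weak_div_mat_ae_eq_0[OF assms] ae_eq_mult_0)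
    then show ?thesis unfolding ae_eq_def by eventually_elim simp
  qed
  show "(m, v\<^sub>1, v\<^sub>2) \<in> linearized_ker l \<Omega> \<mu> u\<^sub>1 u\<^sub>2"
    using z v f[OF v(1)] f[OF v(2)] boundary_trace_ae_eq_0[OF assms v(1)] boundary_trace_ae_eq_0[OF assms v(2)]
    by (simp add: linearized_ker_def linearized_op_def zero_triple_def)
qed

text \<open>For \<open>l \<ge> 2\<close>, the embedding makes \<open>m\<close> and the strain continuously differentiable in \<open>\<Omega>\<close>. Hence the
  weak divergence is the classical one, and it vanishes everywhere because it is continuous.\<close>

lemma divergence_free_weighted_strain_eq_0:
  fixes \<Omega> :: "(real^3) set" and m :: "real^3 \<Rightarrow> real" and u :: "real^3 \<Rightarrow> real^3"
  assumes \<Omega>: "open \<Omega>" "bounded \<Omega>" and l: "l \<ge> 2"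
    and m: "m \<in> sobolev (l+1) \<Omega>" and u: "u \<in> sobolev_vec (l+2) \<Omega>"
    and trace: "has_boundary_trace \<Omega> u (\<lambda>_. 0)"
    and div: "ae_eq \<Omega> (weak_div_mat \<Omega> (\<lambda>y. m y *\<^sub>R strain \<Omega> u y)) (\<lambda>_. 0)"
    and x: "x \<in> \<Omega>"
  shows "smooth_rep \<Omega> m x = 0 \<or> cont_rep \<Omega> (strain \<Omega> u) x = 0"
proof -
  define M where "M = smooth_rep \<Omega> m"
  define DM where "DM i = smooth_rep \<Omega> (weak_partial \<Omega> i m)" for i
  define U where "U j = smooth_rep \<Omega> (\<lambda>y. u y $ j)" for j
  define d where "d i j = weak_partial \<Omega> i (\<lambda>y. u y $ j)" for i j
  define DU where "DU i j = smooth_rep \<Omega> (d i j)" for i j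
  define DDU where "DDU k i j = smooth_rep \<Omega> (weak_partial \<Omega> k (d i j))" for k i j
  define E where "E i j x = (DU i j x + DU j i x) * (1/2)" for i j x
  define DE where "DE k i j x = (DDU k i j x + DDU k j i x) * (1/2)" for k i j x
  have uj: "(\<lambda>y. u y $ j) \<in> sobolev (Suc (Suc l)) \<Omega>" for j using u by (simp add: sobolev_vec_def)
  have d: "d i j \<in> sobolev (Suc l) \<Omega>" for i j unfolding d_def by (rule weak_partial_sobolev(1)[OF \<Omega>(1) uj])
  have dd: "weak_partial \<Omega> k (d i j) \<in> sobolev l \<Omega>" for k i j by (rule weak_partial_sobolev(1)[OF \<Omega>(1) d])
  have ms: "m \<in> sobolev (Suc l) \<Omega>" using m by simp
  have M: "C1_along i \<Omega> M (DM i)" for i unfolding M_def DM_def by (rule smooth_rep_C1[OF \<Omega>(1) ms l])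
  have U: "C1_along i \<Omega> (U j) (DU i j)" for i j
    unfolding U_def DU_def d_def using smooth_rep_C1[OF \<Omega>(1) uj] l by simp
  have DU: "C1_along k \<Omega> (DU i j) (DDU k i j)" for k i j
    unfolding DU_def DDU_def by (rule smooth_rep_C1[OF \<Omega>(1) d l])
  have ae_M: "ae_eq \<Omega> M m" unfolding M_def using smooth_rep_sobolev(2)[OF \<Omega>(1) ms] l by simp
  have ae_U: "ae_eq \<Omega> (U j) (\<lambda>y. u y $ j)" for j unfolding U_def using smooth_rep_sobolev(2)[OF \<Omega>(1) uj] l by simp
  have ae_DU: "ae_eq \<Omega> (DU i j) (d i j)" for i j unfolding DU_def using smooth_rep_sobolev(2)[OF \<Omega>(1) d] l by simp
  have ae_DDU: "ae_eq \<Omega> (DDU k i j) (weak_partial \<Omega> k (d i j))" for k i j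
    unfolding DDU_def by (rule smooth_rep_sobolev(2)[OF \<Omega>(1) dd l])
  have L2_M: "M \<in> L2 \<Omega>" by (rule L2_ae_eq[OF \<Omega>(1) sobolev_L2[OF ms] ae_eq_sym[OF ae_M]])
  have L2_DU: "DU i j \<in> L2 \<Omega>" for i j by (rule L2_ae_eq[OF \<Omega>(1) sobolev_L2[OF d] ae_eq_sym[OF ae_DU]])
  have L2_DDU: "DDU k i j \<in> L2 \<Omega>" for k i j by (rule L2_ae_eq[OF \<Omega>(1) sobolev_L2[OF dd] ae_eq_sym[OF ae_DDU]])
  have L2_mean: "(\<lambda>x. (f x + g x) * (1/2)) \<in> L2 \<Omega>" if f: "f \<in> L2 \<Omega>" and g: "g \<in> L2 \<Omega>" for f g
  proof -
    have "integrable (lebesgue_on \<Omega>) (\<lambda>x. ((f x)\<^sup>2 + 2 * (f x * g x) + (g x)\<^sup>2) * (1/4))"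
      using f g L2_mult_integrable[OF f g] by (auto simp: L2_def)
    moreover have "((f x + g x) * (1/2))\<^sup>2 = ((f x)\<^sup>2 + 2 * (f x * g x) + (g x)\<^sup>2) * (1/4)" for x
      by (simp add: power2_eq_square field_simps)
    ultimately have "integrable (lebesgue_on \<Omega>) (\<lambda>x. ((f x + g x) * (1/2))\<^sup>2)" by (simp only:)
    then show ?thesis using f g by (auto simp: L2_def)
  qed
  have E_C1: "C1_along k \<Omega> (E i j) (DE k i j)" for k i j
    using DU[of k i j] DU[of k j i] unfolding C1_along_def E_def[abs_def] DE_def[abs_def]
    by (intro conjI ballI continuous_intros DERIV_cmult_right DERIV_add) simp_all
  have ae_E: "ae_eq \<Omega> (E i j) (\<lambda>x. strain \<Omega> u x $ i $ j)" for i j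
    using ae_DU[of i j] ae_DU[of j i] unfolding ae_eq_def by eventually_elim (simp add: E_def strain_def d_def)
  have W: "C1_along i \<Omega> (\<lambda>x. M x * E i j x) (\<lambda>x. M x * DE i i j x + DM i x * E i j x)" for i j
    by (intro C1_along_mult M E_C1)
  have W_ae: "ae_eq \<Omega> (weak_partial \<Omega> i (\<lambda>y. (m y *\<^sub>R strain \<Omega> u y) $ i $ j)) (\<lambda>x. M x * DE i i j x + DM i x * E i j x)" for i j
  proof (rule weak_partial_ae_eq[OF \<Omega>(1) C1_along_imp_has_weak_deriv[OF \<Omega>(1) W]])
    show "ae_eq \<Omega> (\<lambda>x. M x * E i j x) (\<lambda>y. (m y *\<^sub>R strain \<Omega> u y) $ i $ j)"
      using ae_M ae_E[of i j] unfolding ae_eq_def by eventually_elim simp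
  qed
  have div0: "(\<Sum>i\<in>UNIV. M x * DE i i j x + DM i x * E i j x) = 0" if "x \<in> \<Omega>" for j x
  proof (rule ae_eq_continuous_imp_eq[OF \<Omega>(1) _ _ continuous_on_const that])
    show "continuous_on \<Omega> (\<lambda>x. \<Sum>i\<in>UNIV. M x * DE i i j x + DM i x * E i j x)"
      using W by (intro continuous_on_sum) (simp add: C1_along_def)
    have "ae_eq \<Omega> (\<lambda>x. \<Sum>i\<in>UNIV. M x * DE i i j x + DM i x * E i j x) (\<lambda>x. weak_div_mat \<Omega> (\<lambda>y. m y *\<^sub>R strain \<Omega> u y) x $ j)"
      unfolding weak_div_mat_def vec_lambda_beta by (rule ae_eq_sum[OF finite ae_eq_sym[OF W_ae]])
    then show "ae_eq \<Omega> (\<lambda>x. \<Sum>i\<in>UNIV. M x * DE i i j x + DM i x * E i j x) (\<lambda>_. 0)"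
      by (rule ae_eq_trans) (rule ae_eq_component[OF div])
  qed
  have cont_U: "continuous_on \<Omega> (U j)" for j using U by (simp add: C1_along_def)
  have rep_u: "cont_rep \<Omega> u x = (\<chi> j. U j x)" if "x \<in> \<Omega>" for x
    by (rule cont_rep_eq[OF \<Omega>(1) _ _ that]) (use cont_U ae_U in \<open>auto intro!: continuous_on_vec_lambda ae_eq_vec\<close>)
  have boundary: "(U j \<longlongrightarrow> 0) (at p within \<Omega>)" if "p \<in> frontier \<Omega>" for j p
  proof -
    have lim: "((\<lambda>x. cont_rep \<Omega> u x $ j) \<longlongrightarrow> 0 $ j) (at p within \<Omega>)"
      using trace that by (intro tendsto_vec_nth) (simp add: has_boundary_trace_def)
    have "\<forall>\<^sub>F x in at p within \<Omega>. cont_rep \<Omega> u x $ j = U j x"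
      by (auto simp: eventually_at_filter rep_u)
    from Lim_transform_eventually[OF lim this] show ?thesis by simp
  qed
  interpret weighted_strain \<Omega> M DM U DU E DE
  proof
    show "E i j \<in> L2 \<Omega>" "DE k i j \<in> L2 \<Omega>" for i j k
      unfolding E_def[abs_def] DE_def[abs_def] by (intro L2_mean L2_DU L2_DDU)+
    show "E i j x = (DU i j x + DU j i x) / 2" for i j x by (simp add: E_def)
  qed (use \<Omega> M U E_C1 L2_M L2_DU div0 boundary in auto)
  have "continuous_on \<Omega> (E i j)" for i j using E_C1 by (simp add: C1_along_def)
  then have "cont_rep \<Omega> (strain \<Omega> u) x = (\<chi> i j. E i j x)"
    using ae_E by (intro cont_rep_eq[OF \<Omega>(1) _ _ x] continuous_on_vec_lambda ae_eq_vec) simp_all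
  then show ?thesis using weighted_strain_eq_0[OF x] by (auto simp: M_def vec_eq_iff)
qed

theorem corollary5:
  fixes l :: nat and \<Omega> :: "(real^3) set"
    and lam \<mu> :: "real^3 \<Rightarrow> real"
    and u\<^sub>1 u\<^sub>2 F\<^sub>1 F\<^sub>2 :: "real^3 \<Rightarrow> real^3"
  assumes "l > 0" and "2 * l > 3"
    and "bounded_Ck_domain (l+2) \<Omega>"
    and "\<mu> \<in> sobolev (l+1) \<Omega>"
    and "u\<^sub>1 \<in> sobolev_vec (l+2) \<Omega>" and "u\<^sub>2 \<in> sobolev_vec (l+2) \<Omega>"
    and "\<not> ae_eq \<Omega> u\<^sub>1 u\<^sub>2" and "\<not> ae_eq \<Omega> F\<^sub>1 F\<^sub>2"
    and "quasi_static_deformation \<Omega> lam \<mu> F\<^sub>1 u\<^sub>1"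
    and "quasi_static_deformation \<Omega> lam \<mu> F\<^sub>2 u\<^sub>2"
    and "\<forall>x\<in>\<Omega>. det (cont_rep \<Omega> (strain \<Omega> u\<^sub>1) x) \<noteq> 0 \<or>
               det (cont_rep \<Omega> (strain \<Omega> u\<^sub>2) x) \<noteq> 0"
  shows "linearized_ker l \<Omega> \<mu> u\<^sub>1 u\<^sub>2 = zero_triple l \<Omega>"
proof
  have \<Omega>: "open \<Omega>" "bounded \<Omega>" using assms(3) by (auto simp: bounded_Ck_domain_def)
  have l: "l \<ge> 2" using assms(2) by simp
  show "zero_triple l \<Omega> \<subseteq> linearized_ker l \<Omega> \<mu> u\<^sub>1 u\<^sub>2" by (rule zero_triple_subset_ker[OF \<Omega>(1)])
  show "linearized_ker l \<Omega> \<mu> u\<^sub>1 u\<^sub>2 \<subseteq> zero_triple l \<Omega>"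
  proof safe
    fix m v\<^sub>1 v\<^sub>2 assume "(m, v\<^sub>1, v\<^sub>2) \<in> linearized_ker l \<Omega> \<mu> u\<^sub>1 u\<^sub>2"
    then have dom: "(m, v\<^sub>1, v\<^sub>2) \<in> linearized_dom l \<Omega>"
      and v: "ae_eq \<Omega> v\<^sub>1 (\<lambda>_. 0)" "ae_eq \<Omega> v\<^sub>2 (\<lambda>_. 0)"
      and f: "ae_eq \<Omega> (\<lambda>x. 2 *\<^sub>R weak_div_mat \<Omega> (\<lambda>y. m y *\<^sub>R strain \<Omega> u\<^sub>1 y) x
          + 2 *\<^sub>R weak_div_mat \<Omega> (\<lambda>y. \<mu> y *\<^sub>R strain \<Omega> v\<^sub>1 y) x) (\<lambda>_. 0)"
        "ae_eq \<Omega> (\<lambda>x. 2 *\<^sub>R weak_div_mat \<Omega> (\<lambda>y. m y *\<^sub>R strain \<Omega> u\<^sub>2 y) x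
          + 2 *\<^sub>R weak_div_mat \<Omega> (\<lambda>y. \<mu> y *\<^sub>R strain \<Omega> v\<^sub>2 y) x) (\<lambda>_. 0)"
      by (auto simp: linearized_ker_def linearized_op_def)
    have m: "m \<in> sobolev (l+1) \<Omega>" using dom by (simp add: linearized_dom_def)
    have div: "ae_eq \<Omega> (weak_div_mat \<Omega> (\<lambda>y. m y *\<^sub>R strain \<Omega> u y)) (\<lambda>_. 0)"
      if v: "ae_eq \<Omega> v (\<lambda>_. 0)" and f: "ae_eq \<Omega> (\<lambda>x. 2 *\<^sub>R weak_div_mat \<Omega> (\<lambda>y. m y *\<^sub>R strain \<Omega> u y) x
          + 2 *\<^sub>R weak_div_mat \<Omega> (\<lambda>y. \<mu> y *\<^sub>R strain \<Omega> v y) x) (\<lambda>_. 0)" for u v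
    proof -
      have "ae_eq \<Omega> (weak_div_mat \<Omega> (\<lambda>y. \<mu> y *\<^sub>R strain \<Omega> v y)) (\<lambda>_. 0)"
        using strain_ae_eq_0[OF \<Omega>(1) v] by (auto intro!: weak_div_mat_ae_eq_0[OF \<Omega>(1)] ae_eq_mult_0)
      with f show ?thesis unfolding ae_eq_def by eventually_elim simp
    qed
    have trace: "has_boundary_trace \<Omega> u\<^sub>1 (\<lambda>_. 0)" "has_boundary_trace \<Omega> u\<^sub>2 (\<lambda>_. 0)"
      using assms(9,10) by (auto simp: quasi_static_deformation_def)
    have "smooth_rep \<Omega> m x = 0" if x: "x \<in> \<Omega>" for x
    proof -
      \<comment> \<open>At each point one of the two strains is invertible, in particular nonzero.\<close>
      have "det (0 :: real^3^3) = 0" by (simp add: det_3)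
      then show ?thesis
        using divergence_free_weighted_strain_eq_0[OF \<Omega> l m assms(5) trace(1) div[OF v(1) f(1)] x]
          divergence_free_weighted_strain_eq_0[OF \<Omega> l m assms(6) trace(2) div[OF v(2) f(2)] x]
          assms(11) x by metis
    qed
    moreover have "ae_eq \<Omega> (smooth_rep \<Omega> m) m" by (rule smooth_rep_sobolev(2)[OF \<Omega>(1) m]) (use l in simp)
    ultimately have "ae_eq \<Omega> m (\<lambda>_. 0)"
      by (auto simp: ae_eq_iff_negligible[OF \<Omega>(1)] elim!: negligible_subset)
    then show "(m, v\<^sub>1, v\<^sub>2) \<in> zero_triple l \<Omega>" using dom v by (simp add: zero_triple_def)
  qed
qed

end
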